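(* For $n\ge 5$, the special outer automorphism group ${\rm Out}^+(\mathbf{F}_n)$ is not strongly relatively hyperbolic.
   Context: $\mathbf{F}_n$ is the free group on $n$ generators. Abelianisation gives a surjective homomorphism ${\rm Aut}(\mathbf{F}_n)\to {\rm Aut}(\mathbf{Z}^n)={\rm GL}(n,\mathbf{Z})$; composing with the determinant ${\rm GL}(n,\mathbf{Z})\to\{\pm1\}$ gives $\varphi:{\rm Aut}(\mathbf{F}_n)\to\{\pm 1\}$. The special automorphism group is ${\rm Aut}^+(\mathbf{F}_n)=\ker(\varphi)$, and the special outer automorphism group is ${\rm Out}^+(\mathbf{F}_n)={\rm Aut}^+(\mathbf{F}_n)/{\rm Inn}(\mathbf{F}_n)$, where ${\rm Inn}(\mathbf{F}_n)$ is the group of inner automorphisms. A finitely generated group is called not strongly relatively hyperbolic if it is not strongly hyperbolic relative to any finite collection of proper finitely generated subgroups. Here a group $G$ is strongly hyperbolic relative to a family $L_1,\dots,L_m$ ($m\ge 1$) of proper finitely generated subgroups if $G$ admits an action on a connected graph $\mathcal{G}$ such that: $\mathcal{G}$ (with all edges of length one) is hyperbolic in the sense of Gromov; $\mathcal{G}$ is fine, i.e. for each $n\in\mathbf{N}$ each edge of $\mathcal{G}$ belongs to only finitely many circuits (closed edge paths without repeated vertices) of length $n$; there are only finitely many $G$-orbits of edges; each edge stabiliser is finite; and the stabilisers of the vertices of infinite valence are precisely the conjugates of the $L_j$. *)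

theory Defs
  imports
    "HOL-Algebra.Generated_Groups"
    "HOL-Algebra.Group_Action"
    "HOL-Algebra.Sym_Groups"
    "Jordan_Normal_Form.Determinant"
begin

section \<open>Free groups\<close>

text \<open>The letter \<open>(i, True)\<close> is the generator \<open>x\<^sub>i\<close>, and \<open>(i, False)\<close> is its inverse.\<close>

type_synonym letter = "nat \<times> bool"

definition inv_letter :: "letter \<Rightarrow> letter"
  where "inv_letter a = (fst a, \<not> snd a)"

definition reduced :: "letter list \<Rightarrow> bool"
  where "reduced w \<longleftrightarrow> successively (\<lambda>a b. b \<noteq> inv_letter a) w"

definition rcons :: "letter \<Rightarrow> letter list \<Rightarrow> letter list"
  where "rcons a w = (if w \<noteq> [] \<and> hd w = inv_letter a then tl w else a # w)"

text \<open>The free group on \<open>x\<^sub>0, \<dots>, x\<^bsub>n-1\<^esub>\<close>: reduced words, multiplied by concatenation followed by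
  free reduction.\<close>

definition free_group :: "nat \<Rightarrow> letter list monoid"
  where "free_group n =
    \<lparr>carrier = {w. reduced w \<and> fst ` set w \<subseteq> {..<n}}, monoid.mult = foldr rcons, one = []\<rparr>"

lemma reduced_Nil [simp]: "reduced []"
  by (simp add: reduced_def)

lemma reduced_Cons: "reduced (a # w) \<longleftrightarrow> reduced w \<and> (w \<noteq> [] \<longrightarrow> hd w \<noteq> inv_letter a)"
  by (cases w) (auto simp: reduced_def)

lemma inv_letter_inv_letter [simp]: "inv_letter (inv_letter a) = a"
  by (simp add: inv_letter_def)

lemma fst_inv_letter [simp]: "fst (inv_letter a) = fst a"
  by (simp add: inv_letter_def)

lemma reduced_rcons: "reduced w \<Longrightarrow> reduced (rcons a w)"
  by (cases w) (auto simp: rcons_def reduced_Cons)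

lemma set_rcons: "set (rcons a w) \<subseteq> insert a (set w)"
  by (cases w) (auto simp: rcons_def)

lemma rcons_cancel: "reduced w \<Longrightarrow> rcons (inv_letter a) (rcons a w) = w"
  by (cases w) (auto simp: rcons_def reduced_Cons)

lemma rcons_reduced: "reduced (a # w) \<Longrightarrow> rcons a w = a # w"
  by (auto simp: rcons_def reduced_Cons)

lemma reduced_foldr: "reduced w \<Longrightarrow> reduced (foldr rcons v w)"
  by (induction v) (auto intro: reduced_rcons)

lemma set_foldr: "set (foldr rcons v w) \<subseteq> set v \<union> set w"
proof (induction v)
  case (Cons a v)
  then show ?case using set_rcons[of a "foldr rcons v w"] by auto
qed simp

lemma foldr_rcons: 
  assumes "reduced w"
  shows "foldr rcons (rcons a v) w = rcons a (foldr rcons v w)"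
proof (cases "v \<noteq> [] \<and> hd v = inv_letter a")
  case True
  then obtain v' where v: "v = inv_letter a # v'" by (cases v) auto
  show ?thesis
    using rcons_cancel[OF reduced_foldr[OF assms], of "inv_letter a" v'] by (simp add: v rcons_def)
qed (auto simp: rcons_def)

lemma foldr_assoc:
  assumes "reduced w"
  shows "foldr rcons (foldr rcons u v) w = foldr rcons u (foldr rcons v w)"
  by (induction u) (auto simp: foldr_rcons assms)

lemma foldr_Nil_right: "reduced v \<Longrightarrow> foldr rcons v [] = v"
  by (induction v) (auto simp: rcons_reduced reduced_Cons[of _ "_ :: letter list"])

lemma foldr_inverse: "reduced w \<Longrightarrow> foldr rcons (rev (map inv_letter v)) (foldr rcons v w) = w"
  by (induction v arbitrary: w) (auto simp: rcons_cancel reduced_foldr)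

lemma group_free_group: "group (free_group n)"
proof (rule groupI)
  fix x y assume "x \<in> carrier (free_group n)" "y \<in> carrier (free_group n)"
  then show "x \<otimes>\<^bsub>free_group n\<^esub> y \<in> carrier (free_group n)"
    using set_foldr[of x y] by (fastforce simp: free_group_def reduced_foldr)
next
  fix x assume x: "x \<in> carrier (free_group n)"
  define y where "y = foldr rcons (rev (map inv_letter x)) []"
  have "y \<in> carrier (free_group n)"
    using x set_foldr[of "rev (map inv_letter x)" "[]"]
    by (fastforce simp: free_group_def y_def reduced_foldr)
  moreover have "y \<otimes>\<^bsub>free_group n\<^esub> x = \<one>\<^bsub>free_group n\<^esub>"
    using x foldr_inverse[of "[]" x]
    by (simp add: free_group_def y_def foldr_assoc foldr_Nil_right)
  ultimately show "\<exists>y\<in>carrier (free_group n). y \<otimes>\<^bsub>free_group n\<^esub> x = \<one>\<^bsub>free_group n\<^esub>" by blast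
qed (auto simp: free_group_def foldr_assoc)


section \<open>The special outer automorphism group\<close>

definition exponent_sum :: "nat \<Rightarrow> letter list \<Rightarrow> int"
  where "exponent_sum i w = int (count_list w (i, True)) - int (count_list w (i, False))"

text \<open>The abelianisation of the free group is the map
  \<open>w \<mapsto> (exponent_sum 0 w, \<dots>, exponent_sum (n - 1) w)\<close> onto \<open>\<int>\<^sup>n\<close>. An automorphism \<open>f\<close> therefore acts
  on \<open>\<int>\<^sup>n\<close> by the matrix whose \<open>j\<close>-th column is the abelianisation of \<open>f x\<^sub>j\<close>.\<close>

definition abelianised_matrix :: "nat \<Rightarrow> (letter list \<Rightarrow> letter list) \<Rightarrow> int mat"
  where "abelianised_matrix n f = mat n n (\<lambda>(i, j). exponent_sum i (f [(j, True)]))"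

definition aut_sign :: "nat \<Rightarrow> (letter list \<Rightarrow> letter list) \<Rightarrow> int"
  where "aut_sign n f = det (abelianised_matrix n f)"

text \<open>\<^const>\<open>sign_img\<close> is the multiplicative group \<open>{-1, 1}\<close>.\<close>

definition Aut_plus :: "nat \<Rightarrow> (letter list \<Rightarrow> letter list) monoid"
  where "Aut_plus n = AutoGroup (free_group n)
    \<lparr>carrier := kernel (AutoGroup (free_group n)) sign_img (aut_sign n)\<rparr>"

definition Inn :: "('a, 'b) monoid_scheme \<Rightarrow> ('a \<Rightarrow> 'a) set"
  where "Inn G = {\<lambda>x\<in>carrier G. g \<otimes>\<^bsub>G\<^esub> x \<otimes>\<^bsub>G\<^esub> inv\<^bsub>G\<^esub> g | g. g \<in> carrier G}"

definition Out_plus :: "nat \<Rightarrow> (letter list \<Rightarrow> letter list) set monoid"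
  where "Out_plus n = Aut_plus n Mod Inn (free_group n)"


section \<open>Graphs\<close>

text \<open>Undirected graphs; loops and multiple edges are allowed.\<close>

record ('v, 'e) graph =
  verts :: "'v set"
  edges :: "'e set"
  ends :: "'e \<Rightarrow> 'v set"

definition wf_graph :: "('v, 'e) graph \<Rightarrow> bool"
  where "wf_graph K \<longleftrightarrow> (\<forall>e\<in>edges K. ends K e \<subseteq> verts K \<and> card (ends K e) \<in> {1, 2})"

definition edge_path :: "('v, 'e) graph \<Rightarrow> 'v list \<Rightarrow> 'e list \<Rightarrow> bool"
  where "edge_path K vs es \<longleftrightarrow>
    length vs = Suc (length es) \<and> set vs \<subseteq> verts K \<and> set es \<subseteq> edges K \<and>
    (\<forall>i<length es. ends K (es ! i) = {vs ! i, vs ! Suc i})"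

definition connected_graph :: "('v, 'e) graph \<Rightarrow> bool"
  where "connected_graph K \<longleftrightarrow>
    (\<forall>u\<in>verts K. \<forall>v\<in>verts K. \<exists>vs es. edge_path K vs es \<and> hd vs = u \<and> last vs = v)"

text \<open>The path metric in which every edge has length one.\<close>

definition graph_dist :: "('v, 'e) graph \<Rightarrow> 'v \<Rightarrow> 'v \<Rightarrow> nat"
  where "graph_dist K u v =
    (LEAST n. \<exists>vs es. edge_path K vs es \<and> hd vs = u \<and> last vs = v \<and> length es = n)"

definition gromov_product :: "('a \<Rightarrow> 'a \<Rightarrow> real) \<Rightarrow> 'a \<Rightarrow> 'a \<Rightarrow> 'a \<Rightarrow> real"
  where "gromov_product d w x y = (d x w + d y w - d x y) / 2"

definition gromov_hyperbolic :: "'a set \<Rightarrow> ('a \<Rightarrow> 'a \<Rightarrow> real) \<Rightarrow> bool"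
  where "gromov_hyperbolic M d \<longleftrightarrow>
    (\<exists>\<delta>\<ge>0. \<forall>w\<in>M. \<forall>x\<in>M. \<forall>y\<in>M. \<forall>z\<in>M.
      gromov_product d w x z \<ge> min (gromov_product d w x y) (gromov_product d w y z) - \<delta>)"

text \<open>Hyperbolicity is imposed on the vertex set with the path metric. Every point of the metric
  graph is within \<open>1/2\<close> of a vertex, so including the interiors of edges would only change \<open>\<delta>\<close>.\<close>

definition hyperbolic_graph :: "('v, 'e) graph \<Rightarrow> bool"
  where "hyperbolic_graph K \<longleftrightarrow> gromov_hyperbolic (verts K) (\<lambda>u v. real (graph_dist K u v))"

text \<open>A circuit comes with a base point and a direction, which multiplies the number of circuits
  of length \<open>n\<close> by at most \<open>2 * n\<close>. Traversing an edge back and forth counts as a circuit of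
  length two; each edge lies on only two of these.\<close>

definition circuit :: "('v, 'e) graph \<Rightarrow> 'v list \<Rightarrow> 'e list \<Rightarrow> bool"
  where "circuit K vs es \<longleftrightarrow> edge_path K vs es \<and> hd vs = last vs \<and> distinct (tl vs)"

definition fine_graph :: "('v, 'e) graph \<Rightarrow> bool"
  where "fine_graph K \<longleftrightarrow>
    (\<forall>n. \<forall>e\<in>edges K. finite {(vs, es). circuit K vs es \<and> length es = n \<and> e \<in> set es})"

definition infinite_valence :: "('v, 'e) graph \<Rightarrow> 'v \<Rightarrow> bool"
  where "infinite_valence K v \<longleftrightarrow> infinite {e \<in> edges K. v \<in> ends K e}"

definition graph_action ::
    "('g, 'b) monoid_scheme \<Rightarrow> ('v, 'e) graph \<Rightarrow> ('g \<Rightarrow> 'v \<Rightarrow> 'v) \<Rightarrow> ('g \<Rightarrow> 'e \<Rightarrow> 'e) \<Rightarrow> bool"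
  where "graph_action G K \<alpha> \<beta> \<longleftrightarrow>
    group_action G (verts K) \<alpha> \<and> group_action G (edges K) \<beta> \<and>
    (\<forall>g\<in>carrier G. \<forall>e\<in>edges K. ends K (\<beta> g e) = \<alpha> g ` ends K e)"


section \<open>Strong relative hyperbolicity\<close>

definition finitely_generated_subgroup :: "'g set \<Rightarrow> ('g, 'b) monoid_scheme \<Rightarrow> bool"
  where "finitely_generated_subgroup H G \<longleftrightarrow>
    subgroup H G \<and> (\<exists>S. finite S \<and> S \<subseteq> carrier G \<and> H = generate G S)"

text \<open>HOL cannot quantify existentially over types, so the types of the vertices and edges of the
  graph are parameters. A negated instance with free type variables excludes graphs over all
  types.\<close>

definition strongly_relatively_hyperbolic ::
    "'v itself \<Rightarrow> 'e itself \<Rightarrow> ('g, 'b) monoid_scheme \<Rightarrow> 'g set set \<Rightarrow> bool"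
  where "strongly_relatively_hyperbolic tv te G \<L> \<longleftrightarrow>
    finite \<L> \<and> \<L> \<noteq> {} \<and>
    (\<forall>L\<in>\<L>. finitely_generated_subgroup L G \<and> L \<noteq> carrier G) \<and>
    (\<exists>(K :: ('v, 'e) graph) \<alpha> \<beta>.
      wf_graph K \<and> connected_graph K \<and> graph_action G K \<alpha> \<beta> \<and>
      hyperbolic_graph K \<and> fine_graph K \<and>
      finite (orbits G (edges K) \<beta>) \<and>
      (\<forall>e\<in>edges K. finite (stabilizer G \<beta> e)) \<and>
      {stabilizer G \<alpha> v | v. v \<in> verts K \<and> infinite_valence K v} =
        {g <#\<^bsub>G\<^esub> L #>\<^bsub>G\<^esub> inv\<^bsub>G\<^esub> g | g L. g \<in> carrier G \<and> L \<in> \<L>})"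

definition not_strongly_relatively_hyperbolic ::
    "'v itself \<Rightarrow> 'e itself \<Rightarrow> ('g, 'b) monoid_scheme \<Rightarrow> bool"
  where "not_strongly_relatively_hyperbolic tv te G \<longleftrightarrow>
    group G \<and> finitely_generated_subgroup (carrier G) G \<and>
    \<not> (\<exists>\<L>. strongly_relatively_hyperbolic tv te G \<L>)"

end

theory Submission
  imports Defs "HOL-Library.Sublist"
begin

text \<open>Let a group act on a fine hyperbolic graph with finite edge stabilisers and finitely many orbits of
  edges. Fineness makes the action acylindrical, so an element \<open>a\<close> that commutes with a copy of \<open>\<int>\<^sup>2\<close>
  has bounded orbits: otherwise that \<open>\<int>\<^sup>2\<close>, which grows quadratically, would translate along a long
  geodesic \<open>[x, a\<^sup>k x]\<close> with only linearly many possible translation lengths. By fineness again, an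
  element of infinite order with bounded orbits fixes a vertex, this vertex is unique, and it is therefore
  fixed by all commuting elements. In the special outer automorphism group the transvections have infinite
  order, any two of them commute with a third one, and each commutes with a \<open>\<int>\<^sup>2\<close>; so they have a common
  fixed vertex. By Nielsen's theorem the transvections generate the group together with finitely many signed
  permutations of the generators, which normalise the set of transvections. Hence the whole group fixes a
  vertex of infinite valence and equals a conjugate of one of the proper subgroups.\<close>

section \<open>Walks and circuits\<close>

text \<open>The bound n >= 5 comes from the linking step: two transvections involve at most four
  generators, so a fifth is free to be altered by a transvection commuting with both. The signed
  permutations have finite order, where uniqueness of fixed vertices may fail; they are reached only
  through the fact that conjugation by them permutes the transvections, which moves fixed vertices
  along. In place of a theory of loxodromic elements and boundaries, hyperbolicity is used only as a
  four-point inequality for distances. The count against quadratic growth succeeds because a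
  translation along a geodesic is recorded as one position, with linearly many values, and one
  correction of bounded range. The common fixed vertex must have infinite valence before its
  stabiliser is known to be a conjugate of a peripheral subgroup; this holds because an element of
  infinite order that fixes it moves an incident edge to infinitely many others. Infinite order and
  independence in the outer group are read off from exponent sums, which inner automorphisms do not
  change.\<close>

fun walk :: "('v, 'e) graph \<Rightarrow> 'v \<Rightarrow> ('e \<times> 'v) list \<Rightarrow> 'v \<Rightarrow> bool" where
  "walk K u [] v \<longleftrightarrow> u = v \<and> u \<in> verts K"
| "walk K u ((e, w) # ps) v \<longleftrightarrow> e \<in> edges K \<and> ends K e = {u, w} \<and> u \<in> verts K \<and> walk K w ps v"

lemma walk_append: "walk K u (ps @ qs) v \<longleftrightarrow> (\<exists>w. walk K u ps w \<and> walk K w qs v)"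
proof (induction ps arbitrary: u)
  case Nil
  then show ?case by (cases qs) auto
qed auto

lemma walk_verts: "walk K u ps v \<Longrightarrow> u \<in> verts K \<and> v \<in> verts K \<and> snd ` set ps \<subseteq> verts K"
  by (induction K u ps v rule: walk.induct) auto

lemma walk_last: "walk K u ps v \<Longrightarrow> v = last (u # map snd ps)"
  by (induction K u ps v rule: walk.induct) auto

lemma walk_edges: "walk K u ps v \<Longrightarrow> fst ` set ps \<subseteq> edges K"
  by (induction K u ps v rule: walk.induct) auto

lemma walk_rev:
  "walk K u ps v \<Longrightarrow> \<exists>qs. walk K v qs u \<and> length qs = length ps \<and> fst ` set qs = fst ` set ps \<and>
    insert v (snd ` set qs) = insert u (snd ` set ps)"
proof (induction ps arbitrary: u)
  case (Cons p ps)
  obtain e w where p: "p = (e, w)" by force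
  have "walk K w ps v" using Cons.prems p by simp
  from Cons.IH[OF this] obtain qs where qs: "walk K v qs w" "length qs = length ps" "fst ` set qs = fst ` set ps"
    "insert v (snd ` set qs) = insert w (snd ` set ps)" by blast
  have "walk K w [(e, u)] u"
    using Cons.prems p walk_verts[of K w ps v] by (auto simp: insert_commute)
  then have "walk K v (qs @ [(e, u)]) u" using qs(1) by (auto simp: walk_append)
  moreover have "insert v (snd ` set (qs @ [(e, u)])) = insert u (snd ` set (p # ps))"
    using qs(4) p by auto
  ultimately show ?case using qs p by (intro exI[of _ "qs @ [(e, u)]"]) auto
qed auto

lemma edge_path_walk: "walk K u ps v \<Longrightarrow> edge_path K (u # map snd ps) (map fst ps)"
proof (induction ps arbitrary: u)
  case (Cons p ps)
  obtain e w where p: "p = (e, w)" by force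
  then have IH: "edge_path K (w # map snd ps) (map fst ps)" using Cons by auto
  show ?case
    unfolding edge_path_def
  proof (intro conjI allI impI)
    fix i assume "i < length (map fst (p # ps))"
    then show "ends K (map fst (p # ps) ! i) = {(u # map snd (p # ps)) ! i, (u # map snd (p # ps)) ! Suc i}"
      using IH Cons.prems p by (cases i) (auto simp: edge_path_def)
  qed (use IH Cons.prems p in \<open>auto simp: edge_path_def\<close>)
qed (auto simp: edge_path_def)

lemma walk_of_edge_path:
  "edge_path K vs es \<Longrightarrow> \<exists>ps. walk K (hd vs) ps (last vs) \<and> length ps = length es"
proof (induction es arbitrary: vs)
  case Nil
  then show ?case by (cases vs) (auto simp: edge_path_def intro: exI[of _ "[]"])
next
  case (Cons e es)
  then obtain u w vs' where vs: "vs = u # w # vs'"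
    unfolding edge_path_def by (metis length_Suc_conv)
  have ends: "ends K ((e # es) ! i) = {vs ! i, vs ! Suc i}" if "i < Suc (length es)" for i
    using Cons.prems that by (auto simp: edge_path_def)
  have "edge_path K (w # vs') es"
    using Cons.prems ends[of "Suc _"] vs by (auto simp: edge_path_def)
  from Cons.IH[OF this] obtain ps where "walk K w ps (last (w # vs'))" "length ps = length es" by auto
  then show ?case using Cons.prems ends[of 0] vs
    by (intro exI[of _ "(e, w) # ps"]) (auto simp: edge_path_def)
qed

text \<open>Passes from the indexed paths behind \<open>graph_dist\<close> to \<open>walk\<close>,
  whose recursive form makes induction and concatenation list operations.\<close>

lemma edge_path_iff_walk:
  "(\<exists>vs es. edge_path K vs es \<and> hd vs = u \<and> last vs = v \<and> length es = n) \<longleftrightarrow>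
   (\<exists>ps. walk K u ps v \<and> length ps = n)"
proof
  assume "\<exists>ps. walk K u ps v \<and> length ps = n"
  then obtain ps where ps: "walk K u ps v" "length ps = n" by blast
  show "\<exists>vs es. edge_path K vs es \<and> hd vs = u \<and> last vs = v \<and> length es = n"
    by (rule exI[of _ "u # map snd ps"], rule exI[of _ "map fst ps"])
      (use edge_path_walk[OF ps(1)] walk_last[OF ps(1)] ps(2) in auto)
qed (use walk_of_edge_path in fastforce)

lemma walk_simple:
  "walk K u ps v \<Longrightarrow> \<exists>qs. walk K u qs v \<and> set qs \<subseteq> set ps \<and> length qs \<le> length ps \<and>
    distinct (u # map snd qs)"
proof (induction ps arbitrary: u)
  case (Cons p ps)
  obtain e w where p: "p = (e, w)" by force
  have "walk K w ps v" using Cons.prems p by simp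
  from Cons.IH[OF this] obtain qs where qs: "walk K w qs v" "set qs \<subseteq> set ps"
    "length qs \<le> length ps" "distinct (w # map snd qs)" by blast
  consider "u = w" | "u \<in> snd ` set qs" | "u \<noteq> w" "u \<notin> snd ` set qs" by blast
  then show ?case
  proof cases
    case 1
    then show ?thesis using qs by (intro exI[of _ qs]) auto
  next
    case 2
    then obtain f where "(f, u) \<in> set qs" by force
    then obtain q1 q2 where q: "qs = q1 @ (f, u) # q2" using split_list by metis
    then have "walk K u q2 v" using qs(1) by (auto simp: walk_append)
    then show ?thesis using qs(2-4) q by (intro exI[of _ q2]) auto
  next
    case 3
    then show ?thesis using qs Cons.prems p by (intro exI[of _ "p # qs"]) auto
  qed
qed (auto intro: exI[of _ "[]"])

section \<open>Edges on a common circuit of bounded length\<close>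

definition cocircuit :: "('v, 'e) graph \<Rightarrow> nat \<Rightarrow> 'e \<Rightarrow> 'e \<Rightarrow> bool"
  where "cocircuit K L e f \<longleftrightarrow>
    (\<exists>vs es. circuit K vs es \<and> length es \<le> L \<and> e \<in> set es \<and> f \<in> set es)"

text \<open>This is the only form in which fineness enters the rest of the proof.\<close>

lemma finite_cocircuit:
  assumes "fine_graph K" "e \<in> edges K"
  shows "finite {f. cocircuit K L e f}"
proof -
  let ?C = "\<lambda>n. {(vs, es). circuit K vs es \<and> length es = n \<and> e \<in> set es}"
  have "{f. cocircuit K L e f} \<subseteq> (\<Union>n\<le>L. \<Union>c\<in>?C n. set (snd c))"
    by (force simp: cocircuit_def)
  moreover have "finite (?C n)" for n using assms by (simp add: fine_graph_def)
  ultimately show ?thesis by (meson List.finite_set finite_UN finite_atMost finite_subset)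
qed

text \<open>Shortening the path to a simple one and closing it through \<open>v\<close> gives the
  circuit; the path avoids \<open>v\<close>, so no vertex repeats. For \<open>w = w'\<close> the
  circuit has length two, which also covers \<open>e = f\<close>.\<close>

lemma cocircuit_of_fan:
  assumes "e \<in> edges K" "ends K e = {v, w}" "f \<in> edges K" "ends K f = {v, w'}"
    and "walk K w ps w'" "v \<notin> insert w (snd ` set ps)" "v \<in> verts K"
  shows "cocircuit K (length ps + 2) e f"
proof -
  from walk_simple[OF assms(5)] obtain qs where qs: "walk K w qs w'" "set qs \<subseteq> set ps"
    "length qs \<le> length ps" "distinct (w # map snd qs)" by blast
  have "walk K w (qs @ [(f, v)]) v"
    using qs(1) assms walk_verts[OF qs(1)] by (auto simp: walk_append insert_commute)
  then have w: "walk K v ((e, w) # qs @ [(f, v)]) v" using assms by auto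
  have "v \<notin> snd ` set qs" using assms(6) qs(2) by auto
  then have "circuit K (v # map snd ((e, w) # qs @ [(f, v)])) (map fst ((e, w) # qs @ [(f, v)]))"
    using edge_path_walk[OF w] walk_last[OF w] qs(4) assms(6) by (auto simp: circuit_def)
  then show ?thesis
    unfolding cocircuit_def using qs(3)
    by (intro exI[of _ "v # map snd ((e, w) # qs @ [(f, v)])"]
        exI[of _ "map fst ((e, w) # qs @ [(f, v)])"]) auto
qed

lemma walk_stays:
  "\<lbrakk>walk K w ps u; w \<in> A; \<forall>e\<in>fst ` set ps. ends K e \<subseteq> A \<or> ends K e \<inter> A = {}\<rbrakk> \<Longrightarrow> u \<in> A"
  by (induction ps arbitrary: w) auto

text \<open>A walk from \<open>w\<close> to \<open>u\<close> has to leave \<open>A\<close>, and only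
  edges of \<open>F\<close> cross the boundary of \<open>A\<close>. Making the walk simple keeps its
  edges among those of \<open>ps\<close>, so a crossing edge in \<open>F\<close> lies on the circuit
  that \<open>e\<close> closes.\<close>

lemma cocircuit_of_detour:
  assumes e: "e \<in> edges K" "ends K e = {u, w}" and ps: "walk K w ps u" "e \<notin> fst ` set ps"
    and A: "w \<in> A" "u \<notin> A"
    and F: "\<And>f. f \<in> fst ` set ps \<Longrightarrow> f \<in> F \<or> ends K f \<subseteq> A \<or> ends K f \<inter> A = {}"
  shows "\<exists>f\<in>F. cocircuit K (length ps + 1) e f"
proof -
  from walk_simple[OF ps(1)] obtain qs where qs: "walk K w qs u" "set qs \<subseteq> set ps"
    "length qs \<le> length ps" "distinct (w # map snd qs)" by blast
  have "\<exists>f\<in>fst ` set qs. f \<in> F"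
  proof (rule ccontr)
    assume no: "\<not> ?thesis"
    have "ends K f \<subseteq> A \<or> ends K f \<inter> A = {}" if "f \<in> fst ` set qs" for f
      using no F[of f] that qs(2) by blast
    then show False using walk_stays[OF qs(1) A(1)] A(2) by blast
  qed
  then obtain f where f: "f \<in> fst ` set qs" "f \<in> F" by blast
  have w: "walk K u ((e, w) # qs) u" using e qs walk_verts[OF qs(1)] by auto
  have "circuit K (u # map snd ((e, w) # qs)) (map fst ((e, w) # qs))"
    using edge_path_walk[OF w] walk_last[OF w] qs(4) by (auto simp: circuit_def)
  then have "cocircuit K (length ps + 1) e f"
    unfolding cocircuit_def using qs(3) f(1)
    by (intro exI[of _ "u # map snd ((e, w) # qs)"] exI[of _ "map fst ((e, w) # qs)"]) auto
  then show ?thesis using f(2) by blast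
qed

section \<open>The path metric of a connected graph\<close>

locale connected_multigraph =
  fixes K :: "('v, 'e) graph"
  assumes wf: "wf_graph K" and connected: "connected_graph K"
begin

abbreviation d where "d \<equiv> graph_dist K"

lemma graph_dist_Least: "d u v = (LEAST n. \<exists>ps. walk K u ps v \<and> length ps = n)"
  unfolding graph_dist_def edge_path_iff_walk ..

lemma ex_walk:
  assumes "u \<in> verts K" "v \<in> verts K"
  shows "\<exists>ps. walk K u ps v"
proof -
  obtain vs es where "edge_path K vs es" "hd vs = u" "last vs = v"
    using assms connected unfolding connected_graph_def by blast
  then show ?thesis using walk_of_edge_path[of K vs es] by auto
qed

lemma ex_geodesic:
  assumes "u \<in> verts K" "v \<in> verts K"
  shows "\<exists>ps. walk K u ps v \<and> length ps = d u v"
proof -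
  obtain ps where "walk K u ps v" using ex_walk[OF assms] by blast
  then have "\<exists>n ps. walk K u ps v \<and> length ps = n" by blast
  then show ?thesis unfolding graph_dist_Least by (rule LeastI_ex)
qed

lemma dist_le: "walk K u ps v \<Longrightarrow> d u v \<le> length ps"
  unfolding graph_dist_Least by (rule Least_le) blast

lemma dist_sym: 
  assumes "u \<in> verts K" "v \<in> verts K"
  shows "d u v = d v u"
proof -
  have "d v u \<le> d u v" if uv: "u \<in> verts K" "v \<in> verts K" for u v
  proof -
    obtain ps where "walk K u ps v" "length ps = d u v" using ex_geodesic[OF uv] by blast
    then obtain qs where "walk K v qs u" "length qs = d u v" using walk_rev[of K u ps v] by auto
    then show ?thesis using dist_le[of v qs u] by simp
  qed
  then show ?thesis using assms by (simp add: le_antisym)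
qed

lemma dist_triangle:
  assumes "u \<in> verts K" "v \<in> verts K" "w \<in> verts K"
  shows "d u w \<le> d u v + d v w"
proof -
  obtain ps where ps: "walk K u ps v" "length ps = d u v"
    using ex_geodesic[OF assms(1,2)] by blast
  obtain qs where qs: "walk K v qs w" "length qs = d v w"
    using ex_geodesic[OF assms(2,3)] by meson
  have "walk K u (ps @ qs) w" using ps qs by (auto simp: walk_append)
  from dist_le[OF this] show ?thesis using ps qs by simp
qed

lemma dist_self [simp]: "u \<in> verts K \<Longrightarrow> d u u = 0"
  using dist_le[of u "[]" u] by auto

lemma geodesic_split:
  assumes "walk K u (ps @ qs) v" "length (ps @ qs) = d u v" "walk K u ps w" "walk K w qs v"
  shows "d u w = length ps" "d w v = length qs"
proof -
  have "d u v \<le> d u w + d w v" using walk_verts[OF assms(1)] walk_verts[OF assms(3)] by (intro dist_triangle) auto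
  moreover have "d u w \<le> length ps" "d w v \<le> length qs" using assms dist_le by auto
  ultimately show "d u w = length ps" "d w v = length qs" using assms(2) by auto
qed

lemma walk_dist_le:
  assumes "walk K u ps v" "y \<in> insert u (snd ` set ps)"
  shows "d u y \<le> length ps" "d y v \<le> length ps"
proof -
  have "\<exists>p1 p2. ps = p1 @ p2 \<and> walk K u p1 y \<and> walk K y p2 v"
  proof (cases "y = u")
    case True
    then show ?thesis using assms(1) walk_verts[OF assms(1)] by (intro exI[of _ "[]"] exI[of _ ps]) simp
  next
    case False
    then obtain f where "(f, y) \<in> set ps" using assms(2) by force
    then obtain q1 q2 where q: "ps = q1 @ [(f, y)] @ q2" using split_list by (metis append_Cons append_Nil)
    then have "walk K u (q1 @ [(f, y)]) y" "walk K y q2 v"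
      using assms(1) walk_verts[OF assms(1)] by (auto simp: walk_append dest: walk_verts)
    then show ?thesis using q by (intro exI[of _ "q1 @ [(f, y)]"] exI[of _ q2]) auto
  qed
  then obtain p1 p2 where "ps = p1 @ p2" "walk K u p1 y" "walk K y p2 v" by blast
  then show "d u y \<le> length ps" "d y v \<le> length ps"
    using dist_le[of u p1 y] dist_le[of y p2 v] by auto
qed

lemma walk_ends:
  "walk K u ps v \<Longrightarrow> e \<in> fst ` set ps \<Longrightarrow> ends K e \<subseteq> insert u (snd ` set ps)"
proof (induction ps arbitrary: u)
  case (Cons p ps)
  obtain f w where "p = (f, w)" by force
  then show ?case using Cons.prems Cons.IH[of w] by (cases "e = f") (simp, fastforce)
qed simp

lemma walk_ends_dist_le:
  assumes "walk K u ps v" "e \<in> fst ` set ps" "y \<in> ends K e"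
  shows "d u y \<le> length ps"
  using walk_dist_le(1)[OF assms(1)] walk_ends[OF assms(1,2)] assms(3) by blast

text \<open>Every vertex of a walk is at distance at most the length of the walk from its
  end.\<close>

lemma walk_closer_avoids:
  assumes "walk K w ps u" "length ps < d v u"
  shows "v \<notin> insert w (snd ` set ps)"
  using walk_dist_le(2)[OF assms(1), of v] assms(2) by auto

end

section \<open>Group actions on fine graphs\<close>

context connected_multigraph
begin

section \<open>Paths that avoid a vertex\<close>

definition joined_off :: "'v \<Rightarrow> nat \<Rightarrow> 'v \<Rightarrow> 'v \<Rightarrow> bool"
  where "joined_off v n u w \<longleftrightarrow> (\<exists>ps. walk K u ps w \<and> length ps \<le> n \<and> v \<notin> insert u (snd ` set ps))"

lemma joined_offI: "walk K u ps w \<Longrightarrow> length ps \<le> n \<Longrightarrow> v \<notin> insert u (snd ` set ps) \<Longrightarrow> joined_off v n u w"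
  unfolding joined_off_def by blast

lemma joined_off_sym:
  assumes "joined_off v n u w"
  shows "joined_off v n w u"
proof -
  obtain ps where ps: "walk K u ps w" "length ps \<le> n" "v \<notin> insert u (snd ` set ps)"
    using assms unfolding joined_off_def by blast
  obtain qs where "walk K w qs u" "length qs = length ps"
    "insert w (snd ` set qs) = insert u (snd ` set ps)" using walk_rev[OF ps(1)] by blast
  then show ?thesis using ps by (intro joined_offI[of w qs]) auto
qed

lemma joined_off_trans:
  assumes "joined_off v n u w" "joined_off v m w z"
  shows "joined_off v (n + m) u z"
proof -
  obtain ps where ps: "walk K u ps w" "length ps \<le> n" "v \<notin> insert u (snd ` set ps)"
    using assms(1) unfolding joined_off_def by blast
  obtain qs where qs: "walk K w qs z" "length qs \<le> m" "v \<notin> insert w (snd ` set qs)"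
    using assms(2) unfolding joined_off_def by blast
  have "walk K u (ps @ qs) z" using ps(1) qs(1) by (auto simp: walk_append)
  then show ?thesis by (rule joined_offI) (use ps qs in auto)
qed

lemma joined_off_closer:
  assumes "walk K w ps u" "length ps < d v u"
  shows "joined_off v (length ps) w u"
  using joined_offI[OF assms(1) order.refl walk_closer_avoids[OF assms]] .

text \<open>This is why avoidance of \<open>v\<close> is tracked: \<open>joined_off v\<close> is
  symmetric and composes with added bounds, so a chain of detours around \<open>v\<close> ends in a
  circuit through two edges at \<open>v\<close>.\<close>

lemma cocircuit_of_joined_off:
  assumes "e \<in> edges K" "ends K e = {v, w}" "f \<in> edges K" "ends K f = {v, w'}"
    and "joined_off v n w w'"
  shows "cocircuit K (n + 2) e f"
proof -
  obtain ps where ps: "walk K w ps w'" "length ps \<le> n" "v \<notin> insert w (snd ` set ps)"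
    using assms(5) unfolding joined_off_def by blast
  have "v \<in> verts K" using wf assms(1,2) by (auto simp: wf_graph_def)
  from cocircuit_of_fan[OF assms(1-4) ps(1,3) this] show ?thesis
    using ps(2) unfolding cocircuit_def by (meson add_le_mono1 order.trans)
qed

lemma geodesic_first_edge:
  assumes "u \<in> verts K" "v \<in> verts K" "u \<noteq> v"
  shows "\<exists>e w ps. e \<in> edges K \<and> ends K e = {u, w} \<and> walk K w ps v \<and> Suc (length ps) = d u v"
proof -
  obtain ps where ps: "walk K u ps v" "length ps = d u v" using ex_geodesic[OF assms(1,2)] by blast
  then obtain e w qs where "ps = (e, w) # qs" using assms(3) by (cases ps) auto
  then show ?thesis using ps by (intro exI[of _ e] exI[of _ w] exI[of _ qs]) auto
qed

end

locale fine_action = group G + connected_multigraph K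
  for G :: "('g, 'b) monoid_scheme" (structure) and K :: "('v, 'e) graph" +
  fixes \<alpha> :: "'g \<Rightarrow> 'v \<Rightarrow> 'v" and \<beta> :: "'g \<Rightarrow> 'e \<Rightarrow> 'e"
  assumes action: "graph_action G K \<alpha> \<beta>"
    and fine: "fine_graph K"
    and finite_orbits: "finite (orbits G (edges K) \<beta>)"
    and finite_edge_stabilizer: "\<And>e. e \<in> edges K \<Longrightarrow> finite (stabilizer G \<beta> e)"
begin

lemma vert_action: "group_action G (verts K) \<alpha>" and edge_action: "group_action G (edges K) \<beta>"
  and ends_act: "g \<in> carrier G \<Longrightarrow> e \<in> edges K \<Longrightarrow> ends K (\<beta> g e) = \<alpha> g ` ends K e"
  using action by (auto simp: graph_action_def)

lemmas act_vert [simp] = group_action.element_image[OF vert_action _ _ refl]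
lemmas act_edge [simp] = group_action.element_image[OF edge_action _ _ refl]
lemmas act_vert_mult = group_action.composition_rule[OF vert_action]
lemmas act_edge_mult = group_action.composition_rule[OF edge_action]

lemma act_vert_one [simp]: "v \<in> verts K \<Longrightarrow> \<alpha> \<one> v = v"
  by (metis group_action.id_eq_one[OF vert_action] restrict_apply')

lemma act_edge_one [simp]: "e \<in> edges K \<Longrightarrow> \<beta> \<one> e = e"
  by (metis group_action.id_eq_one[OF edge_action] restrict_apply')

lemma act_vert_inj: "\<lbrakk>g \<in> carrier G; u \<in> verts K; v \<in> verts K; \<alpha> g u = \<alpha> g v\<rbrakk> \<Longrightarrow> u = v"
  using group_action.inj_prop[OF vert_action, of g] by (auto dest: inj_onD)

lemma act_edge_inj: "\<lbrakk>g \<in> carrier G; e \<in> edges K; f \<in> edges K; \<beta> g e = \<beta> g f\<rbrakk> \<Longrightarrow> e = f"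
  using group_action.inj_prop[OF edge_action, of g] by (auto dest: inj_onD)

lemma walk_act:
  assumes "g \<in> carrier G"
  shows "walk K u ps v \<Longrightarrow> walk K (\<alpha> g u) (map (map_prod (\<beta> g) (\<alpha> g)) ps) (\<alpha> g v)"
proof (induction ps arbitrary: u)
  case (Cons p ps)
  then show ?case using assms by (cases p) (auto simp: ends_act)
qed (use assms in auto)

lemma dist_act:
  assumes g: "g \<in> carrier G" and "u \<in> verts K" "v \<in> verts K"
  shows "d (\<alpha> g u) (\<alpha> g v) = d u v"
proof -
  have le: "d (\<alpha> h x) (\<alpha> h y) \<le> d x y" if h: "h \<in> carrier G" and xy: "x \<in> verts K" "y \<in> verts K" for h x y
  proof -
    obtain ps where "walk K x ps y" "length ps = d x y" using ex_geodesic[OF xy] by blast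
    then show ?thesis using dist_le[OF walk_act[OF h]] by fastforce
  qed
  have "d u v = d (\<alpha> (inv g) (\<alpha> g u)) (\<alpha> (inv g) (\<alpha> g v))"
    using assms by (simp flip: act_vert_mult)
  also have "\<dots> \<le> d (\<alpha> g u) (\<alpha> g v)" using assms by (intro le) auto
  finally show ?thesis using le[OF assms] by simp
qed

section \<open>Fixed vertices of elements of infinite order\<close>

lemma inj_pow_pow:
  assumes "g \<in> carrier G" "inj (\<lambda>k::nat. g [^] k)" "0 < m"
  shows "inj (\<lambda>k::nat. (g [^] (m::nat)) [^] k)"
proof (rule injI)
  fix i j :: nat assume "(g [^] m) [^] i = (g [^] m) [^] j"
  then have "g [^] (m * i) = g [^] (m * j)" using assms(1) by (simp add: nat_pow_pow)
  then show "i = j" using assms(2,3) by (auto dest: injD)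
qed

text \<open>A repetition makes some \<open>g^m\<close> with \<open>m > 0\<close> fix
  \<open>e\<close>, and then its infinitely many powers lie in the finite stabiliser of
  \<open>e\<close>.\<close>

lemma inj_edge_powers:
  assumes g: "g \<in> carrier G" "inj (\<lambda>k::nat. g [^] k)" and e: "e \<in> edges K"
  shows "inj (\<lambda>k::nat. \<beta> (g [^] k) e)"
proof -
  have False if "\<beta> (g [^] k) e = \<beta> (g [^] l) e" "k < l" for k l :: nat
  proof -
    define m where "m = l - k"
    have m: "0 < m" "l = k + m" using that by (auto simp: m_def)
    have "\<beta> (g [^] k) (\<beta> (g [^] m) e) = \<beta> (g [^] k) e"
      using that(1) g e by (simp add: m(2) nat_pow_mult flip: act_edge_mult)
    then have fix_e: "\<beta> (g [^] m) e = e" using g e by (metis act_edge act_edge_inj nat_pow_closed)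
    have "\<beta> ((g [^] m) [^] i) e = e" for i :: nat
      by (induction i) (use g e fix_e in \<open>auto simp: act_edge_mult\<close>)
    then have "range (\<lambda>i::nat. (g [^] m) [^] i) \<subseteq> stabilizer G \<beta> e"
      using g by (auto simp: stabilizer_def)
    moreover have "infinite (range (\<lambda>i::nat. (g [^] m) [^] i))"
      using inj_pow_pow[OF g m(1)] by (simp add: finite_image_iff)
    ultimately show False using finite_edge_stabilizer[OF e] finite_subset by blast
  qed
  then show ?thesis by (intro injI) (metis nat_neq_iff)
qed

lemma act_vert_pow_fixed:
  assumes "g \<in> carrier G" "v \<in> verts K" "\<alpha> g v = v"
  shows "\<alpha> (g [^] (k::nat)) v = v"
  by (induction k) (use assms in \<open>auto simp: act_vert_mult\<close>)

text \<open>The first edges of the translates \<open>g\<^sup>k P\<close> of a geodesic \<open>P\<close> from \<open>u\<close> to \<open>v\<close> lie on circuits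
  of bounded length, so fineness and finiteness of the edge stabilisers bound the order of \<open>g\<close>.\<close>

lemma fixed_vertex_unique:
  assumes g: "g \<in> carrier G" "inj (\<lambda>k::nat. g [^] k)"
    and u: "u \<in> verts K" "\<alpha> g u = u" and v: "v \<in> verts K" "\<alpha> g v = v"
  shows "u = v"
proof (rule ccontr)
  assume "u \<noteq> v"
  then obtain e w ps where e: "e \<in> edges K" "ends K e = {u, w}" "walk K w ps v" "Suc (length ps) = d u v"
    using geodesic_first_edge[OF u(1) v(1)] by blast
  have "cocircuit K (length ps + length ps + 2) e (\<beta> (g [^] k) e)" for k :: nat
  proof -
    let ?h = "g [^] k"
    have h: "?h \<in> carrier G" "\<alpha> ?h u = u" "\<alpha> ?h v = v" using g u v act_vert_pow_fixed by auto
    have "joined_off u (length ps) w v" using e by (intro joined_off_closer) auto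
    moreover have "joined_off u (length ps) (\<alpha> ?h w) v"
      using walk_act[OF h(1) e(3)] h e(4)
        joined_off_closer[of "\<alpha> ?h w" "map (map_prod (\<beta> ?h) (\<alpha> ?h)) ps" v u] by simp
    ultimately have "joined_off u (length ps + length ps) w (\<alpha> ?h w)"
      using joined_off_trans joined_off_sym by blast
    then show ?thesis using e h by (intro cocircuit_of_joined_off[where v = u]) (auto simp: ends_act)
  qed
  then have "range (\<lambda>k::nat. \<beta> (g [^] k) e) \<subseteq> {f. cocircuit K (length ps + length ps + 2) e f}" by auto
  then have "finite (range (\<lambda>k::nat. \<beta> (g [^] k) e))"
    using finite_cocircuit[OF fine e(1)] finite_subset by blast
  then show False using inj_edge_powers[OF g e(1)] by (simp add: finite_image_iff)
qed

lemma commuting_fixes: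
  assumes g: "g \<in> carrier G" "inj (\<lambda>k::nat. g [^] k)" and h: "h \<in> carrier G" "g \<otimes> h = h \<otimes> g"
    and v: "v \<in> verts K" "\<alpha> g v = v"
  shows "\<alpha> h v = v"
proof -
  have "\<alpha> g (\<alpha> h v) = \<alpha> h (\<alpha> g v)" using g(1) h v(1) by (simp flip: act_vert_mult)
  then have "\<alpha> g (\<alpha> h v) = \<alpha> h v" by (simp only: v(2))
  then show ?thesis using fixed_vertex_unique[OF g _ _ v] act_vert[OF h(1) v(1)] by blast
qed

text \<open>\<open>g\<close> commutes with \<open>g^m\<close>, which again has infinite order and
  therefore at most one fixed vertex.\<close>

lemma pow_fixes_imp_fixes:
  assumes g: "g \<in> carrier G" "inj (\<lambda>k::nat. g [^] k)" and "0 < m"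
    and v: "v \<in> verts K" "\<alpha> (g [^] (m::nat)) v = v"
  shows "\<alpha> g v = v"
proof (rule commuting_fixes[OF _ inj_pow_pow[OF g \<open>0 < m\<close>] g(1) _ v])
  show "g [^] m \<otimes> g = g \<otimes> g [^] m" using g(1) by (metis nat_pow_Suc nat_pow_Suc2)
qed (use g in auto)

text \<open>Take a vertex \<open>v\<close> from which infinitely many points of the orbit lie at the smallest possible
  distance. The geodesics from \<open>v\<close> to these points start with infinitely many different edges; if
  \<open>g\<close> moved \<open>v\<close>, all of these edges would be joined to \<open>g v\<close> by bounded paths avoiding \<open>v\<close>.\<close>

lemma bounded_orbit_fixes:
  assumes g: "g \<in> carrier G" "inj (\<lambda>k::nat. g [^] k)" and x: "x \<in> verts K"
    and bounded: "\<And>k::nat. d x (\<alpha> (g [^] k) x) \<le> B"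
  shows "\<exists>v\<in>verts K. \<alpha> g v = v"
proof (rule ccontr)
  assume "\<not> ?thesis"
  then have free: "\<alpha> (g [^] m) v \<noteq> v" if "v \<in> verts K" "0 < m" for v and m :: nat
    using pow_fixes_imp_fixes[OF g] that by blast
  define X where "X k = \<alpha> (g [^] k) x" for k :: nat
  have X: "X k \<in> verts K" for k using g x by (simp add: X_def)
  have gX: "\<alpha> g (X k) = X (Suc k)" for k
    using g x by (simp only: X_def act_vert_mult[symmetric] nat_pow_closed nat_pow_Suc2)
  \<comment> \<open>\<open>free\<close> lets a vertex \<open>y\<close> reach a given
    \<open>v\<close> under at most one power of \<open>g\<close>; hence a fixed finite path has only
    finitely many translates through \<open>v\<close>.\<close>
  have at_most_once: "k = l" if "\<alpha> (g [^] k) y = v" "\<alpha> (g [^] l) y = v" "y \<in> verts K" for k l :: nat and y v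
  proof -
    have False if "\<alpha> (g [^] k) y = \<alpha> (g [^] l) y" "k < l" for k l :: nat
    proof -
      have "\<alpha> (g [^] k) (\<alpha> (g [^] (l - k)) y) = \<alpha> (g [^] k) y"
        using that g \<open>y \<in> verts K\<close> by (simp add: nat_pow_mult flip: act_vert_mult)
      then have "\<alpha> (g [^] (l - k)) y = y"
        using g \<open>y \<in> verts K\<close> by (metis act_vert act_vert_inj nat_pow_closed)
      then show False using free[of y "l - k"] that \<open>y \<in> verts K\<close> by auto
    qed
    then show ?thesis using that by (metis nat_neq_iff)
  qed
  define Q where "Q D \<longleftrightarrow> (\<exists>v\<in>verts K. infinite {k. d v (X k) \<le> D})" for D
  have "{k. d x (X k) \<le> B} = UNIV" using bounded by (auto simp: X_def)
  then have "Q B" unfolding Q_def using x by (intro bexI[of _ x]) auto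
  \<comment> \<open>Minimality ranges over all vertices, so every vertex has only finitely many
    \<open>X k\<close> at distance below \<open>D\<close>. Applied to \<open>v\<close>, this puts
    all but finitely many of the chosen points at distance exactly \<open>D\<close>; applied to
    neighbours of \<open>v\<close>, it forces infinitely many first edges.\<close>
  define D where "D = (LEAST D. Q D)"
  have "Q D" unfolding D_def using \<open>Q B\<close> by (rule LeastI)
  then obtain v where v: "v \<in> verts K" "infinite {k. d v (X k) \<le> D}" by (auto simp: Q_def)
  have fin_less: "finite {k. d w (X k) < D}" if w: "w \<in> verts K" for w
  proof (cases D)
    case (Suc D')
    then have "\<not> Q D'" unfolding D_def by (intro not_less_Least) auto
    then show ?thesis using w Suc by (auto simp: Q_def less_Suc_eq_le)
  qed auto
  obtain \<delta> where \<delta>: "walk K x \<delta> (\<alpha> g x)" using ex_walk x g by (metis act_vert)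
  let ?\<delta> = "\<lambda>k::nat. map (map_prod (\<beta> (g [^] k)) (\<alpha> (g [^] k))) \<delta>"
  have \<delta>k: "walk K (X k) (?\<delta> k) (X (Suc k))" for k
    using walk_act[OF _ \<delta>, of "g [^] k"] g x by (simp add: X_def act_vert_mult)
  have "finite {k. v \<in> insert (X k) (snd ` set (?\<delta> k))}"
  proof (rule finite_subset)
    show "{k. v \<in> insert (X k) (snd ` set (?\<delta> k))} \<subseteq> (\<Union>y\<in>insert x (snd ` set \<delta>). {k. \<alpha> (g [^] k) y = v})"
      by (auto simp: X_def)
    have "finite {k::nat. \<alpha> (g [^] k) y = v}" if "y \<in> insert x (snd ` set \<delta>)" for y
    proof -
      have "y \<in> verts K" using that walk_verts[OF \<delta>] by auto
      then have "k = l" if "\<alpha> (g [^] k) y = v" "\<alpha> (g [^] l) y = v" for k l :: nat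
        using at_most_once that by blast
      then have "\<exists>l. {k::nat. \<alpha> (g [^] k) y = v} \<subseteq> {l}" by (cases "\<exists>l::nat. \<alpha> (g [^] l) y = v") blast+
      then obtain l where "{k::nat. \<alpha> (g [^] k) y = v} \<subseteq> {l}" by blast
      then show ?thesis by (rule finite_subset) simp
    qed
    then show "finite (\<Union>y\<in>insert x (snd ` set \<delta>). {k::nat. \<alpha> (g [^] k) y = v})" by blast
  qed
  moreover have "finite {k. d v (X (Suc k)) < D}"
    using finite_vimageI[OF fin_less[OF v(1)], of Suc] by (simp add: vimage_def)
  ultimately have "finite ({k. d v (X k) < D} \<union> {k. v \<in> insert (X k) (snd ` set (?\<delta> k))} \<union>
      {k. d v (X (Suc k)) < D})" using fin_less[OF v(1)] by blast
  \<comment> \<open>The condition \<open>D \<le> d v (X (Suc k))\<close> concerns the translated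
    geodesic: it ends at \<open>X (Suc k)\<close> and has length \<open>D - 1\<close>, so it too
    avoids \<open>v\<close>.\<close>
  then obtain I where I: "infinite I" and
    Ik: "\<And>k. k \<in> I \<Longrightarrow> d v (X k) = D \<and> v \<notin> insert (X k) (snd ` set (?\<delta> k)) \<and> D \<le> d v (X (Suc k))"
  proof -
    let ?J = "{k. d v (X k) < D} \<union> {k. v \<in> insert (X k) (snd ` set (?\<delta> k))} \<union> {k. d v (X (Suc k)) < D}"
    assume *: "finite ?J" and that: "\<And>I. infinite I \<Longrightarrow> (\<And>k. k \<in> I \<Longrightarrow> d v (X k) = D \<and>
      v \<notin> insert (X k) (snd ` set (?\<delta> k)) \<and> D \<le> d v (X (Suc k))) \<Longrightarrow> thesis"
    show thesis
    proof (rule that[of "{k. d v (X k) \<le> D} - ?J"])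
      show "infinite ({k. d v (X k) \<le> D} - ?J)" using v(2) * by (simp add: Diff_infinite_finite)
    qed (use nat_less_le not_le in blast)
  qed
  have "\<exists>e w ps. e \<in> edges K \<and> ends K e = {v, w} \<and> walk K w ps (X k) \<and> Suc (length ps) = D"
    if "k \<in> I" for k
    using geodesic_first_edge[OF v(1) X[of k]] Ik[OF that] by auto
  then obtain e w ps where e: "\<And>k. k \<in> I \<Longrightarrow> e k \<in> edges K" "\<And>k. k \<in> I \<Longrightarrow> ends K (e k) = {v, w k}"
    and ps: "\<And>k. k \<in> I \<Longrightarrow> walk K (w k) (ps k) (X k)" "\<And>k. k \<in> I \<Longrightarrow> Suc (length (ps k)) = D"
    by metis
  \<comment> \<open>Finitely many first edges would leave finitely many neighbours
    \<open>w k\<close>, one of them closer than \<open>D\<close> to infinitely many points, against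
    the minimality of \<open>D\<close>.\<close>
  have "infinite (e ` I)"
  proof
    assume "finite (e ` I)"
    moreover have "w ` I \<subseteq> (\<Union>f\<in>e ` I. ends K f)" using e(2) by auto
    moreover have "finite (ends K f)" if "f \<in> e ` I" for f using that e(2) by auto
    ultimately have "finite (w ` I)" by (meson finite_UN finite_subset)
    moreover have "finite {k \<in> I. w k = y}" if "y \<in> w ` I" for y
    proof -
      have "d (w k) (X k) < D" if "k \<in> I" for k using dist_le[OF ps(1)[OF that]] ps(2)[OF that] by simp
      then have "{k \<in> I. w k = y} \<subseteq> {k. d y (X k) < D}" by auto
      moreover have "y \<in> verts K" using that walk_verts[OF ps(1)] by blast
      ultimately show ?thesis by (rule finite_subset[OF _ fin_less])
    qed
    ultimately have "finite (\<Union>y\<in>w ` I. {k \<in> I. w k = y})" by blast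
    moreover have "I \<subseteq> (\<Union>y\<in>w ` I. {k \<in> I. w k = y})" by auto
    ultimately show False using I finite_subset by blast
  qed
  \<comment> \<open>Bounds the chain from \<open>w k\<close> to \<open>X k\<close>, along the
    translate of \<open>\<delta>\<close> to \<open>X (Suc k)\<close>, back along the translated
    geodesic to \<open>\<alpha> g (w k)\<close> and over one edge to \<open>\<alpha> g v\<close>;
    each geodesic part counts as \<open>D\<close>.\<close>
  define L where "L = (D + length \<delta>) + (D + 1)"
  have joined: "joined_off v L (w k) (\<alpha> g v)" if k: "k \<in> I" for k
  proof -
    have "joined_off v D (w k) (X k)"
      using joined_off_closer[OF ps(1)[OF k], of v] ps(2)[OF k] Ik[OF k] 
      unfolding joined_off_def by fastforce
    moreover have "joined_off v (length \<delta>) (X k) (X (Suc k))"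
      by (rule joined_offI[OF \<delta>k]) (use Ik[OF k] in auto)
    ultimately have 1: "joined_off v (D + length \<delta>) (w k) (X (Suc k))" by (rule joined_off_trans)
    let ?qs = "map (map_prod (\<beta> g) (\<alpha> g)) (ps k)"
    have qs: "walk K (\<alpha> g (w k)) ?qs (X (Suc k))" using walk_act[OF g(1) ps(1)[OF k]] by (simp add: gX)
    have "joined_off v D (\<alpha> g (w k)) (X (Suc k))"
      using joined_off_closer[OF qs, of v] ps(2)[OF k] Ik[OF k] unfolding joined_off_def by fastforce
    then have 2: "joined_off v D (X (Suc k)) (\<alpha> g (w k))" by (rule joined_off_sym)
    have wv: "w k \<in> verts K" using walk_verts[OF ps(1)[OF k]] by blast
    have "joined_off v 1 (\<alpha> g (w k)) (\<alpha> g v)"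
    proof (rule joined_offI)
      show "walk K (\<alpha> g (w k)) [(\<beta> g (e k), \<alpha> g v)] (\<alpha> g v)"
        using e[OF k] g v wv by (auto simp: ends_act)
      show "v \<notin> insert (\<alpha> g (w k)) (snd ` set [(\<beta> g (e k), \<alpha> g v)])"
        using walk_closer_avoids[OF qs, of v] ps(2)[OF k] Ik[OF k] free[OF v(1), of 1] g by fastforce
    qed auto
    then show ?thesis unfolding L_def using 1 2 joined_off_trans by blast
  qed
  obtain k0 where k0: "k0 \<in> I" using I by (metis equals0I finite.emptyI)
  \<comment> \<open>All chains end at the same vertex \<open>\<alpha> g v\<close>, so any two of the
    \<open>w k\<close> are joined by a bounded path off \<open>v\<close>.\<close>
  have "cocircuit K (L + L + 2) (e k0) (e k)" if k: "k \<in> I" for k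
    using joined_off_trans[OF joined[OF k0] joined_off_sym[OF joined[OF k]]] e k k0
    by (intro cocircuit_of_joined_off[where v = v]) auto
  then have "e ` I \<subseteq> {f. cocircuit K (L + L + 2) (e k0) f}" by auto
  then show False using \<open>infinite (e ` I)\<close> finite_cocircuit[OF fine e(1)[OF k0]] finite_subset by blast
qed

end

context fine_action
begin

section \<open>Uniform bounds and acylindricity\<close>

lemma circuit_act:
  assumes g: "g \<in> carrier G" and c: "circuit K vs es"
  shows "circuit K (map (\<alpha> g) vs) (map (\<beta> g) es)"
proof -
  have path: "edge_path K vs es" and loop: "hd vs = last vs" and dist: "distinct (tl vs)"
    using c by (auto simp: circuit_def)
  then have ne: "vs \<noteq> []" by (auto simp: edge_path_def)
  have sub: "set vs \<subseteq> verts K" "set es \<subseteq> edges K" using path by (auto simp: edge_path_def)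
  have "edge_path K (map (\<alpha> g) vs) (map (\<beta> g) es)"
    using path g sub by (auto simp: edge_path_def ends_act subset_iff)
  moreover have "inj_on (\<alpha> g) (set (tl vs))"
    using g sub ne act_vert_inj by (intro inj_onI) (meson list.set_sel(2) subsetD)
  ultimately show ?thesis
    using ne loop dist by (simp add: circuit_def hd_map last_map distinct_map flip: map_tl)
qed

lemma cocircuit_act:
  assumes "g \<in> carrier G" "cocircuit K L e f"
  shows "cocircuit K L (\<beta> g e) (\<beta> g f)"
proof -
  obtain vs es where "circuit K vs es" "length es \<le> L" "e \<in> set es" "f \<in> set es"
    using assms(2) unfolding cocircuit_def by blast
  then show ?thesis unfolding cocircuit_def using circuit_act[OF assms(1)]
    by (intro exI[of _ "map (\<alpha> g) vs"] exI[of _ "map (\<beta> g) es"]) auto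
qed

lemma edge_representatives:
  "\<exists>E0. finite E0 \<and> E0 \<subseteq> edges K \<and> (\<forall>e\<in>edges K. \<exists>g\<in>carrier G. \<exists>f\<in>E0. e = \<beta> g f)"
proof -
  have "\<forall>Q\<in>orbits G (edges K) \<beta>. \<exists>f. f \<in> edges K \<and> Q = orbit G \<beta> f"
    unfolding orbits_def by blast
  then obtain r where r: "\<And>Q. Q \<in> orbits G (edges K) \<beta> \<Longrightarrow> r Q \<in> edges K \<and> Q = orbit G \<beta> (r Q)"
    by metis
  show ?thesis
  proof (intro exI conjI ballI)
    show "finite (r ` orbits G (edges K) \<beta>)" using finite_orbits by blast
    show "r ` orbits G (edges K) \<beta> \<subseteq> edges K" using r by blast
    fix e assume e: "e \<in> edges K"
    then have Qe: "orbit G \<beta> e \<in> orbits G (edges K) \<beta>" unfolding orbits_def by blast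
    have "e \<in> orbit G \<beta> e" using group_action.orbit_refl[OF edge_action e] .
    then have "e \<in> orbit G \<beta> (r (orbit G \<beta> e))" using r[OF Qe] by metis
    then show "\<exists>g\<in>carrier G. \<exists>f\<in>r ` orbits G (edges K) \<beta>. e = \<beta> g f"
      using Qe unfolding orbit_def[of G \<beta> "r _"] by blast
  qed
qed

lemma inv_act_edge [simp]: "g \<in> carrier G \<Longrightarrow> e \<in> edges K \<Longrightarrow> \<beta> (inv g) (\<beta> g e) = e"
  by (simp flip: act_edge_mult)

text \<open>The action preserves circuits, so the count at \<open>e\<close> is at most that at the
  representative of its orbit, and there are finitely many representatives.\<close>

lemma cocircuit_card_bound: "\<exists>N. \<forall>e\<in>edges K. card {f \<in> edges K. cocircuit K L e f} \<le> N"
proof -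
  obtain E0 where E0: "finite E0" "E0 \<subseteq> edges K"
    "\<And>e. e \<in> edges K \<Longrightarrow> \<exists>g\<in>carrier G. \<exists>f\<in>E0. e = \<beta> g f" using edge_representatives by auto
  let ?c = "\<lambda>e. card {f \<in> edges K. cocircuit K L e f}"
  have "?c e \<le> Max (?c ` E0)" if e: "e \<in> edges K" for e
  proof -
    obtain g e0 where g: "g \<in> carrier G" "e0 \<in> E0" "e = \<beta> g e0" using E0(3)[OF e] by blast
    have e0: "e0 \<in> edges K" using g(2) E0(2) by blast
    have "\<beta> (inv g) ` {f \<in> edges K. cocircuit K L e f} \<subseteq> {f \<in> edges K. cocircuit K L e0 f}"
    proof clarify
      fix f assume f: "f \<in> edges K" "cocircuit K L e f"
      have "cocircuit K L (\<beta> (inv g) e) (\<beta> (inv g) f)" using cocircuit_act f(2) g(1) by simp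
      then show "\<beta> (inv g) f \<in> edges K \<and> cocircuit K L e0 (\<beta> (inv g) f)"
        using f(1) g e0 by simp
    qed
    moreover have "inj_on (\<beta> (inv g)) {f \<in> edges K. cocircuit K L e f}"
      using g(1) act_edge_inj[of "inv g"] by (intro inj_onI) auto
    moreover have "finite {f \<in> edges K. cocircuit K L e0 f}" using finite_cocircuit[OF fine e0] by simp
    ultimately have "?c e \<le> ?c e0" by (meson card_inj_on_le)
    also have "\<dots> \<le> Max (?c ` E0)" using E0(1) g(2) by simp
    finally show ?thesis .
  qed
  then show ?thesis by blast
qed

text \<open>A nonempty set of elements carrying \<open>e\<close> to \<open>f\<close> is a coset of
  the stabiliser of \<open>e\<close>; through a fixed element of it, the set embeds into the
  stabiliser of the representative of the orbit of \<open>e\<close>.\<close>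

lemma transporter_card_bound:
  "\<exists>S. \<forall>e\<in>edges K. \<forall>f\<in>edges K. finite {g \<in> carrier G. \<beta> g e = f} \<and> card {g \<in> carrier G. \<beta> g e = f} \<le> S"
proof -
  obtain E0 where E0: "finite E0" "E0 \<subseteq> edges K"
    "\<And>e. e \<in> edges K \<Longrightarrow> \<exists>g\<in>carrier G. \<exists>f\<in>E0. e = \<beta> g f" using edge_representatives by auto
  let ?c = "\<lambda>e. card (stabilizer G \<beta> e)"
  have "finite {g \<in> carrier G. \<beta> g e = f} \<and> card {g \<in> carrier G. \<beta> g e = f} \<le> Max (?c ` E0)"
    if e: "e \<in> edges K" and f: "f \<in> edges K" for e f
  proof -
    obtain h e0 where h: "h \<in> carrier G" "e0 \<in> E0" "e = \<beta> h e0" using E0(3)[OF e] by blast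
    obtain k f0 where k: "k \<in> carrier G" "f0 \<in> E0" "f = \<beta> k f0" using E0(3)[OF f] by blast
    have e0: "e0 \<in> edges K" and f0: "f0 \<in> edges K" using h(2) k(2) E0(2) by auto
    let ?T = "{g \<in> carrier G. \<beta> g e = f}"
    have "?T = {} \<or> (\<exists>g0. g0 \<in> ?T)" by blast
    then show ?thesis
    proof
      assume T: "?T = {}"
      show ?thesis unfolding T by simp
    next
      assume "\<exists>g0. g0 \<in> ?T"
      then obtain g0 where g0: "g0 \<in> carrier G" "\<beta> g0 e = f" by blast
      let ?p = "\<lambda>g. inv (g0 \<otimes> h) \<otimes> (g \<otimes> h)"
      have "?p ` ?T \<subseteq> stabilizer G \<beta> e0"
      proof clarify
        fix g assume g: "g \<in> carrier G" "f = \<beta> g e"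
        have "\<beta> (g \<otimes> h) e0 = \<beta> (g0 \<otimes> h) e0" using g g0 h e0 by (simp add: act_edge_mult)
        moreover have "\<beta> (?p g) e0 = \<beta> (inv (g0 \<otimes> h)) (\<beta> (g \<otimes> h) e0)"
          using g(1) g0(1) h(1) e0 by (intro act_edge_mult) auto
        ultimately have "\<beta> (?p g) e0 = e0" using g0(1) h(1) e0 by (simp del: inv_mult_group)
        then show "?p g \<in> stabilizer G \<beta> e0" using g(1) g0(1) h(1) by (simp add: stabilizer_def)
      qed
      moreover have "inj_on ?p ?T"
        using g0(1) h(1) by (intro inj_onI) auto
      ultimately have "finite ?T" "card ?T \<le> ?c e0"
        using finite_edge_stabilizer[OF e0] by (auto intro: inj_on_finite card_inj_on_le)
      moreover have "?c e0 \<le> Max (?c ` E0)" using E0(1) h(2) by simp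
      ultimately show ?thesis by linarith
    qed
  qed
  then show ?thesis by blast
qed

text \<open>A geodesic from \<open>m\<close> to \<open>m'\<close>, its translate by \<open>g\<close> and the short paths joining their
  endpoints form a closed path of bounded length. The middle edge of the geodesic lies on a circuit
  that also uses an edge of the translate, because \<open>m\<close> and \<open>m'\<close> are too far apart for the short
  paths to meet.\<close>

lemma middle_edge_meets_translate:
  assumes m: "m \<in> verts K" "m' \<in> verts K"
    and geo: "walk K m (p1 @ (e, y) # p2) m'" "length p1 = C" "length p2 = C" "d m m' = 2 * C + 1"
    and g: "g \<in> carrier G" "d m (\<alpha> g m) \<le> C" "d m' (\<alpha> g m') \<le> C"
  shows "\<exists>f\<in>\<beta> g ` fst ` set (p1 @ (e, y) # p2). f = e \<or> cocircuit K (6 * C + 2) e f"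
proof -
  let ?\<gamma> = "p1 @ (e, y) # p2"
  let ?F = "\<beta> g ` fst ` set ?\<gamma>"
  obtain x where p1: "walk K m p1 x" and e: "e \<in> edges K" "ends K e = {x, y}" and p2: "walk K y p2 m'"
    using geo(1) by (auto simp: walk_append)
  have xy: "x \<in> verts K" "y \<in> verts K" using walk_verts[OF p1] walk_verts[OF p2] by auto
  have gm: "\<alpha> g m \<in> verts K" "\<alpha> g m' \<in> verts K" using g m by auto
  obtain c' where c': "walk K m' c' (\<alpha> g m')" "length c' = d m' (\<alpha> g m')" using ex_geodesic[OF m(2) gm(2)] by blast
  obtain c where c: "walk K m c (\<alpha> g m)" "length c = d m (\<alpha> g m)" using ex_geodesic[OF m(1) gm(1)] by blast
  obtain c2 where c2: "walk K (\<alpha> g m) c2 m" "length c2 = length c" "fst ` set c2 = fst ` set c"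
    using walk_rev[OF c(1)] by blast
  have "walk K (\<alpha> g m) (map (map_prod (\<beta> g) (\<alpha> g)) ?\<gamma>) (\<alpha> g m')" by (rule walk_act[OF g(1) geo(1)])
  moreover have "fst ` set (map (map_prod (\<beta> g) (\<alpha> g)) ?\<gamma>) = ?F"
    by (simp only: set_map image_image fst_map_prod)
  moreover have "length (map (map_prod (\<beta> g) (\<alpha> g)) ?\<gamma>) = 2 * C + 1" using geo(2,3) by simp
  ultimately obtain t where t: "walk K (\<alpha> g m') t (\<alpha> g m)" "length t = 2 * C + 1" "fst ` set t = ?F"
    using walk_rev[of K "\<alpha> g m" "map (map_prod (\<beta> g) (\<alpha> g)) ?\<gamma>" "\<alpha> g m'"] by metis
  define \<rho> where "\<rho> = p2 @ c' @ t @ c2 @ p1"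
  have \<rho>: "walk K y \<rho> x" unfolding \<rho>_def using p2 c'(1) t(1) c2(1) p1 by (auto simp: walk_append)
  \<comment> \<open>\<open>C\<close> edges for each of \<open>p1\<close> and \<open>p2\<close>, at
    most \<open>C\<close> for each connecting path and \<open>2 * C + 1\<close> for the translate;
    the one added edge is \<open>e\<close>.\<close>
  have len: "length \<rho> + 1 \<le> 6 * C + 2"
    unfolding \<rho>_def using geo(2,3) c(2) c'(2) c2(2) t(2) g(2,3) by simp
  \<comment> \<open>The ball of radius \<open>C\<close> about \<open>m'\<close> contains
    \<open>p2\<close> and \<open>c'\<close> and misses \<open>p1\<close> and \<open>c2\<close>,
    which stay within \<open>C\<close> of \<open>m\<close>, because \<open>d m m'\<close> exceeds
    \<open>2 * C\<close>. Among the pieces of \<open>\<rho>\<close> only the translate can cross its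
    boundary.\<close>
  define A where "A = {z. d m' z \<le> C}"
  have right: "ends K f \<subseteq> A" if "f \<in> fst ` set p2 \<or> f \<in> fst ` set c'" for f
  proof -
    obtain p2' where p2': "walk K m' p2' y" "length p2' = C" "fst ` set p2' = fst ` set p2"
      using walk_rev[OF p2] geo(3) by auto
    have "d m' z \<le> C" if "z \<in> ends K f" for z
      using \<open>f \<in> fst ` set p2 \<or> f \<in> fst ` set c'\<close>
    proof
      assume "f \<in> fst ` set p2"
      then show ?thesis using walk_ends_dist_le[OF p2'(1) _ that] p2'(2,3) by simp
    next
      assume "f \<in> fst ` set c'"
      then show ?thesis using walk_ends_dist_le[OF c'(1) _ that] c'(2) g(3) by simp
    qed
    then show ?thesis unfolding A_def by blast
  qed
  have left: "z \<notin> A" if "z \<in> verts K" "d m z \<le> C" for z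
    using dist_triangle[OF m(1) that(1) m(2)] geo(4) dist_sym[OF m(2) that(1)] that(2) by (simp add: A_def)
  have left_edge: "ends K f \<inter> A = {}" if "f \<in> fst ` set c2 \<or> f \<in> fst ` set p1" for f
  proof -
    have "d m z \<le> C" if "z \<in> ends K f" for z
      using \<open>f \<in> fst ` set c2 \<or> f \<in> fst ` set p1\<close>
    proof
      assume "f \<in> fst ` set c2"
      then show ?thesis using walk_ends_dist_le[OF c(1) _ that] c(2) c2(3) g(2) by simp
    next
      assume "f \<in> fst ` set p1"
      then show ?thesis using walk_ends_dist_le[OF p1 _ that] geo(2) by simp
    qed
    moreover have "f \<in> edges K" using that walk_edges[OF p1] walk_edges[OF c(1)] c2(3) by auto
    then have "ends K f \<subseteq> verts K" using wf unfolding wf_graph_def by blast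
    ultimately show ?thesis using left by blast
  qed
  have yA: "y \<in> A"
  proof -
    have "d y m' \<le> C" using dist_le[OF p2] geo(3) by simp
    then show ?thesis using dist_sym[OF xy(2) m(2)] by (simp add: A_def)
  qed
  have xA: "x \<notin> A" using left[OF xy(1)] dist_le[OF p1] geo(2) by simp
  show ?thesis
  proof (cases "e \<in> ?F")
    case False
    have "e \<notin> fst ` set \<rho>"
    proof
      assume "e \<in> fst ` set \<rho>"
      then have "e \<in> fst ` set p2 \<or> e \<in> fst ` set c' \<or> e \<in> fst ` set c2 \<or> e \<in> fst ` set p1"
        using False t(3) by (auto simp: \<rho>_def)
      then show False using right[of e] left_edge[of e] e(2) xA yA by blast
    qed
    moreover have "f \<in> ?F \<or> ends K f \<subseteq> A \<or> ends K f \<inter> A = {}" if "f \<in> fst ` set \<rho>" for f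
    proof -
      have "f \<in> fst ` set p2 \<or> f \<in> fst ` set c' \<or> f \<in> fst ` set t \<or> f \<in> fst ` set c2 \<or> f \<in> fst ` set p1"
        using that unfolding \<rho>_def set_append image_Un by blast
      then show ?thesis using right[of f] left_edge[of f] t(3) by blast
    qed
    ultimately have "\<exists>f\<in>?F. cocircuit K (length \<rho> + 1) e f"
      using cocircuit_of_detour[OF e \<rho> _ yA xA] by blast
    then show ?thesis using len unfolding cocircuit_def by (meson order.trans)
  qed blast
qed

text \<open>The odd distance \<open>2 * C + 1\<close> gives a geodesic a middle edge with
  \<open>C\<close> edges on either side. Each \<open>g\<close> carries one of the
  \<open>2 * C + 1\<close> edges to the middle edge or to one of at most \<open>N\<close> edges on a
  short circuit with it, and each such pair of edges admits at most \<open>S\<close>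
  elements.\<close>

lemma acylindrical:
  "\<exists>N. \<forall>m\<in>verts K. \<forall>m'\<in>verts K. d m m' = 2 * C + 1 \<longrightarrow>
    finite {g \<in> carrier G. d m (\<alpha> g m) \<le> C \<and> d m' (\<alpha> g m') \<le> C} \<and>
    card {g \<in> carrier G. d m (\<alpha> g m) \<le> C \<and> d m' (\<alpha> g m') \<le> C} \<le> N"
proof -
  obtain N where N: "\<And>e. e \<in> edges K \<Longrightarrow> card {f \<in> edges K. cocircuit K (6 * C + 2) e f} \<le> N"
    using cocircuit_card_bound by meson
  obtain S where S: "\<And>e f. e \<in> edges K \<Longrightarrow> f \<in> edges K \<Longrightarrow> finite {g \<in> carrier G. \<beta> g e = f} \<and>
    card {g \<in> carrier G. \<beta> g e = f} \<le> S"
    using transporter_card_bound by meson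
  have "finite {g \<in> carrier G. d m (\<alpha> g m) \<le> C \<and> d m' (\<alpha> g m') \<le> C} \<and>
    card {g \<in> carrier G. d m (\<alpha> g m) \<le> C \<and> d m' (\<alpha> g m') \<le> C} \<le> (2 * C + 1) * ((N + 1) * S)"
    if m: "m \<in> verts K" "m' \<in> verts K" "d m m' = 2 * C + 1" for m m'
  proof -
    let ?A = "{g \<in> carrier G. d m (\<alpha> g m) \<le> C \<and> d m' (\<alpha> g m') \<le> C}"
    obtain ps where ps: "walk K m ps m'" "length ps = 2 * C + 1" using ex_geodesic[OF m(1,2)] m(3) by auto
    define p1 q where "p1 = take C ps" and "q = drop C ps"
    have "length q = C + 1" using ps(2) by (simp add: q_def)
    then obtain e y p2 where q: "q = (e, y) # p2" by (cases q) auto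
    have "ps = p1 @ (e, y) # p2" unfolding q[symmetric] by (simp add: p1_def q_def)
    then have geo: "walk K m (p1 @ (e, y) # p2) m'" "length p1 = C" "length p2 = C"
      using ps \<open>length q = C + 1\<close> q by (auto simp: p1_def)
    let ?E = "fst ` set (p1 @ (e, y) # p2)"
    have E: "?E \<subseteq> edges K" using walk_edges[OF geo(1)] .
    then have e: "e \<in> edges K" by auto
    let ?F = "insert e {f \<in> edges K. cocircuit K (6 * C + 2) e f}"
    have F: "finite ?F" "?F \<subseteq> edges K" using finite_cocircuit[OF fine e] e by auto
    have cF: "card ?F \<le> N + 1" using N[OF e] card_insert_le_m1 F(1) by (simp add: card_insert_if)
    have cE: "card ?E \<le> 2 * C + 1"
      using card_image_le[of "set (p1 @ (e, y) # p2)" fst] card_length[of "p1 @ (e, y) # p2"] geo(2,3)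
      by (simp del: set_append)
    let ?T = "\<lambda>e' f. {g \<in> carrier G. \<beta> g e' = f}"
    have sub: "?A \<subseteq> (\<Union>e'\<in>?E. \<Union>f\<in>?F. ?T e' f)"
    proof
      fix g assume g: "g \<in> ?A"
      then have gG: "g \<in> carrier G" by simp
      obtain f where f: "f \<in> \<beta> g ` ?E" "f = e \<or> cocircuit K (6 * C + 2) e f"
        using middle_edge_meets_translate[OF m(1,2) geo m(3)] g by blast
      then have "f \<in> edges K" using E gG act_edge by blast
      then show "g \<in> (\<Union>e'\<in>?E. \<Union>f\<in>?F. ?T e' f)" using f gG by blast
    qed
    have inner: "finite (\<Union>f\<in>?F. ?T e' f) \<and> card (\<Union>f\<in>?F. ?T e' f) \<le> (N + 1) * S" if e': "e' \<in> ?E" for e'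
    proof -
      have "e' \<in> edges K" using e' E by blast
      then have ST: "finite (?T e' f) \<and> card (?T e' f) \<le> S" if "f \<in> ?F" for f using S that F(2) by blast
      have "card (\<Union>f\<in>?F. ?T e' f) \<le> (\<Sum>f\<in>?F. card (?T e' f))" using F(1) by (rule card_UN_le)
      also have "\<dots> \<le> (\<Sum>f\<in>?F. S)" using ST by (intro sum_mono) blast
      also have "\<dots> \<le> (N + 1) * S" using mult_le_mono1[OF cF, of S] by simp
      finally show ?thesis using ST F(1) by blast
    qed
    have finE: "finite ?E" by simp
    have "card (\<Union>e'\<in>?E. \<Union>f\<in>?F. ?T e' f) \<le> (\<Sum>e'\<in>?E. card (\<Union>f\<in>?F. ?T e' f))" using finE by (rule card_UN_le)
    also have "\<dots> \<le> (\<Sum>e'\<in>?E. (N + 1) * S)" using inner by (intro sum_mono) blast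
    also have "\<dots> \<le> (2 * C + 1) * ((N + 1) * S)" using mult_le_mono1[OF cE, of "(N + 1) * S"] by (simp only: sum_constant of_nat_id)
    finally have card: "card (\<Union>e'\<in>?E. \<Union>f\<in>?F. ?T e' f) \<le> (2 * C + 1) * ((N + 1) * S)" .
    have fin: "finite (\<Union>e'\<in>?E. \<Union>f\<in>?F. ?T e' f)" using inner finE by blast
    show ?thesis using finite_subset[OF sub fin] card_mono[OF fin sub] card by linarith
  qed
  then show ?thesis by blast
qed

end

section \<open>Hyperbolicity and centralisers\<close>

context fine_action
begin

text \<open>Doubling the inequality for Gromov products based at \<open>w\<close> turns it into a
  comparison of the three sums of distances given by the pairings of four points. Rounding
  \<open>2 * \<delta>\<close> up keeps all later estimates in the natural numbers.\<close>

lemma four_point: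
  assumes "hyperbolic_graph K"
  shows "\<exists>D. \<forall>x\<in>verts K. \<forall>y\<in>verts K. \<forall>z\<in>verts K. \<forall>w\<in>verts K.
    d x z + d y w \<le> max (d x y + d z w) (d y z + d x w) + D"
proof -
  obtain \<delta> where \<delta>: "\<And>w x y z. \<lbrakk>w \<in> verts K; x \<in> verts K; y \<in> verts K; z \<in> verts K\<rbrakk> \<Longrightarrow>
      gromov_product (\<lambda>u v. real (d u v)) w x z \<ge>
      min (gromov_product (\<lambda>u v. real (d u v)) w x y) (gromov_product (\<lambda>u v. real (d u v)) w y z) - \<delta>"
    using assms unfolding hyperbolic_graph_def gromov_hyperbolic_def by blast
  have "d x z + d y w \<le> max (d x y + d z w) (d y z + d x w) + nat \<lceil>2 * \<delta>\<rceil>"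
    if "x \<in> verts K" "y \<in> verts K" "z \<in> verts K" "w \<in> verts K" for x y z w
  proof -
    have "real (d x z + d y w) \<le> real (max (d x y + d z w) (d y z + d x w)) + 2 * \<delta>"
      using \<delta>[OF that(4,1,2,3)] unfolding gromov_product_def min_def max_def
      by (auto split: if_splits simp: field_simps)
    then show ?thesis by linarith
  qed
  then show ?thesis by blast
qed

lemma dist_pow_le:
  assumes "g \<in> carrier G" "x \<in> verts K"
  shows "d x (\<alpha> (g [^] (k::nat)) x) \<le> k * d x (\<alpha> g x)"
proof (induction k)
  case (Suc k)
  have "d x (\<alpha> (g [^] Suc k) x) \<le> d x (\<alpha> (g [^] k) x) + d (\<alpha> (g [^] k) x) (\<alpha> (g [^] k) (\<alpha> g x))"
    using assms by (simp add: act_vert_mult dist_triangle)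
  also have "\<dots> \<le> k * d x (\<alpha> g x) + d x (\<alpha> g x)" using Suc assms by (simp add: dist_act)
  finally show ?case by simp
qed (use assms in simp)

text \<open>Two four-point inequalities, for \<open>x, x', q, y\<close> and for
  \<open>q, x', y', y\<close>. In each, the distance of \<open>q\<close> from one end rules out one
  alternative of the maximum, and adding the remaining ones cancels \<open>d x' y\<close>.\<close>

lemma thin_quadrilateral:
  assumes D: "\<And>x y z w. \<lbrakk>x \<in> verts K; y \<in> verts K; z \<in> verts K; w \<in> verts K\<rbrakk> \<Longrightarrow>
      d x z + d y w \<le> max (d x y + d z w) (d y z + d x w) + D"
    and V: "x \<in> verts K" "y \<in> verts K" "x' \<in> verts K" "y' \<in> verts K" "q \<in> verts K"
    and "d x y = d x' y'" "d x x' \<le> r" "d y y' \<le> r"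
    and "d x' q + d q y' = d x' y'" "2 * r + D < d x' q" "2 * r + D < d q y'"
  shows "d x q + d q y \<le> d x y + 2 * D"
proof -
  have "d x q + d x' y \<le> max (d x x' + d q y) (d x' q + d x y) + D"
    using D[of x x' q y] V by blast
  moreover have "d q y + d x' y' \<le> max (d q x' + d y y') (d x' y + d q y') + D"
    using D[of q x' y y'] V by blast
  moreover have "d q y \<le> d q y' + d y' y" "d q y' \<le> d q y + d y y'" "d x' q \<le> d x' x + d x q"
    "d x y \<le> d x x' + d x' y"
    using V by (simp_all add: dist_triangle)
  moreover have "d y' y = d y y'" "d x' x = d x x'" "d q x' = d x' q" using V by (simp_all add: dist_sym)
  ultimately show ?thesis using assms(7-12) unfolding max_def by (auto split: if_splits)
qed

text \<open>If \<open>a\<close> had an unbounded orbit, then the elements \<open>s = b\<^sup>i c\<^sup>j\<close> with \<open>i, j < k\<close> would move a very long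
  geodesic \<open>[x, h x]\<close>, \<open>h\<close> a power of \<open>a\<close>, along itself up to a bounded error. There are \<open>k\<^sup>2\<close> of them
  but only \<open>O(k)\<close> possible translation lengths, contradicting \<open>acylindrical\<close>.\<close>

lemma bounded_orbit_of_centralizer:
  assumes hyp: "hyperbolic_graph K"
    and abc: "a \<in> carrier G" "b \<in> carrier G" "c \<in> carrier G"
    and comm: "a \<otimes> b = b \<otimes> a" "a \<otimes> c = c \<otimes> a"
    and inj: "inj (\<lambda>(i::nat, j::nat). b [^] i \<otimes> c [^] j)"
    and x: "x \<in> verts K"
  shows "\<exists>B. \<forall>k::nat. d x (\<alpha> (a [^] k) x) \<le> B"
proof (rule ccontr)
  assume "\<not> ?thesis"
  then have unbounded: "\<exists>k::nat. B < d x (\<alpha> (a [^] k) x)" for B by (meson not_le)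
  obtain D where D: "\<And>x y z w. \<lbrakk>x \<in> verts K; y \<in> verts K; z \<in> verts K; w \<in> verts K\<rbrakk> \<Longrightarrow>
      d x z + d y w \<le> max (d x y + d z w) (d y z + d x w) + D"
    using four_point[OF hyp] by blast
  \<comment> \<open>If two points are equally far from \<open>x\<close> and for both the sum of the
    distances to \<open>x\<close> and \<open>y\<close> exceeds \<open>d x y\<close> by at most
    \<open>2 * D\<close>, then the four-point inequality puts them within \<open>3 * D\<close> of
    each other.\<close>
  define C where "C = 3 * D"
  define R where "R = 2 * C + 1"
  obtain N where N: "\<And>m m'. \<lbrakk>m \<in> verts K; m' \<in> verts K; d m m' = R\<rbrakk> \<Longrightarrow>
    finite {g \<in> carrier G. d m (\<alpha> g m) \<le> C \<and> d m' (\<alpha> g m') \<le> C} \<and>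
    card {g \<in> carrier G. d m (\<alpha> g m) \<le> C \<and> d m' (\<alpha> g m') \<le> C} \<le> N"
    using acylindrical[of C] unfolding R_def by blast
  define E where "E = d x (\<alpha> b x) + d x (\<alpha> c x)"
  \<comment> \<open>Chosen so that \<open>(2 * r + 1) * (2 * R + 1) * N < k * k\<close> for
    \<open>r = k * E\<close>: the left side is at most \<open>k * (k - 1)\<close>.\<close>
  define k where "k = N * (2 * E + 1) * (2 * R + 1) + 1"
  define r where "r = k * E"
  \<comment> \<open>The points \<open>m\<close> and \<open>m'\<close> must be more than
    \<open>2 * r + D\<close> away from both ends of the geodesic for
    \<open>thin_quadrilateral\<close> to apply; \<open>l\<close> is then taken so large that two
    margins \<open>M\<close> and a segment of length \<open>R\<close> fit.\<close>
  define M where "M = 2 * r + D + 1"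
  obtain l where l: "2 * M + R < d x (\<alpha> (a [^] (l::nat)) x)" using unbounded by blast
  define h where "h = a [^] l"
  define y where "y = \<alpha> h x"
  define A where "A = d x y"
  have h: "h \<in> carrier G" and y: "y \<in> verts K" using abc x by (auto simp: h_def y_def)
  have A: "2 * M + R < A" using l by (simp add: A_def y_def h_def)
  obtain ps where ps: "walk K x ps y" "length ps = A" using ex_geodesic[OF x y] A_def by blast
  define p1 p2 p3 where "p1 = take M ps" and "p2 = take R (drop M ps)" and "p3 = drop R (drop M ps)"
  have split: "ps = p1 @ p2 @ p3" by (simp only: p1_def p2_def p3_def append_take_drop_id)
  have len: "length p1 = M" "length p2 = R" "length p3 = A - (M + R)"
    using A ps(2) by (auto simp: p1_def p2_def p3_def)
  obtain m m' where w: "walk K x p1 m" "walk K m p2 m'" "walk K m' p3 y"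
    using ps(1) unfolding split by (auto simp: walk_append)
  have m: "m \<in> verts K" "m' \<in> verts K" using walk_verts[OF w(2)] by auto
  have w23: "walk K m (p2 @ p3) y" using w by (auto simp: walk_append)
  have w12: "walk K x (p1 @ p2) m'" using w by (auto simp: walk_append)
  have d1: "d x m = M" "d m y = A - M"
    using geodesic_split[of x p1 "p2 @ p3" y m] ps w(1) w23 split len A by (auto simp: A_def)
  have d2: "d x m' = M + R" "d m' y = A - (M + R)"
    using geodesic_split[of x "p1 @ p2" p3 y m'] ps w(3) w12 split len A by (auto simp: A_def)
  have d3: "d m m' = R"
    using geodesic_split(1)[of m p2 p3 y m'] w(2,3) w23 len d1 A by auto
  define f where "f = (\<lambda>(i::nat, j::nat). b [^] i \<otimes> c [^] j)"
  define S where "S = f ` ({..<k} \<times> {..<k})"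
  have "card S = k * k"
    unfolding S_def using card_image[of f "{..<k} \<times> {..<k}"] inj inj_on_subset[of f UNIV]
    by (simp add: f_def card_cartesian_product)
  have "finite S" unfolding S_def by blast
  have SG: "s \<in> carrier G" if "s \<in> S" for s using that abc by (auto simp: S_def f_def)
  have small: "d x (\<alpha> s x) \<le> r" if s: "s \<in> S" for s
  proof -
    obtain i j where ij: "i < k" "j < k" "s = b [^] i \<otimes> c [^] j" using s by (auto simp: S_def f_def)
    have "d x (\<alpha> s x) \<le> d x (\<alpha> (b [^] i) x) + d (\<alpha> (b [^] i) x) (\<alpha> (b [^] i) (\<alpha> (c [^] j) x))"
      using ij abc x by (simp add: act_vert_mult dist_triangle)
    also have "\<dots> \<le> i * d x (\<alpha> b x) + j * d x (\<alpha> c x)"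
      using dist_pow_le[OF abc(2) x, of i] dist_pow_le[OF abc(3) x, of j] abc x by (simp add: dist_act)
    also have "\<dots> \<le> k * d x (\<alpha> b x) + k * d x (\<alpha> c x)"
      using ij by (intro add_mono mult_le_mono1) auto
    finally show ?thesis by (simp add: r_def E_def algebra_simps)
  qed
  have comm_h: "s \<otimes> h = h \<otimes> s" if s: "s \<in> S" for s
  proof -
    obtain i j where ij: "s = b [^] (i::nat) \<otimes> c [^] (j::nat)" using s by (auto simp: S_def f_def)
    have *: "g [^] i \<otimes> h = h \<otimes> g [^] i" if "g \<in> carrier G" "a \<otimes> g = g \<otimes> a" for g and i :: nat
      unfolding h_def using that abc(1) by (metis group_commutes_pow nat_pow_closed)
    have "s \<otimes> h = b [^] i \<otimes> (c [^] j \<otimes> h)" using ij abc h by (simp add: m_assoc)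
    also have "\<dots> = (b [^] i \<otimes> h) \<otimes> c [^] j" using *[OF abc(3) comm(2)] abc h by (simp add: m_assoc)
    also have "\<dots> = h \<otimes> s" using *[OF abc(2) comm(1)] ij abc h by (simp add: m_assoc)
    finally show ?thesis .
  qed
  have between: "d x (\<alpha> s q) + d (\<alpha> s q) y \<le> A + 2 * D"
    if s: "s \<in> S" and q: "q \<in> verts K" "M \<le> d x q" "M \<le> d q y" "d x q + d q y = A" for s q
  proof -
    have sG: "s \<in> carrier G" using SG s .
    \<comment> \<open>Commutation with \<open>h\<close> is what bounds the displacement of the far
      end \<open>y\<close> by that of \<open>x\<close>.\<close>
    have "\<alpha> s y = \<alpha> h (\<alpha> s x)"
      using comm_h[OF s] sG h x unfolding y_def by (metis act_vert_mult)
    then have "d y (\<alpha> s y) \<le> r" using small[OF s] sG h x by (simp add: y_def dist_act)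
    then show ?thesis
      using thin_quadrilateral[OF D, of x y "\<alpha> s x" "\<alpha> s y" "\<alpha> s q" r] small[OF s] sG x y q
      by (simp add: dist_act A_def M_def)
  qed
  \<comment> \<open>Recording the two distances separately would allow a number of values quadratic
    in \<open>k\<close>, like the number of elements. The second entry is instead their difference,
    shifted by \<open>R\<close> to stay nonnegative in \<open>nat\<close>; by the triangle
    inequality it takes at most \<open>2 * R + 1\<close> values.\<close>
  define \<kappa> where "\<kappa> s = (d x (\<alpha> s m), d x (\<alpha> s m') + R - d x (\<alpha> s m))" for s
  have \<kappa>: "\<kappa> s \<in> {M - r..M + r} \<times> {0..2 * R} \<and> d x (\<alpha> s m) \<le> d x (\<alpha> s m') + R" if "s \<in> S" for s
  proof -
    have sG: "s \<in> carrier G" using SG that .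
    have "d x (\<alpha> s m) \<le> d x (\<alpha> s x) + d (\<alpha> s x) (\<alpha> s m)" "d (\<alpha> s x) (\<alpha> s m) \<le> d (\<alpha> s x) x + d x (\<alpha> s m)"
      "d x (\<alpha> s m') \<le> d x (\<alpha> s m) + d (\<alpha> s m) (\<alpha> s m')" "d x (\<alpha> s m) \<le> d x (\<alpha> s m') + d (\<alpha> s m') (\<alpha> s m)"
      using sG x m by (simp_all add: dist_triangle)
    moreover have "d (\<alpha> s x) x = d x (\<alpha> s x)" "d (\<alpha> s m') (\<alpha> s m) = d (\<alpha> s m) (\<alpha> s m')"
      using sG x m by (simp_all add: dist_sym)
    ultimately show ?thesis using small[OF that] d1 d3 sG x m by (auto simp: \<kappa>_def dist_act)
  qed
  have close: "d (\<alpha> s q) (\<alpha> s' q) \<le> C"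
    if s: "s \<in> S" "s' \<in> S" and eq: "d x (\<alpha> s q) = d x (\<alpha> s' q)"
      and q: "q \<in> verts K" "M \<le> d x q" "M \<le> d q y" "d x q + d q y = A" for s s' q
  proof -
    have "\<alpha> s q \<in> verts K" "\<alpha> s' q \<in> verts K" using SG s q by auto
    then show ?thesis
      using D[of "\<alpha> s q" x "\<alpha> s' q" y] between[OF s(1) q] between[OF s(2) q] eq x y
        dist_sym[of x "\<alpha> s q"] by (simp add: C_def A_def)
  qed
  have fibre: "card {s \<in> S. \<kappa> s = z} \<le> N" if "z \<in> \<kappa> ` S" for z
  proof -
    obtain s0 where s0: "s0 \<in> S" "z = \<kappa> s0" using \<open>z \<in> \<kappa> ` S\<close> by blast
    \<comment> \<open>Two elements with the same value of \<open>\<kappa>\<close> send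
      \<open>m\<close> to nearby points and \<open>m'\<close> to nearby points, so
      \<open>inv s0 \<otimes> s\<close> moves both only slightly and the acylindricity bound
      applies.\<close>
    let ?g = "\<lambda>s. inv s0 \<otimes> s"
    let ?A = "{g \<in> carrier G. d m (\<alpha> g m) \<le> C \<and> d m' (\<alpha> g m') \<le> C}"
    have "?g ` {s \<in> S. \<kappa> s = z} \<subseteq> ?A"
    proof clarify
      fix s assume s: "s \<in> S" "z = \<kappa> s"
      have G: "s \<in> carrier G" "s0 \<in> carrier G" using SG s s0 by auto
      have "d x (\<alpha> s0 m) = d x (\<alpha> s m)" "d x (\<alpha> s0 m') = d x (\<alpha> s m')"
        using s(2) s0(2) \<kappa>[OF s(1)] \<kappa>[OF s0(1)] by (auto simp: \<kappa>_def)
      then have "d (\<alpha> s0 m) (\<alpha> s m) \<le> C" "d (\<alpha> s0 m') (\<alpha> s m') \<le> C"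
        using close[OF s0(1) s(1), of m] close[OF s0(1) s(1), of m'] m d1 d2 A by auto
      moreover have "d q (\<alpha> (?g s) q) = d (\<alpha> s0 q) (\<alpha> s q)" if "q \<in> verts K" for q
        using dist_act[of s0 q "\<alpha> (?g s) q"] G that by (simp add: inv_solve_left flip: act_vert_mult m_assoc)
      ultimately show "?g s \<in> carrier G \<and> d m (\<alpha> (?g s) m) \<le> C \<and> d m' (\<alpha> (?g s) m') \<le> C"
        using m G by simp
    qed
    moreover have "inj_on ?g {s \<in> S. \<kappa> s = z}" using SG SG[OF s0(1)] by (intro inj_onI) auto
    ultimately have "card {s \<in> S. \<kappa> s = z} \<le> card ?A"
      using N[OF m d3] by (intro card_inj_on_le[of ?g]) auto
    then show ?thesis using N[OF m d3] by linarith
  qed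
  have "S = (\<Union>z\<in>\<kappa> ` S. {s \<in> S. \<kappa> s = z})" by blast
  then have "card S \<le> (\<Sum>z\<in>\<kappa> ` S. card {s \<in> S. \<kappa> s = z})"
    using card_UN_le[of "\<kappa> ` S" "\<lambda>z. {s \<in> S. \<kappa> s = z}"] \<open>finite S\<close> by simp
  also have "\<dots> \<le> card (\<kappa> ` S) * N" using fibre sum_bounded_above[of "\<kappa> ` S" _ N] by simp
  also have "card (\<kappa> ` S) \<le> card ({M - r..M + r} \<times> {0..2 * R})"
    using \<kappa> by (intro card_mono image_subsetI) blast+
  also have "card ({M - r..M + r} \<times> {0..2 * R}) = (2 * r + 1) * (2 * R + 1)"
    by (simp add: card_cartesian_product M_def)
  finally have "k * k \<le> (2 * r + 1) * (2 * R + 1) * N" using \<open>card S = k * k\<close> by simp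
  also have "\<dots> \<le> (k * (2 * E + 1)) * (2 * R + 1) * N"
    by (intro mult_le_mono1) (simp add: r_def k_def algebra_simps)
  also have "\<dots> = k * (k - 1)" by (simp add: k_def algebra_simps)
  also have "\<dots> < k * k" by (simp add: k_def)
  finally show False by simp
qed

end

text \<open>\<open>link\<close> lets the fixed vertex of \<open>a\<close> spread to all of
  \<open>S\<close> in two commutation steps. Elements of \<open>W\<close> may have finite order and
  need not commute with anything in \<open>S\<close>, so they are treated through the conjugates of
  \<open>a\<close>.\<close>

theorem (in group) not_strongly_relatively_hyperbolic_if_commuting:
  assumes S: "S \<subseteq> carrier G" "\<And>s. s \<in> S \<Longrightarrow> inj (\<lambda>k::nat. s [^] k)"
    and link: "\<And>s t. \<lbrakk>s \<in> S; t \<in> S\<rbrakk> \<Longrightarrow> \<exists>u\<in>S. s \<otimes> u = u \<otimes> s \<and> t \<otimes> u = u \<otimes> t"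
    and abc: "a \<in> S" "b \<in> carrier G" "c \<in> carrier G" "a \<otimes> b = b \<otimes> a" "a \<otimes> c = c \<otimes> a"
      "inj (\<lambda>(i::nat, j::nat). b [^] i \<otimes> c [^] j)"
    and W: "W \<subseteq> carrier G" "\<And>w s. \<lbrakk>w \<in> W; s \<in> S\<rbrakk> \<Longrightarrow> w \<otimes> s \<otimes> inv w \<in> S"
    and gen: "carrier G = generate G (S \<union> W)"
  shows "\<not> strongly_relatively_hyperbolic TYPE('v) TYPE('e) G \<L>"
proof
  assume "strongly_relatively_hyperbolic TYPE('v) TYPE('e) G \<L>"
  then obtain K :: "('v, 'e) graph" and \<alpha> \<beta> where L: "\<L> \<noteq> {}"
      "\<And>L. L \<in> \<L> \<Longrightarrow> finitely_generated_subgroup L G \<and> L \<noteq> carrier G"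
    and K: "wf_graph K" "connected_graph K" "graph_action G K \<alpha> \<beta>" "hyperbolic_graph K" "fine_graph K"
      "finite (orbits G (edges K) \<beta>)" "\<And>e. e \<in> edges K \<Longrightarrow> finite (stabilizer G \<beta> e)"
    and stabs: "{stabilizer G \<alpha> v | v. v \<in> verts K \<and> infinite_valence K v} =
        {g <# L #> inv g | g L. g \<in> carrier G \<and> L \<in> \<L>}"
    unfolding strongly_relatively_hyperbolic_def by (elim conjE exE) (rule that; blast)
  interpret fine_action G K \<alpha> \<beta> using K by unfold_locales auto
  \<comment> \<open>The conjugate of \<open>L0\<close> by the identity is the stabiliser of some
    vertex of infinite valence; this vertex serves as base point.\<close>
  obtain L0 where "L0 \<in> \<L>" using L(1) by blast
  then have "\<one> <# L0 #> inv \<one> \<in> {g <# L #> inv g | g L. g \<in> carrier G \<and> L \<in> \<L>}" by blast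
  then obtain u where u: "u \<in> verts K" "infinite_valence K u" unfolding stabs[symmetric] by blast
  have a: "a \<in> carrier G" "inj (\<lambda>k::nat. a [^] k)" using S abc(1) by auto
  obtain B where B: "\<And>k::nat. d u (\<alpha> (a [^] k) u) \<le> B"
    using bounded_orbit_of_centralizer[OF K(4) a(1) abc(2-6) u(1)] by blast
  obtain v where v: "v \<in> verts K" "\<alpha> a v = v" using bounded_orbit_fixes[OF a u(1) B] by blast
  have S_fix: "\<alpha> s v = v" if s: "s \<in> S" for s
  proof -
    obtain t where t: "t \<in> S" "a \<otimes> t = t \<otimes> a" "s \<otimes> t = t \<otimes> s" using link[OF abc(1) s] by blast
    have "\<alpha> t v = v" using commuting_fixes[OF a _ t(2) v] t(1) S(1) by blast
    then show ?thesis using commuting_fixes[of t s v] t s S v(1) by auto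
  qed
  have W_fix: "\<alpha> w v = v" if w: "w \<in> W" for w
  proof -
    have G: "w \<in> carrier G" using w W(1) by blast
    have "\<alpha> (w \<otimes> a \<otimes> inv w) v = v" using S_fix[OF W(2)[OF w abc(1)]] .
    then have *: "\<alpha> w (\<alpha> a (\<alpha> (inv w) v)) = v" using G a(1) v(1) by (simp add: act_vert_mult)
    have cancel: "\<alpha> (inv w) (\<alpha> w z) = z" if "z \<in> verts K" for z
      using G that by (simp flip: act_vert_mult)
    have wv: "\<alpha> (inv w) v \<in> verts K" using G v(1) by simp
    \<comment> \<open>Since \<open>w a w^-1\<close> fixes \<open>v\<close>, the element
      \<open>a\<close> fixes \<open>w^-1 v\<close>, which by uniqueness is \<open>v\<close>.\<close>
    have "\<alpha> a (\<alpha> (inv w) v) = \<alpha> (inv w) v"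
      using arg_cong[OF *, of "\<alpha> (inv w)"] cancel[OF act_vert[OF a(1) wv]] by simp
    then have "\<alpha> (inv w) v = v" using fixed_vertex_unique[OF a wv _ v] by simp
    moreover have "\<alpha> w (\<alpha> (inv w) v) = v" using G v(1) by (simp flip: act_vert_mult)
    ultimately show ?thesis by simp
  qed
  have "S \<union> W \<subseteq> stabilizer G \<alpha> v" using S_fix W_fix S(1) W(1) by (auto simp: stabilizer_def)
  then have "carrier G \<subseteq> stabilizer G \<alpha> v"
    using generate_subgroup_incl[OF _ group_action.stabilizer_subgroup[OF vert_action v(1)]] gen by blast
  then have stab: "stabilizer G \<alpha> v = carrier G" by (auto simp: stabilizer_def)
  \<comment> \<open>One edge at \<open>v\<close> is enough: the powers of \<open>a\<close> fix
    \<open>v\<close> and move this edge to infinitely many others. If \<open>u = v\<close>, the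
    valence provides it, otherwise the first edge of a geodesic to \<open>u\<close>.\<close>
  have "\<exists>e\<in>edges K. v \<in> ends K e"
  proof (cases "u = v")
    case True
    then show ?thesis using u(2) unfolding infinite_valence_def by (metis (mono_tags, lifting) Collect_empty_eq finite.emptyI)
  next
    case False
    then show ?thesis using geodesic_first_edge[OF v(1) u(1)] by blast
  qed
  then obtain e where e: "e \<in> edges K" "v \<in> ends K e" by blast
  have "v \<in> ends K (\<beta> (a [^] (k::nat)) e)" for k
    using ends_act[OF nat_pow_closed[OF a(1)] e(1)] e(2) act_vert_pow_fixed[OF a(1) v]
    by (metis image_eqI)
  then have "range (\<lambda>k::nat. \<beta> (a [^] k) e) \<subseteq> {e \<in> edges K. v \<in> ends K e}" using a(1) e(1) by auto
  moreover have "infinite (range (\<lambda>k::nat. \<beta> (a [^] k) e))"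
    using inj_edge_powers[OF a e(1)] by (simp add: finite_image_iff)
  ultimately have "infinite_valence K v" unfolding infinite_valence_def using finite_subset by blast
  then have "carrier G \<in> {g <# L #> inv g | g L. g \<in> carrier G \<and> L \<in> \<L>}"
    using v(1) stab unfolding stabs[symmetric] by blast
  then obtain g L where gL: "g \<in> carrier G" "L \<in> \<L>" "carrier G = g <# L #> inv g" by blast
  have LG: "L \<subseteq> carrier G" using L(2)[OF gL(2)] unfolding finitely_generated_subgroup_def
    by (meson subgroup.subset)
  have "carrier G \<subseteq> L"
  proof
    fix z assume z: "z \<in> carrier G"
    then have "g \<otimes> z \<otimes> inv g \<in> g <# L #> inv g" using gL by auto
    then obtain l where l: "l \<in> L" "g \<otimes> z \<otimes> inv g = g \<otimes> l \<otimes> inv g"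
      unfolding l_coset_def r_coset_def by blast
    then have "z = l" using z LG gL(1) by auto
    then show "z \<in> L" using l(1) by simp
  qed
  then show False using L(2)[OF gL(2)] LG by blast
qed

section \<open>Reduced words and automorphisms of free groups\<close>

lemma carrier_free_group: "w \<in> carrier (free_group n) \<longleftrightarrow> reduced w \<and> fst ` set w \<subseteq> {..<n}"
  by (simp add: free_group_def)

lemma mult_free_group: "u \<otimes>\<^bsub>free_group n\<^esub> v = foldr rcons u v"
  by (simp add: free_group_def)

lemma one_free_group: "\<one>\<^bsub>free_group n\<^esub> = []"
  by (simp add: free_group_def)

lemma inv_letter_neq [simp]: "inv_letter a \<noteq> a" "a \<noteq> inv_letter a"
  by (cases a; simp add: inv_letter_def)+

lemma inv_letter_eq_iff [simp]: "inv_letter a = inv_letter b \<longleftrightarrow> a = b"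
  by (metis inv_letter_inv_letter)

lemma inv_letter_eq_swap: "inv_letter a = b \<longleftrightarrow> a = inv_letter b"
  by auto

lemma snd_inv_letter [simp]: "snd (inv_letter a) \<longleftrightarrow> \<not> snd a"
  by (simp add: inv_letter_def)

lemma fst_eq_imp: "fst a = fst b \<Longrightarrow> a = b \<or> a = inv_letter b"
  by (cases a; cases b) (auto simp: inv_letter_def)

definition word_inv :: "letter list \<Rightarrow> letter list"
  where "word_inv w = rev (map inv_letter w)"

lemma length_word_inv [simp]: "length (word_inv w) = length w"
  by (simp add: word_inv_def)

lemma word_inv_append [simp]: "word_inv (u @ v) = word_inv v @ word_inv u"
  by (simp add: word_inv_def)

lemma word_inv_word_inv [simp]: "word_inv (word_inv w) = w"
  by (simp add: word_inv_def rev_map comp_def)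

lemma word_inv_Nil [simp]: "word_inv [] = []"
  by (simp add: word_inv_def)

lemma word_inv_singleton [simp]: "word_inv [a] = [inv_letter a]"
  by (simp add: word_inv_def)

lemma fst_set_word_inv: "fst ` set (word_inv w) = fst ` set w"
  by (simp add: word_inv_def image_image)

lemma reduced_append_iff:
  "reduced (u @ v) \<longleftrightarrow> reduced u \<and> reduced v \<and> (u \<noteq> [] \<longrightarrow> v \<noteq> [] \<longrightarrow> hd v \<noteq> inv_letter (last u))"
  by (auto simp: reduced_def successively_append_iff)

lemma reduced_word_inv: "reduced w \<Longrightarrow> reduced (word_inv w)"
proof (induction w)
  case (Cons a w)
  then show ?case
    by (cases w) (auto simp: reduced_append_iff reduced_Cons word_inv_def)
qed simp

lemma word_inv_carrier: "w \<in> carrier (free_group n) \<Longrightarrow> word_inv w \<in> carrier (free_group n)"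
  by (simp add: carrier_free_group reduced_word_inv fst_set_word_inv)

lemma inv_free_group:
  assumes "w \<in> carrier (free_group n)"
  shows "inv\<^bsub>free_group n\<^esub> w = word_inv w"
proof (rule group.inv_equality[OF group_free_group _ assms word_inv_carrier[OF assms]])
  show "word_inv w \<otimes>\<^bsub>free_group n\<^esub> w = \<one>\<^bsub>free_group n\<^esub>"
    using assms foldr_inverse[of "[]" w] by (simp add: carrier_free_group mult_free_group one_free_group word_inv_def foldr_Nil_right)
qed

lemma letter_carrier [simp]: "[a] \<in> carrier (free_group n) \<longleftrightarrow> fst a < n"
  by (auto simp: carrier_free_group reduced_Cons)

lemma Cons_carrier:
  assumes "a # w \<in> carrier (free_group n)"
  shows "fst a < n" "w \<in> carrier (free_group n)" "[a] \<otimes>\<^bsub>free_group n\<^esub> w = a # w"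
  using assms rcons_reduced[of a w] by (auto simp: carrier_free_group reduced_Cons mult_free_group)

lemma snoc_carrier:
  assumes "w @ [a] \<in> carrier (free_group n)"
  shows "fst a < n" "w \<in> carrier (free_group n)" "w \<otimes>\<^bsub>free_group n\<^esub> [a] = w @ [a]"
    "w \<noteq> [] \<Longrightarrow> a \<noteq> inv_letter (last w)"
proof -
  have "foldr rcons w [a] = w @ [a]" if "reduced (w @ [a])" for w
    using that
  proof (induction w)
    case (Cons b w)
    then have "reduced (w @ [a])" by (simp add: reduced_Cons)
    then show ?case using Cons rcons_reduced[of b "w @ [a]"] by simp
  qed simp
  then show "fst a < n" "w \<in> carrier (free_group n)" "w \<otimes>\<^bsub>free_group n\<^esub> [a] = w @ [a]"
    "w \<noteq> [] \<Longrightarrow> a \<noteq> inv_letter (last w)"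
    using assms by (auto simp: carrier_free_group mult_free_group reduced_append_iff)
qed

lemma foldr_rcons_reduced: "reduced (u @ v) \<Longrightarrow> foldr rcons u v = u @ v"
proof (induction u)
  case (Cons a u)
  then have "foldr rcons u v = u @ v" by (simp add: reduced_Cons)
  then show ?case using rcons_reduced[of a "u @ v"] Cons.prems by simp
qed simp

section \<open>Cancellation in products of reduced words\<close>

abbreviation lcp :: "letter list \<Rightarrow> letter list \<Rightarrow> nat"
  where "lcp u v \<equiv> length (longest_common_prefix u v)"

lemma lcp_sym: "lcp u v = lcp v u"
  by (induction u v rule: longest_common_prefix.induct) auto

lemma take_lcp: "take (lcp u v) u = take (lcp u v) v"
  by (induction u v rule: longest_common_prefix.induct) auto

lemma lcp_le: "lcp u v \<le> length u" "lcp u v \<le> length v"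
  by (induction u v rule: longest_common_prefix.induct) auto

lemma lcp_ge: "k \<le> length u \<Longrightarrow> k \<le> length v \<Longrightarrow> take k u = take k v \<Longrightarrow> k \<le> lcp u v"
proof (induction u v arbitrary: k rule: longest_common_prefix.induct)
  case (1 x xs y ys)
  then show ?case by (cases k) auto
qed auto

text \<open>The first \<open>m\<close> letters of \<open>u\<close> already show where
  \<open>u\<close> and \<open>v\<close> part or \<open>v\<close> ends, so what follows them does not
  matter.\<close>

lemma lcp_take_append: "lcp u v < m \<Longrightarrow> m \<le> length u \<Longrightarrow> lcp (take m u @ w) v = lcp u v"
proof (induction u v arbitrary: m rule: longest_common_prefix.induct)
  case (1 x xs y ys)
  then show ?case by (cases m) auto
qed auto

text \<open>What cancels in a product is the longest common prefix of \<open>u^-1\<close> and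
  \<open>v\<close>, removed from the end of \<open>u\<close> and from the start of
  \<open>v\<close>.\<close>

lemma mult_eq_take_drop:
  assumes "reduced u" "reduced v"
  shows "foldr rcons u v = take (length u - lcp (word_inv u) v) u @ drop (lcp (word_inv u) v) v"
  using assms
proof (induction u arbitrary: v rule: rev_induct)
  case (snoc c u)
  show ?case
  proof (cases "v \<noteq> [] \<and> hd v = inv_letter c")
    case True
    then obtain v' where v: "v = inv_letter c # v'" by (cases v) auto
    then show ?thesis using snoc by (simp add: rcons_def reduced_append_iff reduced_Cons)
  next
    case False
    then have "lcp (word_inv (u @ [c])) v = 0" by (cases v) auto
    moreover have "reduced ((u @ [c]) @ v)" using snoc.prems False by (auto simp: reduced_append_iff reduced_Cons)
    ultimately show ?thesis using foldr_rcons_reduced[of "u @ [c]" v] by simp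
  qed
qed simp

lemma length_mult:
  assumes "reduced u" "reduced v"
  shows "length (foldr rcons u v) = length u + length v - 2 * lcp (word_inv u) v"
  using mult_eq_take_drop[OF assms] lcp_le[of "word_inv u" v] by simp

text \<open>A nontrivial reduced word of even length does not have the form \<open>h h\<inverse>\<close>, and the middle letter of a
  word of odd length is not its own inverse.\<close>

lemma lcp_word_inv_self:
  assumes "reduced w" "w \<noteq> []"
  shows "2 * lcp w (word_inv w) < length w"
proof (rule ccontr)
  assume "\<not> ?thesis"
  then have k: "length w \<le> 2 * lcp w (word_inv w)" by simp
  have sym: "w ! i = inv_letter (w ! (length w - Suc i))" if "i < lcp w (word_inv w)" for i
  proof -
    have "w ! i = word_inv w ! i" using take_lcp[of w "word_inv w"] that by (metis nth_take)
    moreover have "i < length w" using that lcp_le(1)[of w "word_inv w"] by linarith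
    ultimately show ?thesis by (simp add: word_inv_def rev_nth)
  qed
  have red: "w ! Suc i \<noteq> inv_letter (w ! i)" if "Suc i < length w" for i
    using assms(1) that by (auto simp: reduced_def successively_conv_nth)
  show False
  proof (cases "even (length w)")
    case True
    then obtain m where m: "length w = 2 * Suc m" using assms(2) by (metis evenE length_0_conv mult_0_right not0_implies_Suc)
    have "w ! m = inv_letter (w ! Suc m)" using sym[of m] k m by simp
    then show False using red[of m] m by simp
  next
    case False
    then obtain m where "length w = 2 * m + 1" by (auto elim: oddE)
    then show False using sym[of m] k by simp
  qed
qed

lemma free_group_hom_eqI:
  assumes H: "group H" and f: "f \<in> hom (free_group n) H" and g: "g \<in> hom (free_group n) H"
    and eq: "\<And>a. fst a < n \<Longrightarrow> f [a] = g [a]"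
    and w: "w \<in> carrier (free_group n)"
  shows "f w = g w"
  using w
proof (induction w)
  case Nil
  show ?case using hom_one[OF f group_free_group H] hom_one[OF g group_free_group H] by (simp add: one_free_group)
next
  case (Cons a w)
  note C = Cons_carrier[OF Cons.prems]
  have "f (a # w) = f [a] \<otimes>\<^bsub>H\<^esub> f w" "g (a # w) = g [a] \<otimes>\<^bsub>H\<^esub> g w"
    using hom_mult[OF f, of "[a]" w] hom_mult[OF g, of "[a]" w] C by simp_all
  then show ?case using Cons.IH C eq by simp
qed

text \<open>Images are prescribed for inverse letters as well, so that the extension to words is a
  plain fold without case distinction.\<close>

definition letter_map :: "nat \<Rightarrow> (letter \<Rightarrow> letter list) \<Rightarrow> bool"
  where "letter_map n \<phi> \<longleftrightarrow> (\<forall>a. fst a < n \<longrightarrow> \<phi> a \<in> carrier (free_group n) \<and> \<phi> (inv_letter a) = word_inv (\<phi> a))"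

lemma letter_mapD:
  assumes "letter_map n \<phi>" "fst a < n"
  shows "\<phi> a \<in> carrier (free_group n)" "\<phi> (inv_letter a) = word_inv (\<phi> a)"
  using assms unfolding letter_map_def by blast+

definition word_extension :: "nat \<Rightarrow> (letter \<Rightarrow> letter list) \<Rightarrow> letter list \<Rightarrow> letter list"
  where "word_extension n \<phi> = (\<lambda>w\<in>carrier (free_group n). foldr (\<lambda>a. foldr rcons (\<phi> a)) w [])"

lemma word_extension_hom:
  assumes "letter_map n \<phi>"
  shows "word_extension n \<phi> \<in> hom (free_group n) (free_group n)"
proof -
  interpret F: group "free_group n" by (rule group_free_group)
  define e where "e w = foldr (\<lambda>a. foldr rcons (\<phi> a)) w []" for w
  have e_Cons: "e (a # w) = \<phi> a \<otimes>\<^bsub>free_group n\<^esub> e w" for a w by (simp add: e_def mult_free_group)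
  have \<phi>: "\<phi> a \<in> carrier (free_group n)" "\<phi> (inv_letter a) = inv\<^bsub>free_group n\<^esub> (\<phi> a)" if "fst a < n" for a
    using letter_mapD[OF assms that] by (simp_all add: inv_free_group)
  have e_carrier: "e w \<in> carrier (free_group n)" if "fst ` set w \<subseteq> {..<n}" for w
    using that
  proof (induction w)
    case Nil
    show ?case using F.one_closed by (simp add: e_def one_free_group)
  qed (use \<phi> in \<open>auto simp: e_Cons\<close>)
  \<comment> \<open>The fold respects free reduction: when \<open>a\<close> meets its inverse, the
    two images cancel because \<open>\<phi>\<close> is compatible with inversion.\<close>
  have e_rcons: "e (rcons a w) = \<phi> a \<otimes>\<^bsub>free_group n\<^esub> e w" if "fst a < n" "fst ` set w \<subseteq> {..<n}" for a w
  proof (cases "w \<noteq> [] \<and> hd w = inv_letter a")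
    case True
    then obtain v where v: "w = inv_letter a # v" by (cases w) auto
    then have "e v \<in> carrier (free_group n)" using that e_carrier by simp
    then show ?thesis using v \<phi>[OF that(1)] by (simp add: rcons_def e_Cons flip: F.m_assoc)
  next
    case False
    then have "rcons a w = a # w" unfolding rcons_def by (rule if_not_P)
    then show ?thesis by (simp add: e_Cons)
  qed
  have e_mult: "e (foldr rcons u v) = e u \<otimes>\<^bsub>free_group n\<^esub> e v"
    if "fst ` set u \<subseteq> {..<n}" "fst ` set v \<subseteq> {..<n}" for u v
    using that(1)
  proof (induction u)
    case Nil
    then show ?case using F.l_one[OF e_carrier[OF that(2)]] by (simp add: e_def one_free_group)
  next
    case (Cons a u)
    have "fst ` set (foldr rcons u v) \<subseteq> {..<n}" using set_foldr[of u v] Cons.prems that(2) by fastforce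
    then show ?case using Cons \<phi>[of a] e_carrier[of u] e_carrier[OF that(2)] e_rcons
      by (simp add: e_Cons F.m_assoc)
  qed
  show ?thesis
  proof (rule homI)
    fix u assume "u \<in> carrier (free_group n)"
    then show "word_extension n \<phi> u \<in> carrier (free_group n)"
      using e_carrier[of u] by (simp add: word_extension_def e_def carrier_free_group[of u])
  next
    fix u v assume uv: "u \<in> carrier (free_group n)" "v \<in> carrier (free_group n)"
    then have "u \<otimes>\<^bsub>free_group n\<^esub> v \<in> carrier (free_group n)" by simp
    then show "word_extension n \<phi> (u \<otimes>\<^bsub>free_group n\<^esub> v) = word_extension n \<phi> u \<otimes>\<^bsub>free_group n\<^esub> word_extension n \<phi> v"
      using e_mult[of u v] uv by (simp add: word_extension_def e_def mult_free_group carrier_free_group)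
  qed
qed

lemma word_extension_letter:
  assumes "letter_map n \<phi>" "fst a < n"
  shows "word_extension n \<phi> [a] = \<phi> a"
  using foldr_Nil_right[of "\<phi> a"] letter_mapD(1)[OF assms] assms(2)
  by (simp add: word_extension_def carrier_free_group[of "\<phi> a"])

section \<open>Automorphisms of the free group\<close>

lemma autoI_inverse:
  assumes G: "group G" and f: "f \<in> hom G G" "f \<in> extensional (carrier G)" and g: "g \<in> hom G G"
    and "\<And>x. x \<in> carrier G \<Longrightarrow> g (f x) = x" "\<And>x. x \<in> carrier G \<Longrightarrow> f (g x) = x"
  shows "f \<in> auto G"
proof -
  have "bij_betw f (carrier G) (carrier G)"
    using assms by (intro bij_betwI[where g = g]) (auto simp: hom_def)
  then show ?thesis using f by (simp add: auto_def Bij_def)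
qed

lemma auto_hom: "f \<in> auto G \<Longrightarrow> f \<in> hom G G"
  by (simp add: auto_def)

lemma auto_closed: "f \<in> auto G \<Longrightarrow> x \<in> carrier G \<Longrightarrow> f x \<in> carrier G"
  by (auto simp: auto_def hom_def)

lemma auto_inj: "f \<in> auto G \<Longrightarrow> x \<in> carrier G \<Longrightarrow> y \<in> carrier G \<Longrightarrow> f x = f y \<Longrightarrow> x = y"
  by (auto simp: auto_def Bij_def bij_betw_def dest: inj_onD)

lemma auto_surj:
  assumes "f \<in> auto G" "y \<in> carrier G"
  shows "\<exists>x\<in>carrier G. f x = y"
proof -
  have "f ` carrier G = carrier G" using assms(1) by (simp add: auto_def Bij_def bij_betw_def)
  then show ?thesis using assms(2) by (metis imageE)
qed

lemma AutoGroup_simps [simp]: "carrier (AutoGroup G) = auto G" "\<one>\<^bsub>AutoGroup G\<^esub> = (\<lambda>x\<in>carrier G. x)"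
  by (simp_all add: AutoGroup_def BijGroup_def)

lemma AutoGroup_mult: "f \<in> auto G \<Longrightarrow> g \<in> auto G \<Longrightarrow> f \<otimes>\<^bsub>AutoGroup G\<^esub> g = compose (carrier G) f g"
  by (simp add: AutoGroup_def BijGroup_def auto_def)

lemma auto_free_group_eqI:
  assumes "f \<in> auto (free_group n)" "g \<in> auto (free_group n)" "\<And>a. fst a < n \<Longrightarrow> f [a] = g [a]"
  shows "f = g"
proof (rule extensionalityI)
  show "f \<in> extensional (carrier (free_group n))" "g \<in> extensional (carrier (free_group n))"
    using assms by (auto simp: auto_def Bij_def)
  show "f w = g w" if "w \<in> carrier (free_group n)" for w
    using free_group_hom_eqI[OF group_free_group auto_hom[OF assms(1)] auto_hom[OF assms(2)] assms(3) that] .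
qed

lemma auto_word_inv:
  assumes "f \<in> auto (free_group n)" "w \<in> carrier (free_group n)"
  shows "f (word_inv w) = word_inv (f w)"
proof -
  interpret group_hom "free_group n" "free_group n" f
    using auto_hom[OF assms(1)] group_free_group by (simp add: group_hom_def group_hom_axioms_def)
  show ?thesis using hom_inv[OF assms(2)] assms auto_closed[OF assms] by (simp add: inv_free_group)
qed

lemma auto_inv_letter: "f \<in> auto (free_group n) \<Longrightarrow> fst a < n \<Longrightarrow> f [inv_letter a] = word_inv (f [a])"
  using auto_word_inv[of f n "[a]"] by simp

lemma auto_letter_neq_Nil: 
  assumes "f \<in> auto (free_group n)" "fst a < n"
  shows "f [a] \<noteq> []"
proof
  assume "f [a] = []"
  moreover have "f [] = []"
    using hom_one[OF auto_hom[OF assms(1)] group_free_group group_free_group] by (simp add: one_free_group)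
  moreover have "[] \<in> carrier (free_group n)" by (simp add: carrier_free_group)
  ultimately show False using auto_inj[OF assms(1), of "[a]" "[]"] assms(2) by simp
qed

text \<open>Since \<open>a\<close> and \<open>b\<close> range over all letters, the maps \<open>a \<mapsto> b\<inverse> a\<close> cover left and right multiplications by
  generators and by their inverses.\<close>

definition transvection_letter :: "letter \<Rightarrow> letter \<Rightarrow> letter \<Rightarrow> letter list"
  where "transvection_letter a b c =
    (if c = a then [inv_letter b, a] else if c = inv_letter a then [inv_letter a, b] else [c])"

definition transvection :: "nat \<Rightarrow> letter \<Rightarrow> letter \<Rightarrow> letter list \<Rightarrow> letter list"
  where "transvection n a b = word_extension n (transvection_letter a b)"

context
  fixes n :: nat and a b :: letter
  assumes ab: "fst a < n" "fst b < n" "fst a \<noteq> fst b"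
begin

lemma letter_map_transvection: "letter_map n (transvection_letter a b)"
proof -
  have ne: "a \<noteq> b" "a \<noteq> inv_letter b" "b \<noteq> inv_letter a" using ab(3) by auto
  show ?thesis
    using ab ne by (auto simp: letter_map_def transvection_letter_def carrier_free_group reduced_Cons word_inv_def
      inv_letter_eq_swap)
qed

lemma transvection_apply_letter: "fst c < n \<Longrightarrow> transvection n a b [c] = transvection_letter a b c"
  unfolding transvection_def by (rule word_extension_letter[OF letter_map_transvection])

lemma transvection_hom: "transvection n a b \<in> hom (free_group n) (free_group n)"
  unfolding transvection_def by (rule word_extension_hom[OF letter_map_transvection])

end

text \<open>Both maps fix \<open>b\<close>, which belongs to a different generator from
  \<open>a\<close>, so \<open>b^-1 a\<close> is sent to \<open>b^-1 b a = a\<close>.\<close>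

lemma transvection_cancel:
  assumes "fst a < n" "fst b < n" "fst a \<noteq> fst b" "w \<in> carrier (free_group n)"
  shows "transvection n a (inv_letter b) (transvection n a b w) = w"
proof -
  let ?F = "free_group n"
  have ab': "fst a < n" "fst (inv_letter b) < n" "fst a \<noteq> fst (inv_letter b)" using assms by auto
  note h = transvection_hom[OF assms(1-3)] and h' = transvection_hom[OF ab']
  have ne: "a \<noteq> b" "a \<noteq> inv_letter b" "b \<noteq> inv_letter a" "b \<noteq> a" "inv_letter b \<noteq> inv_letter a"
    using assms(3) by auto
  have "(transvection n a (inv_letter b) \<circ> transvection n a b) w = (\<lambda>x. x) w"
  proof (rule free_group_hom_eqI[OF group_free_group hom_compose[OF h h'] _ _ assms(4)])
    show "(\<lambda>x. x) \<in> hom ?F ?F" by (auto simp: hom_def)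
    fix c :: letter assume c: "fst c < n"
    have two: "transvection n a (inv_letter b) [x, y] =
        foldr rcons (transvection_letter a (inv_letter b) x) (transvection_letter a (inv_letter b) y)"
      if "fst x < n" "fst y < n" "y \<noteq> inv_letter x" for x y
    proof -
      have "[x, y] \<in> carrier ?F" using that by (auto simp: carrier_free_group reduced_Cons)
      note C = Cons_carrier(3)[OF this]
      show ?thesis using hom_mult[OF h', of "[x]" "[y]"] that C transvection_apply_letter[OF ab']
        by (simp add: mult_free_group)
    qed
    show "(transvection n a (inv_letter b) \<circ> transvection n a b) [c] = [c]"
      using two[of "inv_letter b" a] two[of "inv_letter a" b] assms(1,2) ne c
      by (auto simp: transvection_apply_letter[OF assms(1-3)] transvection_apply_letter[OF ab']
          transvection_letter_def rcons_def inv_letter_eq_swap)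
  qed
  then show ?thesis by simp
qed

lemma transvection_auto:
  assumes "fst a < n" "fst b < n" "fst a \<noteq> fst b"
  shows "transvection n a b \<in> auto (free_group n)"
proof (rule autoI_inverse[OF group_free_group transvection_hom[OF assms]])
  have ab': "fst a < n" "fst (inv_letter b) < n" "fst a \<noteq> fst (inv_letter b)" using assms by auto
  show "transvection n a b \<in> extensional (carrier (free_group n))"
    by (simp add: transvection_def word_extension_def)
  show "transvection n a (inv_letter b) \<in> hom (free_group n) (free_group n)" by (rule transvection_hom[OF ab'])
  show "transvection n a (inv_letter b) (transvection n a b x) = x" if "x \<in> carrier (free_group n)" for x
    using transvection_cancel[OF assms that] .
  show "transvection n a b (transvection n a (inv_letter b) x) = x" if "x \<in> carrier (free_group n)" for x
    using transvection_cancel[OF ab' that] by simp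
qed

section \<open>Nielsen reduction\<close>

definition letters :: "nat \<Rightarrow> letter set"
  where "letters n = {a. fst a < n}"

lemma finite_letters: "finite (letters n)"
proof -
  have "letters n = {..<n} \<times> UNIV" by (auto simp: letters_def)
  then show ?thesis by simp
qed

text \<open>A word is read as a number in base \<open>2 * n\<close>, leading digit first. On words
  of equal length the numerical order is a lexicographic order, which breaks ties between Nielsen
  moves that preserve length.\<close>

fun word_code :: "nat \<Rightarrow> letter list \<Rightarrow> nat" where
  "word_code n [] = 0"
| "word_code n (a # w) = (2 * fst a + of_bool (snd a)) * (2 * n) ^ length w + word_code n w"

lemma letter_code_less:
  fixes a :: letter
  shows "fst a < n \<Longrightarrow> 2 * fst a + of_bool (snd a) < 2 * n"
  by (cases "snd a") auto

lemma word_code_less: "fst ` set w \<subseteq> {..<n} \<Longrightarrow> word_code n w < (2 * n) ^ length w"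
proof (induction w)
  case (Cons a w)
  then have "Suc (2 * fst a + of_bool (snd a)) \<le> 2 * n" using letter_code_less[of a n] by simp
  then have "Suc (2 * fst a + of_bool (snd a)) * (2 * n) ^ length w \<le> 2 * n * (2 * n) ^ length w"
    by (rule mult_le_mono1)
  then show ?case using Cons by simp
qed simp

lemma word_code_append: "word_code n (u @ v) = word_code n u * (2 * n) ^ length v + word_code n v"
  by (induction u) (simp_all add: algebra_simps power_add)

lemma digit_eq:
  fixes x y u v B :: nat
  assumes "x * B + u = y * B + v" "u < B" "v < B"
  shows "x = y" "u = v"
  using arg_cong[OF assms(1), of "\<lambda>m. m div B"] arg_cong[OF assms(1), of "\<lambda>m. m mod B"] assms(2,3)
  by simp_all

lemma word_code_inj:
  "\<lbrakk>length u = length v; fst ` set u \<subseteq> {..<n}; fst ` set v \<subseteq> {..<n}; word_code n u = word_code n v\<rbrakk> \<Longrightarrow> u = v"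
proof (induction u v rule: list_induct2)
  case (Cons a u b v)
  let ?c = "\<lambda>a::letter. 2 * fst a + of_bool (snd a) :: nat"
  have less: "word_code n u < (2 * n) ^ length u" "word_code n v < (2 * n) ^ length u"
    using word_code_less[of u n] word_code_less[of v n] Cons by auto
  have "?c a * (2 * n) ^ length u + word_code n u = ?c b * (2 * n) ^ length u + word_code n v"
    using Cons by simp
  note * = digit_eq[OF this less]
  have "a = b"
    using *(1) by (cases a; cases b) (auto simp: of_bool_def split: if_splits; presburger)
  then show ?case using Cons *(2) by simp
qed simp

definition half :: "'a list \<Rightarrow> 'a list"
  where "half w = take (length w div 2) w"

definition total_length :: "nat \<Rightarrow> (letter list \<Rightarrow> letter list) \<Rightarrow> nat"
  where "total_length n f = (\<Sum>a\<in>letters n. length (f [a]))"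

text \<open>The sum runs over inverse letters too, and so takes account of the initial half of each
  image and of the initial half of its inverse.\<close>

definition total_code :: "nat \<Rightarrow> (letter list \<Rightarrow> letter list) \<Rightarrow> nat"
  where "total_code n f = (\<Sum>a\<in>letters n. word_code n (half (f [a])))"

definition nielsen_less :: "nat \<Rightarrow> ((letter list \<Rightarrow> letter list) \<times> (letter list \<Rightarrow> letter list)) set"
  where "nielsen_less n = measures [total_length n, total_code n]"

lemma wf_nielsen_less: "wf (nielsen_less n)"
  by (simp add: nielsen_less_def)

lemma in_nielsen_less:
  "(g, f) \<in> nielsen_less n \<longleftrightarrow>
    total_length n g < total_length n f \<or> total_length n g = total_length n f \<and> total_code n g < total_code n f"
  by (auto simp: nielsen_less_def)

lemma sum_letters_update:
  fixes F G :: "letter \<Rightarrow> nat"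
  assumes "fst a < n" and "\<And>c. fst c < n \<Longrightarrow> c \<noteq> a \<Longrightarrow> c \<noteq> inv_letter a \<Longrightarrow> F c = G c"
  shows "(\<Sum>c\<in>letters n. F c) + (G a + G (inv_letter a)) = (\<Sum>c\<in>letters n. G c) + (F a + F (inv_letter a))"
proof -
  have split: "(\<Sum>c\<in>letters n. H c) = H a + H (inv_letter a) + (\<Sum>c\<in>letters n - {a, inv_letter a}. H c)" for H :: "letter \<Rightarrow> nat"
  proof -
    have "{a, inv_letter a} \<subseteq> letters n" using assms(1) by (simp add: letters_def)
    then have "sum H (letters n) = sum H (letters n - {a, inv_letter a}) + sum H {a, inv_letter a}"
      using finite_letters by (intro sum.subset_diff) auto
    then show ?thesis by simp
  qed
  have "(\<Sum>c\<in>letters n - {a, inv_letter a}. F c) = (\<Sum>c\<in>letters n - {a, inv_letter a}. G c)"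
    using assms(2) by (intro sum.cong) (auto simp: letters_def)
  then show ?thesis using split[of F] split[of G] by simp
qed

text \<open>Precomposition with a transvection is an elementary Nielsen move on the tuple of images
  of the generators.\<close>

lemma auto_transvection_letter:
  assumes f: "f \<in> auto (free_group n)" and ab: "fst a < n" "fst b < n" "fst a \<noteq> fst b" and c: "fst c < n"
  defines "g \<equiv> compose (carrier (free_group n)) f (transvection n a b)"
  shows "g [a] = foldr rcons (word_inv (f [b])) (f [a])"
    and "g [inv_letter a] = word_inv (g [a])"
    and "c \<noteq> a \<Longrightarrow> c \<noteq> inv_letter a \<Longrightarrow> g [c] = f [c]"
proof -
  have "[inv_letter b, a] \<in> carrier (free_group n)"
    using ab by (auto simp: carrier_free_group reduced_Cons)
  note C = Cons_carrier(3)[OF this]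
  have g: "g [c] = f (transvection_letter a b c)" if "fst c < n" for c
    using that transvection_apply_letter[OF ab that] by (simp add: g_def compose_def)
  show "g [a] = foldr rcons (word_inv (f [b])) (f [a])"
    using g[OF ab(1)] hom_mult[OF auto_hom[OF f], of "[inv_letter b]" "[a]"] C ab auto_inv_letter[OF f ab(2)]
    by (simp add: transvection_letter_def mult_free_group)
  show "c \<noteq> a \<Longrightarrow> c \<noteq> inv_letter a \<Longrightarrow> g [c] = f [c]"
    using g[OF c] by (simp add: transvection_letter_def)
  have "transvection_letter a b (inv_letter a) = word_inv (transvection_letter a b a)"
    by (simp add: transvection_letter_def word_inv_def)
  moreover have "transvection_letter a b a \<in> carrier (free_group n)"
    using letter_mapD(1)[OF letter_map_transvection[OF ab] ab(1)] .
  ultimately show "g [inv_letter a] = word_inv (g [a])"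
    using g[of a] g[of "inv_letter a"] ab(1) auto_word_inv[OF f] by simp
qed

section \<open>Automorphisms that no transvection makes smaller\<close>

definition nielsen_minimal :: "nat \<Rightarrow> (letter list \<Rightarrow> letter list) \<Rightarrow> bool"
  where "nielsen_minimal n f \<longleftrightarrow>
    (\<forall>a b. fst a < n \<longrightarrow> fst b < n \<longrightarrow> fst a \<noteq> fst b \<longrightarrow>
      (compose (carrier (free_group n)) f (transvection n a b), f) \<notin> nielsen_less n)"

context
  fixes n :: nat and f :: "letter list \<Rightarrow> letter list"
  assumes f: "f \<in> auto (free_group n)" and minimal: "nielsen_minimal n f"
begin

lemma image_letter_carrier: "fst a < n \<Longrightarrow> f [a] \<in> carrier (free_group n)"
  by (simp add: auto_closed[OF f])

lemma image_letter_reduced: "fst a < n \<Longrightarrow> reduced (f [a])"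
  using image_letter_carrier unfolding carrier_free_group by blast

text \<open>If more than half of \<open>f [b]\<close> were a prefix of \<open>f [a]\<close>,
  multiplying by the inverse of \<open>f [b]\<close> would shorten \<open>f [a]\<close>.\<close>

lemma minimal_lcp_le:
  assumes ab: "fst a < n" "fst b < n" "fst a \<noteq> fst b"
  shows "2 * lcp (f [a]) (f [b]) \<le> length (f [b])"
proof (rule ccontr)
  assume neg: "\<not> ?thesis"
  let ?g = "compose (carrier (free_group n)) f (transvection n a b)"
  note g = auto_transvection_letter[OF f ab]
  have len: "length (?g [a]) = length (f [b]) + length (f [a]) - 2 * lcp (f [b]) (f [a])"
    using length_mult[of "word_inv (f [b])" "f [a]"] image_letter_reduced[OF ab(1)]
      reduced_word_inv[OF image_letter_reduced[OF ab(2)]] g(1)[OF ab(1)] by simp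
  have "length (?g [a]) < length (f [a])"
    using len neg lcp_le[of "f [b]" "f [a]"] lcp_sym[of "f [b]" "f [a]"] by simp
  moreover have "total_length n ?g + (length (f [a]) + length (f [inv_letter a])) =
      total_length n f + (length (?g [a]) + length (?g [inv_letter a]))"
    unfolding total_length_def using g(3) by (intro sum_letters_update[OF ab(1)]) auto
  moreover have "length (f [inv_letter a]) = length (f [a])" "length (?g [inv_letter a]) = length (?g [a])"
    using auto_inv_letter[OF f ab(1)] g(2)[OF ab(1)] by simp_all
  ultimately have "total_length n ?g < total_length n f" by simp
  then show False using minimal ab unfolding nielsen_minimal_def in_nielsen_less by blast
qed

text \<open>Here \<open>f [b] = p q^-1\<close> and \<open>f [a] = p s\<close> with \<open>p\<close>
  and \<open>q\<close> of equal length, so the Nielsen move replaces \<open>p s\<close> by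
  \<open>q s\<close> and keeps all lengths. Minimality then forbids the code of \<open>q\<close>
  from being smaller than that of \<open>p\<close>.\<close>

lemma minimal_half_code:
  assumes ab: "fst a < n" "fst b < n" "fst a \<noteq> fst b"
    and eq: "2 * lcp (f [a]) (f [b]) = length (f [b])"
  shows "word_code n (half (f [b])) \<le> word_code n (half (f [inv_letter b]))"
proof (rule ccontr)
  assume neg: "\<not> ?thesis"
  let ?g = "compose (carrier (free_group n)) f (transvection n a b)"
  note g = auto_transvection_letter[OF f ab]
  define k where "k = lcp (f [b]) (f [a])"
  define p s q where "p = take k (f [b])" and "s = drop k (f [a])" and "q = take k (word_inv (f [b]))"
  have lenb: "length (f [b]) = 2 * k" using eq lcp_sym[of "f [b]" "f [a]"] by (simp add: k_def)
  \<comment> \<open>The length bound with \<open>a\<close> and \<open>b\<close> exchanged: the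
    replaced prefix lies within the first half of \<open>f [a]\<close>, so the initial half of the
    inverse of \<open>f [a]\<close> is unaffected.\<close>
  have "2 * k \<le> length (f [a])"
    using minimal_lcp_le[OF ab(2,1)] ab(3) by (simp add: k_def)
  then have lens: "k \<le> length s" "length p = k" "length q = k" using lenb by (auto simp: s_def p_def q_def)
  have fa: "f [a] = p @ s" using take_lcp[of "f [b]" "f [a]"] unfolding p_def s_def k_def by (metis append_take_drop_id)
  have ga: "?g [a] = q @ s"
    using mult_eq_take_drop[of "word_inv (f [b])" "f [a]"] image_letter_reduced[OF ab(1)]
      reduced_word_inv[OF image_letter_reduced[OF ab(2)]] g(1)[OF ab(1)] lenb
    by (simp add: k_def q_def s_def mult_2)
  have halves: "half (f [b]) = p" "half (f [inv_letter b]) = q"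
    using lenb auto_inv_letter[OF f ab(2)] by (simp_all add: half_def p_def q_def)
  define t where "t = take ((k + length s) div 2 - k) s"
  have h: "k \<le> (k + length s) div 2" "(k + length s) div 2 \<le> length s" using lens by auto
  have "half (f [a]) = p @ t" "half (?g [a]) = q @ t"
    using h lens by (simp_all add: fa ga half_def t_def)
  moreover have "half (f [inv_letter a]) = half (?g [inv_letter a])"
    using h lens g(2)[OF ab(1)] auto_inv_letter[OF f ab(1)] by (simp add: fa ga half_def add.commute)
  moreover have "total_code n ?g + (word_code n (half (f [a])) + word_code n (half (f [inv_letter a]))) =
      total_code n f + (word_code n (half (?g [a])) + word_code n (half (?g [inv_letter a])))"
    unfolding total_code_def using g(3)
    by (intro sum_letters_update[OF ab(1), where F = "\<lambda>c. word_code n (half (?g [c]))"]) auto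
  moreover have "word_code n (q @ t) < word_code n (p @ t)"
  proof -
    have "word_code n q * (2 * n) ^ length t < word_code n p * (2 * n) ^ length t"
      using neg ab(1) unfolding halves by (intro mult_strict_right_mono) auto
    then show ?thesis unfolding word_code_append by simp
  qed
  ultimately have "total_code n ?g < total_code n f" by simp
  moreover have "total_length n ?g + (length (f [a]) + length (f [inv_letter a])) =
      total_length n f + (length (?g [a]) + length (?g [inv_letter a]))"
    unfolding total_length_def using g(3) by (intro sum_letters_update[OF ab(1)]) auto
  moreover have "length (?g [a]) = length (f [a])" "length (?g [inv_letter a]) = length (f [inv_letter a])"
    using auto_inv_letter[OF f ab(1)] g(2)[OF ab(1)] lens by (simp_all add: fa ga)
  ultimately have "(?g, f) \<in> nielsen_less n" unfolding in_nielsen_less by simp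
  then show False using minimal ab unfolding nielsen_minimal_def by blast
qed

text \<open>The case beyond different generators is \<open>a = b^-1\<close>, where less than half of
  a nontrivial reduced word agrees with its inverse; the inequality is strict there.\<close>

lemma minimal_lcp_half:
  assumes ab: "fst a < n" "fst b < n" "a \<noteq> b"
  shows "2 * lcp (f [a]) (f [b]) \<le> length (f [b])"
    and "2 * lcp (f [a]) (f [b]) = length (f [b]) \<Longrightarrow> fst a \<noteq> fst b"
proof -
  have "2 * lcp (f [a]) (f [b]) < length (f [b])" if "fst a = fst b"
  proof -
    have "a = inv_letter b" using fst_eq_imp[OF that] ab(3) by blast
    then show ?thesis
      using lcp_word_inv_self[OF image_letter_reduced[OF ab(2)] auto_letter_neq_Nil[OF f ab(2)]]
        auto_inv_letter[OF f ab(2)] by (simp add: lcp_sym)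
  qed
  then show "2 * lcp (f [a]) (f [b]) \<le> length (f [b])"
    and "2 * lcp (f [a]) (f [b]) = length (f [b]) \<Longrightarrow> fst a \<noteq> fst b"
    using minimal_lcp_le[OF ab(1,2)] by fastforce+
qed

text \<open>In a reduced product the two neighbours of a factor never cancel all of it: if both cancelled
  exactly half of it, then the tie-breaking order would force it to have the form \<open>h h\<inverse>\<close>.\<close>

lemma minimal_lcp_add:
  assumes b: "fst b < n" and a: "fst a < n" "a \<noteq> b" and c: "fst c < n" "c \<noteq> inv_letter b"
  shows "lcp (f [a]) (f [b]) + lcp (f [c]) (word_inv (f [b])) < length (f [b])"
proof (rule ccontr)
  assume neg: "\<not> ?thesis"
  have b': "fst (inv_letter b) < n" and fb': "f [inv_letter b] = word_inv (f [b])"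
    using b auto_inv_letter[OF f b] by simp_all
  note half_a = minimal_lcp_half[OF a(1) b a(2)] and half_c = minimal_lcp_half[OF c(1) b' c(2)]
  have eq: "2 * lcp (f [a]) (f [b]) = length (f [b])" "2 * lcp (f [c]) (f [inv_letter b]) = length (f [inv_letter b])"
    using neg half_a(1) half_c(1) unfolding fb' by simp_all
  have "word_code n (half (f [b])) \<le> word_code n (half (f [inv_letter b]))"
    "word_code n (half (f [inv_letter b])) \<le> word_code n (half (f [inv_letter (inv_letter b)]))"
    using minimal_half_code[OF a(1) b half_a(2)[OF eq(1)] eq(1)]
      minimal_half_code[OF c(1) b' half_c(2)[OF eq(2)] eq(2)] by simp_all
  then have code: "word_code n (half (f [b])) = word_code n (half (word_inv (f [b])))"
    unfolding fb' by simp
  have valid: "fst ` set (f [b]) \<subseteq> {..<n}"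
    using image_letter_carrier[OF b] unfolding carrier_free_group by blast
  moreover have "set (half w) \<subseteq> set w" for w :: "letter list" unfolding half_def by (rule set_take_subset)
  ultimately have "fst ` set (half (f [b])) \<subseteq> {..<n}" "fst ` set (half (word_inv (f [b]))) \<subseteq> {..<n}"
    using fst_set_word_inv[of "f [b]"] by blast+
  then have "half (f [b]) = half (word_inv (f [b]))"
    by (intro word_code_inj[OF _ _ _ code]) (simp add: half_def)
  then have "length (f [b]) div 2 \<le> lcp (f [b]) (word_inv (f [b]))"
    by (intro lcp_ge) (auto simp: half_def)
  then show False
    using lcp_word_inv_self[OF image_letter_reduced[OF b] auto_letter_neq_Nil[OF f b]] eq(1) by presburger
qed

text \<open>An induction invariant: of the last factor a tail survives that has lost only a prefix
  shared with the image of another letter \<open>a\<close>. By \<open>minimal_lcp_add\<close> the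
  next cancellation cannot use up that tail, so each earlier letter leaves at least one letter
  behind.\<close>

lemma minimal_image_shape:
  "y @ [z] \<in> carrier (free_group n) \<Longrightarrow> \<exists>s j. f (y @ [z]) = s @ drop j (f [z]) \<and> length y \<le> length s \<and>
    (\<exists>a. fst a < n \<and> a \<noteq> z \<and> j \<le> lcp (f [a]) (f [z]))"
proof (induction y arbitrary: z rule: rev_induct)
  case Nil
  then have "fst z < n" by simp
  then have "fst (inv_letter z) < n \<and> inv_letter z \<noteq> z \<and> 0 \<le> lcp (f [inv_letter z]) (f [z])" by simp
  then have "\<exists>a. fst a < n \<and> a \<noteq> z \<and> 0 \<le> lcp (f [a]) (f [z])" by blast
  then show ?case by (intro exI[of _ "[]"] exI[of _ 0] conjI) simp_all
next
  case (snoc x y)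
  note S = snoc_carrier[OF snoc.prems]
  have x: "fst x < n" using snoc_carrier(1)[OF S(2)] .
  have zx: "z \<noteq> inv_letter x" using S(4) by simp
  obtain s j a where s: "f (y @ [x]) = s @ drop j (f [x])" "length y \<le> length s"
    and a: "fst a < n" "a \<noteq> x" "j \<le> lcp (f [a]) (f [x])" using snoc.IH[OF S(2)] by blast
  define k where "k = lcp (word_inv (f [x])) (f [z])"
  define m where "m = length (f [x]) - j"
  have k: "j + k < length (f [x])"
    using minimal_lcp_add[OF x a(1,2) S(1) zx] a(3) by (simp add: k_def lcp_sym)
  have "word_inv (f [x]) = word_inv (drop j (f [x])) @ word_inv (take j (f [x]))"
    by (metis append_take_drop_id word_inv_append)
  then have "word_inv (drop j (f [x])) = take m (word_inv (f [x]))" by (simp add: m_def)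
  \<comment> \<open>Cancellation stops inside the tail, as \<open>k < m\<close>, so comparing with
    the inverse of the whole image gives the same \<open>k\<close> as comparing with the inverse of
    \<open>f [x]\<close>.\<close>
  then have "lcp (word_inv (f (y @ [x]))) (f [z]) = k"
    unfolding s(1) using lcp_take_append[of "word_inv (f [x])" "f [z]" m "word_inv s"] k by (simp add: k_def m_def)
  moreover have "f ((y @ [x]) @ [z]) = foldr rcons (f (y @ [x])) (f [z])"
    using hom_mult[OF auto_hom[OF f] S(2), of "[z]"] S(1,3) by (simp add: mult_free_group)
  moreover have "reduced (f (y @ [x]))" using auto_closed[OF f S(2)] by (simp add: carrier_free_group)
  ultimately have fz: "f ((y @ [x]) @ [z]) = take (length (f (y @ [x])) - k) (f (y @ [x])) @ drop k (f [z])"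
    using mult_eq_take_drop image_letter_reduced[OF S(1)] by simp
  have "length (y @ [x]) \<le> length (take (length (f (y @ [x])) - k) (f (y @ [x])))"
    using k s by simp
  moreover have "fst (inv_letter x) < n \<and> inv_letter x \<noteq> z \<and> k \<le> lcp (f [inv_letter x]) (f [z])"
    using x zx auto_inv_letter[OF f x] by (auto simp: k_def)
  ultimately show ?case using fz by blast
qed

lemma minimal_length_le:
  assumes "y \<in> carrier (free_group n)"
  shows "length y \<le> length (f y)"
proof (cases y rule: rev_cases)
  case (snoc y' z)
  then have z: "fst z < n" using snoc_carrier(1) assms by blast
  obtain s j a where s: "f y = s @ drop j (f [z])" "length y' \<le> length s"
    and a: "fst a < n" "a \<noteq> z" "j \<le> lcp (f [a]) (f [z])"
    using minimal_image_shape assms unfolding snoc by blast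
  have "2 * j \<le> length (f [z])" using minimal_lcp_half(1)[OF a(1) z a(2)] a(3) by simp
  moreover have "f [z] \<noteq> []" using auto_letter_neq_Nil[OF f z] .
  ultimately have "j < length (f [z])" by (cases "f [z]") auto
  then show ?thesis using s snoc by simp
qed simp

text \<open>Since \<open>f\<close> does not shorten words, the preimage of a letter has length at
  most one.\<close>

lemma minimal_permutes_letters:
  assumes "fst x < n"
  shows "\<exists>c. fst c < n \<and> f [c] = [x]"
proof -
  obtain y where y: "y \<in> carrier (free_group n)" "f y = [x]"
    using auto_surj[OF f, of "[x]"] assms by auto
  have "length y \<le> 1" using minimal_length_le[OF y(1)] y(2) by simp
  moreover have "y \<noteq> []"
    using hom_one[OF auto_hom[OF f] group_free_group group_free_group] y(2) by (auto simp: one_free_group)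
  ultimately obtain c where "y = [c]" by (cases y) auto
  then have "fst c < n" "f [c] = [x]" using y by simp_all
  then show ?thesis by blast
qed

end

definition letter_permutation :: "nat \<Rightarrow> (letter list \<Rightarrow> letter list) \<Rightarrow> bool"
  where "letter_permutation n f \<longleftrightarrow> (\<forall>a. fst a < n \<longrightarrow> (\<exists>c. fst c < n \<and> f [a] = [c]))"

text \<open>Choosing preimage letters is an injective self-map of the finite set of letters, hence
  surjective, so every letter is mapped to a letter.\<close>

lemma minimal_letter_permutation:
  assumes "f \<in> auto (free_group n)" "nielsen_minimal n f"
  shows "letter_permutation n f"
proof -
  have "\<forall>x\<in>letters n. \<exists>c. c \<in> letters n \<and> f [c] = [x]"
    using minimal_permutes_letters[OF assms] unfolding letters_def by blast
  then obtain g where g: "\<And>x. x \<in> letters n \<Longrightarrow> g x \<in> letters n \<and> f [g x] = [x]" by metis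
  have "inj_on g (letters n)"
  proof (rule inj_onI)
    fix x y assume "x \<in> letters n" "y \<in> letters n" "g x = g y"
    then have "[x] = [y]" using g by metis
    then show "x = y" by simp
  qed
  moreover have "g ` letters n \<subseteq> letters n" using g by blast
  ultimately have surj: "g ` letters n = letters n" using endo_inj_surj[OF finite_letters] by blast
  show ?thesis
    unfolding letter_permutation_def
  proof (intro allI impI)
    fix a :: letter assume "fst a < n"
    then have "a \<in> g ` letters n" unfolding surj by (simp add: letters_def)
    then obtain x where "x \<in> letters n" "a = g x" by blast
    then have "fst x < n \<and> f [a] = [x]" using g by (simp add: letters_def)
    then show "\<exists>c. fst c < n \<and> f [a] = [c]" by blast
  qed
qed

section \<open>Abelianisation and outer automorphisms\<close>

lemma exponent_sum_Nil [simp]: "exponent_sum i [] = 0"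
  by (simp add: exponent_sum_def)

lemma exponent_sum_append: "exponent_sum i (u @ v) = exponent_sum i u + exponent_sum i v"
  by (simp add: exponent_sum_def)

lemma exponent_sum_Cons: "exponent_sum i (a # w) = exponent_sum i [a] + exponent_sum i w"
  by (simp add: exponent_sum_def)

lemma exponent_sum_letter: "exponent_sum i [a] = (if fst a = i then if snd a then 1 else -1 else 0)"
  by (cases a) (auto simp: exponent_sum_def)

lemma exponent_sum_inv_letter: "exponent_sum i [inv_letter a] = - exponent_sum i [a]"
  by (simp add: exponent_sum_letter inv_letter_def)

lemma exponent_sum_word_inv: "exponent_sum i (word_inv w) = - exponent_sum i w"
proof (induction w)
  case (Cons a w)
  have "word_inv (a # w) = word_inv w @ [inv_letter a]" by (simp add: word_inv_def)
  then show ?case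
    using Cons by (simp add: exponent_sum_append exponent_sum_inv_letter exponent_sum_Cons[of i a w])
qed simp

lemma exponent_sum_rcons: "exponent_sum i (rcons a w) = exponent_sum i [a] + exponent_sum i w"
proof (cases "w \<noteq> [] \<and> hd w = inv_letter a")
  case True
  then obtain v where "w = inv_letter a # v" by (cases w) auto
  then show ?thesis
    by (simp add: rcons_def exponent_sum_Cons[of i "inv_letter a"] exponent_sum_inv_letter)
next
  case False
  then have "rcons a w = a # w" unfolding rcons_def by (rule if_not_P)
  then show ?thesis by (simp add: exponent_sum_Cons[of i a w])
qed

lemma exponent_sum_mult: "exponent_sum i (foldr rcons u v) = exponent_sum i u + exponent_sum i v"
proof (induction u)
  case (Cons a u)
  then show ?case by (simp add: exponent_sum_rcons exponent_sum_Cons[of i a u])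
qed simp

lemma exponent_sum_hom:
  assumes f: "f \<in> hom (free_group n) (free_group n)" and w: "w \<in> carrier (free_group n)"
  shows "exponent_sum i (f w) = (\<Sum>j<n. exponent_sum i (f [(j, True)]) * exponent_sum j w)"
  using w
proof (induction w)
  case Nil
  show ?case using hom_one[OF f group_free_group group_free_group] by (simp add: one_free_group)
next
  case (Cons a w)
  note C = Cons_carrier[OF Cons.prems]
  interpret group_hom "free_group n" "free_group n" f
    using f group_free_group by (simp add: group_hom_def group_hom_axioms_def)
  have "f (a # w) = foldr rcons (f [a]) (f w)"
    using hom_mult[of "[a]" w] C by (simp add: mult_free_group)
  then have 1: "exponent_sum i (f (a # w)) = exponent_sum i (f [a]) + exponent_sum i (f w)"
    by (simp add: exponent_sum_mult)
  obtain k s where a: "a = (k, s)" by force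
  have x: "[(k, True)] \<in> carrier (free_group n)" using C(1) a by simp
  have "exponent_sum i (f [a]) = exponent_sum i (f [(k, True)]) * exponent_sum k [a]"
  proof (cases s)
    case False
    have "f [a] = word_inv (f [(k, True)])"
      using hom_inv[OF x] x False a hom_closed[OF x] inv_free_group[OF x] inv_free_group[OF hom_closed[OF x]]
      by (simp add: inv_letter_def)
    then show ?thesis using a False by (simp add: exponent_sum_word_inv exponent_sum_letter)
  qed (use a in \<open>simp add: exponent_sum_letter\<close>)
  also have "\<dots> = (\<Sum>j<n. exponent_sum i (f [(j, True)]) * exponent_sum j [a])"
  proof -
    have "(\<Sum>j<n. exponent_sum i (f [(j, True)]) * exponent_sum j [a]) =
        (\<Sum>j\<in>{k}. exponent_sum i (f [(j, True)]) * exponent_sum j [a])"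
      using C(1) a by (intro sum.mono_neutral_right) (auto simp: exponent_sum_letter)
    then show ?thesis by simp
  qed
  finally show ?case
    unfolding 1 Cons.IH[OF C(2)] exponent_sum_Cons[of _ a w] by (simp add: sum.distrib distrib_left)
qed

lemma abelianised_matrix_mult:
  assumes f: "f \<in> auto (free_group n)" and g: "g \<in> auto (free_group n)"
  shows "abelianised_matrix n (compose (carrier (free_group n)) f g) = abelianised_matrix n f * abelianised_matrix n g"
proof (rule eq_matI)
  fix i j assume ij: "i < dim_row (abelianised_matrix n f * abelianised_matrix n g)"
    "j < dim_col (abelianised_matrix n f * abelianised_matrix n g)"
  then have ij: "i < n" "j < n" by (simp_all add: abelianised_matrix_def)
  then have "g [(j, True)] \<in> carrier (free_group n)" by (simp add: auto_closed[OF g])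
  from exponent_sum_hom[OF auto_hom[OF f] this]
  show "abelianised_matrix n (compose (carrier (free_group n)) f g) $$ (i, j) =
      (abelianised_matrix n f * abelianised_matrix n g) $$ (i, j)"
    using ij by (simp add: abelianised_matrix_def compose_def scalar_prod_def lessThan_atLeast0)
qed (simp_all add: abelianised_matrix_def)

lemma aut_sign_mult:
  assumes "f \<in> auto (free_group n)" "g \<in> auto (free_group n)"
  shows "aut_sign n (f \<otimes>\<^bsub>AutoGroup (free_group n)\<^esub> g) = aut_sign n f * aut_sign n g"
  unfolding aut_sign_def AutoGroup_mult[OF assms] abelianised_matrix_mult[OF assms]
  by (rule det_mult) (auto simp: abelianised_matrix_def)

lemma aut_sign_eq_1:
  assumes "\<And>i j. i < n \<Longrightarrow> j < n \<Longrightarrow> exponent_sum i (f [(j, True)]) = exponent_sum i [(j, True)]"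
  shows "aut_sign n f = 1"
proof -
  have "abelianised_matrix n f = 1\<^sub>m n"
    by (rule eq_matI) (auto simp: abelianised_matrix_def assms exponent_sum_letter)
  then show ?thesis by (simp add: aut_sign_def)
qed

lemma group_AutoGroup_free: "group (AutoGroup (free_group n))"
  by (rule group.AutoGroup[OF group_free_group])

text \<open>By multiplicativity the determinants of \<open>f\<close> and of its inverse are integers
  with product one.\<close>

lemma aut_sign_group_hom: "group_hom (AutoGroup (free_group n)) sign_img (aut_sign n)"
proof -
  interpret A: group "AutoGroup (free_group n)" by (rule group_AutoGroup_free)
  have one: "aut_sign n \<one>\<^bsub>AutoGroup (free_group n)\<^esub> = 1"
    by (rule aut_sign_eq_1) simp
  have "aut_sign n f \<in> {-1, 1}" if f: "f \<in> carrier (AutoGroup (free_group n))" for f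
  proof -
    have "aut_sign n f * aut_sign n (inv\<^bsub>AutoGroup (free_group n)\<^esub> f) = 1"
      using aut_sign_mult[of f n "inv\<^bsub>AutoGroup (free_group n)\<^esub> f"] f A.inv_closed[OF f] A.r_inv[OF f] one
      by simp
    then show ?thesis by (metis insertCI zmult_eq_1_iff)
  qed
  then have "aut_sign n \<in> hom (AutoGroup (free_group n)) sign_img"
    using aut_sign_mult by (auto simp: hom_def sign_img_def)
  then show ?thesis
    using sign_img_is_group A.group_axioms by (simp add: group_hom_def group_hom_axioms_def)
qed

lemma carrier_Aut_plus: "f \<in> carrier (Aut_plus n) \<longleftrightarrow> f \<in> auto (free_group n) \<and> aut_sign n f = 1"
  by (auto simp: Aut_plus_def kernel_def sign_img_def)

lemma subgroup_Aut_plus: "subgroup (carrier (Aut_plus n)) (AutoGroup (free_group n))"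
  using group_hom.subgroup_kernel[OF aut_sign_group_hom] by (simp add: Aut_plus_def)

lemma group_Aut_plus: "group (Aut_plus n)"
  using subgroup.subgroup_is_group[OF subgroup_Aut_plus group_AutoGroup_free] by (simp add: Aut_plus_def)

lemma Aut_plus_mult:
  "f \<in> carrier (Aut_plus n) \<Longrightarrow> g \<in> carrier (Aut_plus n) \<Longrightarrow>
    f \<otimes>\<^bsub>Aut_plus n\<^esub> g = compose (carrier (free_group n)) f g"
  using AutoGroup_mult[of f "free_group n" g] by (simp add: carrier_Aut_plus) (simp add: Aut_plus_def)

lemma Aut_plus_mult_apply:
  "f \<in> carrier (Aut_plus n) \<Longrightarrow> g \<in> carrier (Aut_plus n) \<Longrightarrow> w \<in> carrier (free_group n) \<Longrightarrow>
    (f \<otimes>\<^bsub>Aut_plus n\<^esub> g) w = f (g w)"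
  by (simp add: Aut_plus_mult compose_def)

lemma Aut_plus_one: "\<one>\<^bsub>Aut_plus n\<^esub> = (\<lambda>w\<in>carrier (free_group n). w)"
  using AutoGroup_simps(2)[of "free_group n"] by (simp add: Aut_plus_def)

lemma Aut_plus_eqI:
  assumes "f \<in> carrier (Aut_plus n)" "g \<in> carrier (Aut_plus n)" "\<And>a. fst a < n \<Longrightarrow> f [a] = g [a]"
  shows "f = g"
  using assms by (intro auto_free_group_eqI) (auto simp: carrier_Aut_plus)

section \<open>Inner automorphisms and outer classes\<close>

definition conjugation :: "nat \<Rightarrow> letter list \<Rightarrow> letter list \<Rightarrow> letter list"
  where "conjugation n g = (\<lambda>x\<in>carrier (free_group n). g \<otimes>\<^bsub>free_group n\<^esub> x \<otimes>\<^bsub>free_group n\<^esub> inv\<^bsub>free_group n\<^esub> g)"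

lemma Inn_free_group: "Inn (free_group n) = conjugation n ` carrier (free_group n)"
  by (auto simp: Inn_def conjugation_def)

lemma exponent_sum_conjugation:
  assumes "g \<in> carrier (free_group n)" "x \<in> carrier (free_group n)"
  shows "exponent_sum i (conjugation n g x) = exponent_sum i x"
  using assms by (simp add: conjugation_def inv_free_group)
    (simp add: mult_free_group exponent_sum_mult exponent_sum_word_inv)

lemma conjugation_Aut_plus:
  assumes g: "g \<in> carrier (free_group n)"
  shows "conjugation n g \<in> carrier (Aut_plus n)"
proof -
  interpret F: group "free_group n" by (rule group_free_group)
  have hom: "conjugation n h \<in> hom (free_group n) (free_group n)" if "h \<in> carrier (free_group n)" for h
    using that by (intro homI) (auto simp: conjugation_def F.m_assoc F.inv_solve_left)
  have cancel: "conjugation n (inv\<^bsub>free_group n\<^esub> h) (conjugation n h x) = x"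
    if "h \<in> carrier (free_group n)" "x \<in> carrier (free_group n)" for h x
    using that by (simp add: conjugation_def F.m_assoc) (simp flip: F.m_assoc)
  have "conjugation n g \<in> auto (free_group n)"
  proof (rule autoI_inverse[OF group_free_group hom[OF g]])
    show "conjugation n g \<in> extensional (carrier (free_group n))" by (simp add: conjugation_def)
    show "conjugation n (inv\<^bsub>free_group n\<^esub> g) \<in> hom (free_group n) (free_group n)"
      using hom g by simp
  qed (use cancel[OF g] cancel[of "inv\<^bsub>free_group n\<^esub> g"] g in simp_all)
  moreover have "aut_sign n (conjugation n g) = 1"
    by (rule aut_sign_eq_1) (simp add: exponent_sum_conjugation[OF g])
  ultimately show ?thesis by (simp add: carrier_Aut_plus)
qed

lemma normal_Inn: "Inn (free_group n) \<lhd> Aut_plus n"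
proof -
  interpret F: group "free_group n" by (rule group_free_group)
  interpret A: group "Aut_plus n" by (rule group_Aut_plus)
  let ?c = "conjugation n"
  have c: "?c g \<in> carrier (Aut_plus n)" if "g \<in> carrier (free_group n)" for g
    using conjugation_Aut_plus[OF that] .
  have c_mult: "?c g \<otimes>\<^bsub>Aut_plus n\<^esub> ?c h = ?c (g \<otimes>\<^bsub>free_group n\<^esub> h)"
    if "g \<in> carrier (free_group n)" "h \<in> carrier (free_group n)" for g h
  proof (rule Aut_plus_eqI)
    fix a :: letter assume "fst a < n"
    then show "(?c g \<otimes>\<^bsub>Aut_plus n\<^esub> ?c h) [a] = ?c (g \<otimes>\<^bsub>free_group n\<^esub> h) [a]"
      using that by (simp add: c Aut_plus_mult_apply) (simp add: conjugation_def F.m_assoc F.inv_mult_group)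
  qed (use that c in simp_all)
  have c_one: "?c \<one>\<^bsub>free_group n\<^esub> = \<one>\<^bsub>Aut_plus n\<^esub>"
    by (intro Aut_plus_eqI[where n = n] c A.one_closed) (auto simp: Aut_plus_one conjugation_def)
  have c_inv: "inv\<^bsub>Aut_plus n\<^esub> (?c g) = ?c (inv\<^bsub>free_group n\<^esub> g)" if "g \<in> carrier (free_group n)" for g
    using that by (intro A.inv_equality) (auto simp: c c_mult c_one)
  have "subgroup (Inn (free_group n)) (Aut_plus n)"
  proof (rule A.subgroupI)
    show "Inn (free_group n) \<subseteq> carrier (Aut_plus n)" using c by (auto simp: Inn_free_group)
    show "Inn (free_group n) \<noteq> {}" using F.one_closed by (auto simp: Inn_free_group)
    show "inv\<^bsub>Aut_plus n\<^esub> x \<in> Inn (free_group n)" if "x \<in> Inn (free_group n)" for x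
      using that c_inv by (auto simp: Inn_free_group)
    show "x \<otimes>\<^bsub>Aut_plus n\<^esub> y \<in> Inn (free_group n)" if "x \<in> Inn (free_group n)" "y \<in> Inn (free_group n)" for x y
      using that c_mult by (auto simp: Inn_free_group)
  qed
  moreover have "x \<otimes>\<^bsub>Aut_plus n\<^esub> h \<otimes>\<^bsub>Aut_plus n\<^esub> inv\<^bsub>Aut_plus n\<^esub> x \<in> Inn (free_group n)"
    if x: "x \<in> carrier (Aut_plus n)" and h: "h \<in> Inn (free_group n)" for x h
  proof -
    obtain g where g: "g \<in> carrier (free_group n)" "h = ?c g" using h by (auto simp: Inn_free_group)
    have xa: "x \<in> auto (free_group n)" using x by (simp add: carrier_Aut_plus)
    interpret x: group_hom "free_group n" "free_group n" x
      using auto_hom[OF xa] by (simp add: group_hom_def group_hom_axioms_def F.group_axioms)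
    \<comment> \<open>Conjugation by \<open>g\<close> is carried by \<open>x\<close> to conjugation
      by \<open>x g\<close>; written without inverses, the identity can be checked on
      letters.\<close>
    have "x \<otimes>\<^bsub>Aut_plus n\<^esub> ?c g = ?c (x g) \<otimes>\<^bsub>Aut_plus n\<^esub> x"
      using g(1) x c by (intro Aut_plus_eqI) (auto simp: Aut_plus_mult_apply conjugation_def)
    then have "x \<otimes>\<^bsub>Aut_plus n\<^esub> h \<otimes>\<^bsub>Aut_plus n\<^esub> inv\<^bsub>Aut_plus n\<^esub> x = ?c (x g)"
      using g x c[of "x g"] by (simp add: A.m_assoc)
    then show ?thesis using g(1) by (auto simp: Inn_free_group)
  qed
  ultimately show ?thesis unfolding A.normal_inv_iff by blast
qed

lemma group_Out_plus: "group (Out_plus n)"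
  unfolding Out_plus_def by (rule normal.factorgroup_is_group[OF normal_Inn])

definition outer_class :: "nat \<Rightarrow> (letter list \<Rightarrow> letter list) \<Rightarrow> (letter list \<Rightarrow> letter list) set"
  where "outer_class n f = Inn (free_group n) #>\<^bsub>Aut_plus n\<^esub> f"

lemma outer_class_group_hom: "group_hom (Aut_plus n) (Out_plus n) (outer_class n)"
  using normal.r_coset_hom_Mod[OF normal_Inn] group_Aut_plus group_Out_plus
  by (simp add: group_hom_def group_hom_axioms_def Out_plus_def outer_class_def[abs_def])

lemma carrier_Out_plus: "carrier (Out_plus n) = outer_class n ` carrier (Aut_plus n)"
  by (simp add: Out_plus_def carrier_FactGroup outer_class_def)

lemma outer_class_pow:
  "f \<in> carrier (Aut_plus n) \<Longrightarrow> outer_class n f [^]\<^bsub>Out_plus n\<^esub> (k::nat) = outer_class n (f [^]\<^bsub>Aut_plus n\<^esub> k)"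
  unfolding Out_plus_def outer_class_def by (rule normal.FactGroup_pow[OF normal_Inn])

text \<open>Two representatives of an outer class differ by an inner automorphism, which acts
  trivially on the abelianisation. Distinct outer classes are told apart only through this
  invariant.\<close>

lemma outer_class_eq_imp_exponent_sum:
  assumes f: "f \<in> carrier (Aut_plus n)" and g: "g \<in> carrier (Aut_plus n)"
    and eq: "outer_class n f = outer_class n g" and w: "w \<in> carrier (free_group n)"
  shows "exponent_sum i (f w) = exponent_sum i (g w)"
proof -
  interpret A: group "Aut_plus n" by (rule group_Aut_plus)
  have "f \<in> outer_class n f"
    unfolding outer_class_def using A.rcos_self[OF f] normal_Inn normal_imp_subgroup by blast
  then have "f \<in> Inn (free_group n) #>\<^bsub>Aut_plus n\<^esub> g" by (simp only: eq) (simp only: outer_class_def)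
  then obtain h where h: "h \<in> carrier (free_group n)" "f = conjugation n h \<otimes>\<^bsub>Aut_plus n\<^esub> g"
    unfolding r_coset_def Inn_free_group by auto
  have "g w \<in> carrier (free_group n)" using g w auto_closed[of g "free_group n" w] by (simp add: carrier_Aut_plus)
  then show ?thesis
    using h g w conjugation_Aut_plus[OF h(1)] exponent_sum_conjugation[OF h(1)]
    by (simp add: Aut_plus_mult_apply)
qed

section \<open>Generation by transvections\<close>

lemma transvection_fixes:
  assumes ab: "fst a < n" "fst b < n" "fst a \<noteq> fst b"
  shows "w \<in> carrier (free_group n) \<Longrightarrow> fst a \<notin> fst ` set w \<Longrightarrow> transvection n a b w = w"
proof (induction w)
  case Nil
  show ?case
    using hom_one[OF transvection_hom[OF ab] group_free_group group_free_group] by (simp add: one_free_group)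
next
  case (Cons c w)
  note C = Cons_carrier[OF Cons.prems(1)]
  have "c \<noteq> a" "c \<noteq> inv_letter a" using Cons.prems(2) by auto
  then have "transvection n a b [c] = [c]"
    using transvection_apply_letter[OF ab C(1)] by (simp add: transvection_letter_def)
  then show ?case
    using hom_mult[OF transvection_hom[OF ab], of "[c]" w] C Cons by simp
qed

text \<open>The factor \<open>exponent_sum (fst a) [a]\<close> is the sign of the letter
  \<open>a\<close>. It converts exponents of the generator into exponents of \<open>a\<close>, each
  of which contributes one inverse of \<open>b\<close>.\<close>

lemma exponent_sum_transvection:
  assumes ab: "fst a < n" "fst b < n" "fst a \<noteq> fst b"
  shows "w \<in> carrier (free_group n) \<Longrightarrow> exponent_sum i (transvection n a b w) =
    exponent_sum i w - exponent_sum (fst a) w * exponent_sum (fst a) [a] * exponent_sum i [b]"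
proof (induction w)
  case Nil
  show ?case
    using hom_one[OF transvection_hom[OF ab] group_free_group group_free_group] by (simp add: one_free_group)
next
  case (Cons c w)
  note C = Cons_carrier[OF Cons.prems]
  have two: "exponent_sum i [x, y] = exponent_sum i [x] + exponent_sum i [y]" for x y
    using exponent_sum_Cons[of i x "[y]"] .
  have "exponent_sum i (transvection n a b (c # w)) =
      exponent_sum i (transvection_letter a b c) + exponent_sum i (transvection n a b w)"
    using hom_mult[OF transvection_hom[OF ab], of "[c]" w] C transvection_apply_letter[OF ab C(1)]
    by (simp add: mult_free_group exponent_sum_mult)
  moreover have "exponent_sum i (transvection_letter a b c) =
      exponent_sum i [c] - exponent_sum (fst a) [c] * exponent_sum (fst a) [a] * exponent_sum i [b]"
  proof -
    consider "c = a" | "c = inv_letter a" | "fst c \<noteq> fst a" using fst_eq_imp by blast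
    then show ?thesis
    proof cases
      case 3
      then have "c \<noteq> a" "c \<noteq> inv_letter a" by auto
      then show ?thesis using 3 by (simp add: transvection_letter_def exponent_sum_letter)
    qed (simp_all add: transvection_letter_def two exponent_sum_letter)
  qed
  ultimately show ?case
    using Cons.IH[OF C(2)] unfolding exponent_sum_Cons[of _ c w] by (simp add: algebra_simps)
qed

lemma transvection_Aut_plus:
  assumes ab: "fst a < n" "fst b < n" "fst a \<noteq> fst b"
  shows "transvection n a b \<in> carrier (Aut_plus n)"
proof -
  \<comment> \<open>The product of the signs of the two letters, negated because \<open>a\<close> is
    sent to \<open>b^-1 a\<close>; it is the off-diagonal entry of an elementary matrix.\<close>
  let ?c = "- (exponent_sum (fst a) [a] * exponent_sum (fst b) [b])"
  have "abelianised_matrix n (transvection n a b) = addrow_mat n ?c (fst b) (fst a)"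
  proof (rule eq_matI)
    fix i j assume "i < dim_row (addrow_mat n ?c (fst b) (fst a))" "j < dim_col (addrow_mat n ?c (fst b) (fst a))"
    then have ij: "i < n" "j < n" by (simp_all add: addrow_mat_def)
    then show "abelianised_matrix n (transvection n a b) $$ (i, j) = addrow_mat n ?c (fst b) (fst a) $$ (i, j)"
      using exponent_sum_transvection[OF ab, of "[(j, True)]" i]
      by (auto simp: abelianised_matrix_def addrow_mat_def exponent_sum_letter)
  qed (simp_all add: abelianised_matrix_def addrow_mat_def)
  then have "aut_sign n (transvection n a b) = 1"
    using det_addrow_mat[of "fst b" "fst a" n ?c] ab(3) by (simp add: aut_sign_def)
  then show ?thesis using transvection_auto[OF ab] by (simp add: carrier_Aut_plus)
qed

lemma exponent_sum_transvection_pow: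
  assumes ab: "fst a < n" "fst b < n" "fst a \<noteq> fst b" and w: "w \<in> carrier (free_group n)"
  shows "exponent_sum i ((transvection n a b [^]\<^bsub>Aut_plus n\<^esub> (k::nat)) w) =
    exponent_sum i w - int k * exponent_sum (fst a) w * exponent_sum (fst a) [a] * exponent_sum i [b]"
  using w
proof (induction k arbitrary: w)
  case 0
  then show ?case using group.is_monoid[OF group_Aut_plus] by (simp add: Aut_plus_one)
next
  case (Suc k)
  interpret A: group "Aut_plus n" by (rule group_Aut_plus)
  note T = transvection_Aut_plus[OF ab]
  have "transvection n a b w \<in> carrier (free_group n)"
    using auto_closed[OF transvection_auto[OF ab] Suc.prems] .
  from Suc.IH[OF this] show ?case
    using Suc.prems T exponent_sum_transvection[OF ab Suc.prems] ab(3)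
    by (simp add: Aut_plus_mult_apply exponent_sum_letter algebra_simps)
qed

text \<open>Each map alters one generator, these are different, and neither is the multiplier of the
  other map. The multipliers \<open>b\<close> and \<open>d\<close> may belong to the same generator,
  which is exploited when commuting transvections are chosen.\<close>

lemma transvections_commute:
  assumes ab: "fst a < n" "fst b < n" "fst a \<noteq> fst b" and cd: "fst c < n" "fst d < n" "fst c \<noteq> fst d"
    and ac: "fst a \<noteq> fst c" and ad: "fst a \<noteq> fst d" and bc: "fst b \<noteq> fst c"
  shows "transvection n a b \<otimes>\<^bsub>Aut_plus n\<^esub> transvection n c d = transvection n c d \<otimes>\<^bsub>Aut_plus n\<^esub> transvection n a b"
proof -
  interpret A: group "Aut_plus n" by (rule group_Aut_plus)
  have swap: "transvection n a b (transvection n c d [e]) = transvection n c d (transvection n a b [e])"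
    if e: "fst e < n" "fst e \<noteq> fst a" and ab: "fst a < n" "fst b < n" "fst a \<noteq> fst b"
      and cd: "fst c < n" "fst d < n" "fst c \<noteq> fst d" and "fst a \<noteq> fst c" "fst a \<noteq> fst d" for a b c d e
  proof -
    have "set (transvection n c d [e]) \<subseteq> {e, c, inv_letter c, d, inv_letter d}"
      using transvection_apply_letter[OF cd e(1)] by (auto simp: transvection_letter_def)
    then have "fst a \<notin> fst ` set (transvection n c d [e])" using that by auto
    moreover have "transvection n c d [e] \<in> carrier (free_group n)"
      using auto_closed[OF transvection_auto[OF cd]] e(1) by simp
    ultimately show ?thesis using transvection_fixes[OF ab] e by simp
  qed
  show ?thesis
  proof (rule Aut_plus_eqI)
    fix e :: letter assume e: "fst e < n"
    have "transvection n a b (transvection n c d [e]) = transvection n c d (transvection n a b [e])"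
    proof (cases "fst e = fst a")
      case True
      then have "fst e \<noteq> fst c" using ac by simp
      then show ?thesis using swap[of e c d a b] e ab cd ac bc by simp
    next
      case False
      then show ?thesis using swap[of e a b c d] e ab cd ac ad by simp
    qed
    then show "(transvection n a b \<otimes>\<^bsub>Aut_plus n\<^esub> transvection n c d) [e] =
        (transvection n c d \<otimes>\<^bsub>Aut_plus n\<^esub> transvection n a b) [e]"
      using e transvection_Aut_plus[OF ab] transvection_Aut_plus[OF cd] by (simp add: Aut_plus_mult_apply)
  qed (use transvection_Aut_plus[OF ab] transvection_Aut_plus[OF cd] in simp_all)
qed

definition transvections :: "nat \<Rightarrow> (letter list \<Rightarrow> letter list) set"
  where "transvections n = {transvection n a b | a b. fst a < n \<and> fst b < n \<and> fst a \<noteq> fst b}"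

definition special_letter_permutations :: "nat \<Rightarrow> (letter list \<Rightarrow> letter list) set"
  where "special_letter_permutations n = {f \<in> carrier (Aut_plus n). letter_permutation n f}"

lemma transvection_mem_transvections:
  "fst a < n \<Longrightarrow> fst b < n \<Longrightarrow> fst a \<noteq> fst b \<Longrightarrow> transvection n a b \<in> transvections n"
  unfolding transvections_def by blast

lemma transvections_subset: "transvections n \<subseteq> carrier (Aut_plus n)"
  using transvection_Aut_plus by (auto simp: transvections_def)

lemma finite_transvections: "finite (transvections n)"
proof -
  have "transvections n \<subseteq> case_prod (transvection n) ` (letters n \<times> letters n)"
    by (force simp: transvections_def letters_def)
  then show ?thesis using finite_letters finite_subset by blast
qed

lemma finite_special_letter_permutations: "finite (special_letter_permutations n)"
proof -
  let ?r = "\<lambda>f. restrict (\<lambda>a. f [a]) (letters n)"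
  have "?r ` special_letter_permutations n \<subseteq> PiE (letters n) (\<lambda>_. (\<lambda>c. [c]) ` letters n)"
  proof (intro image_subsetI restrict_PiE_iff[THEN iffD2] ballI)
    fix f a assume "f \<in> special_letter_permutations n" "a \<in> letters n"
    then show "f [a] \<in> (\<lambda>c. [c]) ` letters n"
      unfolding special_letter_permutations_def letter_permutation_def letters_def by blast
  qed
  moreover have "finite (PiE (letters n) (\<lambda>_. (\<lambda>c. [c]) ` letters n))"
    using finite_letters by (intro finite_PiE) auto
  moreover have "inj_on ?r (special_letter_permutations n)"
  proof (rule inj_onI)
    fix f g assume fg: "f \<in> special_letter_permutations n" "g \<in> special_letter_permutations n" "?r f = ?r g"
    have "f [a] = g [a]" if "fst a < n" for a
      using fun_cong[OF fg(3), of a] that by (simp add: letters_def)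
    then show "f = g" using fg(1,2) by (intro Aut_plus_eqI) (auto simp: special_letter_permutations_def)
  qed
  ultimately show ?thesis using finite_subset finite_imageD by metis
qed

text \<open>Nielsen's theorem: an automorphism that no transvection makes smaller permutes the letters.\<close>

lemma Aut_plus_generated:
  "carrier (Aut_plus n) = generate (Aut_plus n) (transvections n \<union> special_letter_permutations n)"
proof -
  interpret A: group "Aut_plus n" by (rule group_Aut_plus)
  let ?X = "transvections n \<union> special_letter_permutations n"
  have X: "?X \<subseteq> carrier (Aut_plus n)"
    using transvections_subset by (auto simp: special_letter_permutations_def)
  have "f \<in> carrier (Aut_plus n) \<Longrightarrow> f \<in> generate (Aut_plus n) ?X" for f
  proof (induction f rule: wf_induct_rule[OF wf_nielsen_less[of n]])
    case (1 f)
    have f: "f \<in> auto (free_group n)" using 1(2) by (simp add: carrier_Aut_plus)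
    show ?case
    proof (cases "nielsen_minimal n f")
      case True
      then have "f \<in> ?X"
        using minimal_letter_permutation[OF f] 1(2) by (simp add: special_letter_permutations_def)
      then show ?thesis by (rule generate.incl)
    next
      case False
      then obtain a b where ab: "fst a < n" "fst b < n" "fst a \<noteq> fst b"
        and less: "(compose (carrier (free_group n)) f (transvection n a b), f) \<in> nielsen_less n"
        unfolding nielsen_minimal_def by blast
      let ?T = "transvection n a b"
      have T: "?T \<in> carrier (Aut_plus n)" "?T \<in> ?X"
        using transvection_Aut_plus[OF ab] transvection_mem_transvections[OF ab] by simp_all
      have "f \<otimes>\<^bsub>Aut_plus n\<^esub> ?T \<in> generate (Aut_plus n) ?X"
        using 1(1)[of "f \<otimes>\<^bsub>Aut_plus n\<^esub> ?T"] less 1(2) T(1) by (simp add: Aut_plus_mult[OF 1(2) T(1)]) 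
          (metis A.m_closed Aut_plus_mult)
      then have "(f \<otimes>\<^bsub>Aut_plus n\<^esub> ?T) \<otimes>\<^bsub>Aut_plus n\<^esub> inv\<^bsub>Aut_plus n\<^esub> ?T \<in> generate (Aut_plus n) ?X"
        by (rule generate.eng[OF _ generate.inv[OF T(2)]])
      then show ?thesis using 1(2) T(1) by (simp add: A.m_assoc)
    qed
  qed
  then show ?thesis using A.generate_incl[OF X] by blast
qed

text \<open>Conjugation by a permutation of the letters only relabels: with
  \<open>f [c] = [\<sigma> c]\<close>, the result is the transvection for \<open>\<sigma> a\<close>
  and \<open>\<sigma> b\<close>.\<close>

lemma letter_permutation_conjugates_transvection:
  assumes f: "f \<in> special_letter_permutations n" and T: "T \<in> transvections n"
  shows "f \<otimes>\<^bsub>Aut_plus n\<^esub> T \<otimes>\<^bsub>Aut_plus n\<^esub> inv\<^bsub>Aut_plus n\<^esub> f \<in> transvections n"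
proof -
  interpret A: group "Aut_plus n" by (rule group_Aut_plus)
  obtain a b where ab: "fst a < n" "fst b < n" "fst a \<noteq> fst b" and T: "T = transvection n a b"
    using T unfolding transvections_def by blast
  have fA: "f \<in> carrier (Aut_plus n)" and fperm: "letter_permutation n f"
    using f by (auto simp: special_letter_permutations_def)
  have fa: "f \<in> auto (free_group n)" using fA by (simp add: carrier_Aut_plus)
  obtain \<sigma> where \<sigma>: "\<And>c. fst c < n \<Longrightarrow> fst (\<sigma> c) < n" "\<And>c. fst c < n \<Longrightarrow> f [c] = [\<sigma> c]"
    using fperm unfolding letter_permutation_def by metis
  have \<sigma>_inv: "\<sigma> (inv_letter c) = inv_letter (\<sigma> c)" if "fst c < n" for c
    using auto_inv_letter[OF fa that] \<sigma>(2) that by simp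
  have \<sigma>_inj: "c = e" if "fst c < n" "fst e < n" "\<sigma> c = \<sigma> e" for c e
    using auto_inj[OF fa, of "[c]" "[e]"] \<sigma>(2) that by simp
  have \<sigma>ab: "fst (\<sigma> a) < n" "fst (\<sigma> b) < n" "fst (\<sigma> a) \<noteq> fst (\<sigma> b)"
  proof -
    show "fst (\<sigma> a) \<noteq> fst (\<sigma> b)"
    proof
      assume "fst (\<sigma> a) = fst (\<sigma> b)"
      then have "\<sigma> a = \<sigma> b \<or> \<sigma> a = \<sigma> (inv_letter b)" using fst_eq_imp \<sigma>_inv[OF ab(2)] by metis
      then show False using \<sigma>_inj[of a b] \<sigma>_inj[of a "inv_letter b"] ab by auto
    qed
  qed (use \<sigma> ab in auto)
  let ?T' = "transvection n (\<sigma> a) (\<sigma> b)"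
  note TA = transvection_Aut_plus[OF ab] and TA' = transvection_Aut_plus[OF \<sigma>ab]
  have f2: "f [x, y] = [\<sigma> x, \<sigma> y]" if "fst x < n" "fst y < n" "y \<noteq> inv_letter x" for x y
  proof -
    have xy: "[x, y] \<in> carrier (free_group n)" using that by (auto simp: carrier_free_group reduced_Cons)
    have "\<sigma> y \<noteq> inv_letter (\<sigma> x)" using \<sigma>_inj[of y "inv_letter x"] \<sigma>_inv[OF that(1)] that by auto
    then show ?thesis
      using hom_mult[OF auto_hom[OF fa], of "[x]" "[y]"] Cons_carrier(3)[OF xy] that \<sigma>(2)
      by (simp add: mult_free_group rcons_def)
  qed
  have "f \<otimes>\<^bsub>Aut_plus n\<^esub> T = ?T' \<otimes>\<^bsub>Aut_plus n\<^esub> f"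
  proof (rule Aut_plus_eqI)
    fix e :: letter assume e: "fst e < n"
    have ne: "a \<noteq> b" "a \<noteq> inv_letter b" "b \<noteq> inv_letter a" "b \<noteq> a" using ab(3) by auto
    have "f (transvection_letter a b e) = transvection_letter (\<sigma> a) (\<sigma> b) (\<sigma> e)"
    proof -
      consider "e = a" | "e = inv_letter a" | "e \<noteq> a" "e \<noteq> inv_letter a" by blast
      then show ?thesis
      proof cases
        case 1
        then show ?thesis using f2[of "inv_letter b" a] ab ne \<sigma>_inv by (simp add: transvection_letter_def)
      next
        case 2
        then show ?thesis using f2[of "inv_letter a" b] ab ne \<sigma>_inv by (simp add: transvection_letter_def)
      next
        case 3
        then have "\<sigma> e \<noteq> \<sigma> a" "\<sigma> e \<noteq> inv_letter (\<sigma> a)"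
          using \<sigma>_inj[of e a] \<sigma>_inj[of e "inv_letter a"] \<sigma>_inv[OF ab(1)] e ab by auto
        then show ?thesis using 3 \<sigma>(2)[OF e] by (simp add: transvection_letter_def)
      qed
    qed
    then show "(f \<otimes>\<^bsub>Aut_plus n\<^esub> T) [e] = (?T' \<otimes>\<^bsub>Aut_plus n\<^esub> f) [e]"
      using e fA TA TA' T \<sigma>(1)[OF e] \<sigma>(2)[OF e] transvection_apply_letter[OF ab e]
        transvection_apply_letter[OF \<sigma>ab \<sigma>(1)[OF e]]
      by (simp add: Aut_plus_mult_apply)
  qed (use fA TA TA' T in simp_all)
  then have "f \<otimes>\<^bsub>Aut_plus n\<^esub> T \<otimes>\<^bsub>Aut_plus n\<^esub> inv\<^bsub>Aut_plus n\<^esub> f = ?T'"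
    using fA TA' by (simp add: A.m_assoc)
  then show ?thesis using \<sigma>ab unfolding transvections_def by blast
qed

lemma Out_plus_generated:
  "carrier (Out_plus n) = generate (Out_plus n)
    (outer_class n ` transvections n \<union> outer_class n ` special_letter_permutations n)"
proof -
  have "transvections n \<union> special_letter_permutations n \<subseteq> carrier (Aut_plus n)"
    using transvections_subset by (auto simp: special_letter_permutations_def)
  from group_hom.generate_img[OF outer_class_group_hom this] show ?thesis
    by (simp add: carrier_Out_plus image_Un flip: Aut_plus_generated)
qed

text \<open>The exponent of the generator of \<open>b\<close> in the image of \<open>a\<close> is
  \<open>k\<close> up to sign for the \<open>k\<close>-th power, and the outer class determines this
  exponent.\<close>

lemma inj_outer_transvection_pow:
  assumes ab: "fst a < n" "fst b < n" "fst a \<noteq> fst b"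
  shows "inj (\<lambda>k::nat. outer_class n (transvection n a b) [^]\<^bsub>Out_plus n\<^esub> k)"
proof (rule injI)
  interpret A: group "Aut_plus n" by (rule group_Aut_plus)
  fix k l :: nat
  note T = transvection_Aut_plus[OF ab]
  assume "outer_class n (transvection n a b) [^]\<^bsub>Out_plus n\<^esub> k = outer_class n (transvection n a b) [^]\<^bsub>Out_plus n\<^esub> l"
  then have "outer_class n (transvection n a b [^]\<^bsub>Aut_plus n\<^esub> k) = outer_class n (transvection n a b [^]\<^bsub>Aut_plus n\<^esub> l)"
    using T by (simp add: outer_class_pow)
  from outer_class_eq_imp_exponent_sum[OF _ _ this, of "[a]" "fst b"] show "k = l"
    using T ab exponent_sum_transvection_pow[OF ab, of "[a]" "fst b"]
    by (simp add: exponent_sum_letter split: if_splits)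
qed

theorem corollary15:
  fixes n :: nat
  assumes "n \<ge> 5"
  shows "not_strongly_relatively_hyperbolic TYPE('v) TYPE('e) (Out_plus n)"
proof -
  interpret A: group "Aut_plus n" by (rule group_Aut_plus)
  interpret O: group "Out_plus n" by (rule group_Out_plus)
  interpret \<pi>: group_hom "Aut_plus n" "Out_plus n" "outer_class n" by (rule outer_class_group_hom)
  let ?\<pi> = "outer_class n"
  let ?S = "?\<pi> ` transvections n" and ?W = "?\<pi> ` special_letter_permutations n"
  have SW: "?S \<subseteq> carrier (Out_plus n)" "?W \<subseteq> carrier (Out_plus n)"
    using transvections_subset by (auto simp: carrier_Out_plus special_letter_permutations_def)
  have "finitely_generated_subgroup (carrier (Out_plus n)) (Out_plus n)"
    unfolding finitely_generated_subgroup_def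
    using O.subgroup_self SW finite_transvections finite_special_letter_permutations Out_plus_generated[of n]
    by (intro conjI exI[of _ "?S \<union> ?W"]) auto
  moreover have "\<not> strongly_relatively_hyperbolic TYPE('v) TYPE('e) (Out_plus n) \<L>" for \<L>
  proof -
    define T where "T a b = transvection n a b" for a b
    have T: "T a b \<in> carrier (Aut_plus n)" "?\<pi> (T a b) \<in> ?S" if "fst a < n" "fst b < n" "fst a \<noteq> fst b" for a b
      using transvection_Aut_plus[OF that] transvection_mem_transvections[OF that] by (simp_all add: T_def)
    have commute: "?\<pi> (T a b) \<otimes>\<^bsub>Out_plus n\<^esub> ?\<pi> (T c d) = ?\<pi> (T c d) \<otimes>\<^bsub>Out_plus n\<^esub> ?\<pi> (T a b)"
      if "fst a < n" "fst b < n" "fst a \<noteq> fst b" "fst c < n" "fst d < n" "fst c \<noteq> fst d"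
        "fst a \<noteq> fst c" "fst a \<noteq> fst d" "fst b \<noteq> fst c" for a b c d
      using transvections_commute[OF that] T that by (simp add: T_def flip: \<pi>.hom_mult)
    \<comment> \<open>This needs the full bound \<open>n \<ge> 5\<close>: the indices to be avoided
      are those of two transvections, up to four.\<close>
    have fresh: "\<exists>i<n. i \<notin> X" if "finite X" "card X \<le> 4" for X
    proof (rule ccontr)
      assume "\<not> ?thesis"
      then have "{..<n} \<subseteq> X" by auto
      then show False using card_mono[OF that(1), of "{..<n}"] that(2) assms by simp
    qed
    have card4: "card {i, j, k, l} \<le> 4" for i j k l :: nat
      using card_length[of "[i, j, k, l]"] by simp
    define x where "x i = (i::nat, True)" for i
    \<comment> \<open>The three transvections share the multiplier \<open>x 1\<close> and alter the
      different generators \<open>x 0\<close>, \<open>x 2\<close> and \<open>x 3\<close>, so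
      \<open>?b\<close> and \<open>?c\<close> commute with \<open>?a\<close> and are independent of
      each other.\<close>
    let ?a = "T (x 0) (x 1)" and ?b = "T (x 2) (x 1)" and ?c = "T (x 3) (x 1)"
    have fst_x [simp]: "fst (x i) = i" for i by (simp add: x_def)
    show ?thesis
    proof (rule O.not_strongly_relatively_hyperbolic_if_commuting[OF SW(1) _ _ _ _ _ _ _ _ SW(2) _ Out_plus_generated])
      fix s assume "s \<in> ?S"
      then show "inj (\<lambda>k::nat. s [^]\<^bsub>Out_plus n\<^esub> k)"
        using inj_outer_transvection_pow unfolding transvections_def by auto
    next
      fix s t assume "s \<in> ?S" "t \<in> ?S"
      then obtain a b c d where s: "s = ?\<pi> (T a b)" "fst a < n" "fst b < n" "fst a \<noteq> fst b"
        and t: "t = ?\<pi> (T c d)" "fst c < n" "fst d < n" "fst c \<noteq> fst d"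
        unfolding transvections_def T_def by blast
      obtain i where i: "i < n" "i \<notin> {fst a, fst b, fst c, fst d}"
        using fresh[of "{fst a, fst b, fst c, fst d}"] card4 by auto
      \<comment> \<open>The multiplier only has to avoid the altered generators; it may coincide
        with the multiplier of \<open>s\<close> or of \<open>t\<close>.\<close>
      obtain j where j: "j < n" "j \<notin> {fst a, fst c, i}"
        using fresh[of "{fst a, fst c, i, i}"] card4[of "fst a" "fst c" i i] by auto
      have "?\<pi> (T (x i) (x j)) \<in> ?S" using T i j by simp
      moreover have "s \<otimes>\<^bsub>Out_plus n\<^esub> ?\<pi> (T (x i) (x j)) = ?\<pi> (T (x i) (x j)) \<otimes>\<^bsub>Out_plus n\<^esub> s"
        "t \<otimes>\<^bsub>Out_plus n\<^esub> ?\<pi> (T (x i) (x j)) = ?\<pi> (T (x i) (x j)) \<otimes>\<^bsub>Out_plus n\<^esub> t"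
        using commute s t i j by auto
      ultimately show "\<exists>u\<in>?S. s \<otimes>\<^bsub>Out_plus n\<^esub> u = u \<otimes>\<^bsub>Out_plus n\<^esub> s \<and> t \<otimes>\<^bsub>Out_plus n\<^esub> u = u \<otimes>\<^bsub>Out_plus n\<^esub> t"
        by blast
    next
      show "?\<pi> ?a \<in> ?S" "?\<pi> ?b \<in> carrier (Out_plus n)" "?\<pi> ?c \<in> carrier (Out_plus n)"
        using T SW(1) assms by auto
      show "?\<pi> ?a \<otimes>\<^bsub>Out_plus n\<^esub> ?\<pi> ?b = ?\<pi> ?b \<otimes>\<^bsub>Out_plus n\<^esub> ?\<pi> ?a"
        "?\<pi> ?a \<otimes>\<^bsub>Out_plus n\<^esub> ?\<pi> ?c = ?\<pi> ?c \<otimes>\<^bsub>Out_plus n\<^esub> ?\<pi> ?a"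
        using commute assms by auto
    next
      have bc: "?b \<in> carrier (Aut_plus n)" "?c \<in> carrier (Aut_plus n)" using T assms by auto
      \<comment> \<open>In the images of \<open>x 2\<close> and \<open>x 3\<close> the exponent of
        generator \<open>1\<close> is \<open>- i\<close> and \<open>- j\<close>, so the outer class
        determines both powers.\<close>
      have exponent: "exponent_sum 1 ((?b [^]\<^bsub>Aut_plus n\<^esub> i \<otimes>\<^bsub>Aut_plus n\<^esub> ?c [^]\<^bsub>Aut_plus n\<^esub> j) [x m]) =
          exponent_sum 1 [x m] - int j * exponent_sum 3 [x m] - int i * exponent_sum 2 [x m]"
        if "m < n" for i j m :: nat
      proof -
        have c: "(?c [^]\<^bsub>Aut_plus n\<^esub> j) [x m] \<in> carrier (free_group n)"
          using auto_closed[of "?c [^]\<^bsub>Aut_plus n\<^esub> j" "free_group n" "[x m]"] bc(2) that A.nat_pow_closed[OF bc(2), of j]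
          by (simp add: carrier_Aut_plus)
        show ?thesis
          using exponent_sum_transvection_pow[of "x 2" n "x 1" _ 1 i] exponent_sum_transvection_pow[of "x 3" n "x 1" "[x m]" _ j]
            c bc that assms
          by (simp add: Aut_plus_mult_apply T_def exponent_sum_letter[of _ "x _"] x_def exponent_sum_letter)
      qed
      show "inj (\<lambda>(i::nat, j::nat). ?\<pi> ?b [^]\<^bsub>Out_plus n\<^esub> i \<otimes>\<^bsub>Out_plus n\<^esub> ?\<pi> ?c [^]\<^bsub>Out_plus n\<^esub> j)"
      proof (rule injI, clarify)
        fix i j k l :: nat
        assume "?\<pi> ?b [^]\<^bsub>Out_plus n\<^esub> i \<otimes>\<^bsub>Out_plus n\<^esub> ?\<pi> ?c [^]\<^bsub>Out_plus n\<^esub> j =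
          ?\<pi> ?b [^]\<^bsub>Out_plus n\<^esub> k \<otimes>\<^bsub>Out_plus n\<^esub> ?\<pi> ?c [^]\<^bsub>Out_plus n\<^esub> l"
        then have "?\<pi> (?b [^]\<^bsub>Aut_plus n\<^esub> i \<otimes>\<^bsub>Aut_plus n\<^esub> ?c [^]\<^bsub>Aut_plus n\<^esub> j) =
          ?\<pi> (?b [^]\<^bsub>Aut_plus n\<^esub> k \<otimes>\<^bsub>Aut_plus n\<^esub> ?c [^]\<^bsub>Aut_plus n\<^esub> l)"
          using bc by (simp add: outer_class_pow)
        note eq = outer_class_eq_imp_exponent_sum[OF _ _ this, of "[x m]" 1 for m]
        have "exponent_sum 1 [x m] - int j * exponent_sum 3 [x m] - int i * exponent_sum 2 [x m] =
            exponent_sum 1 [x m] - int l * exponent_sum 3 [x m] - int k * exponent_sum 2 [x m]" if "m < n" for m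
          unfolding exponent[OF that, symmetric] by (rule eq) (use bc that in auto)
        from this[of 2] this[of 3] show "i = k \<and> j = l" using assms by (simp add: exponent_sum_letter x_def)
      qed
    next
      fix w s assume "w \<in> ?W" "s \<in> ?S"
      then obtain f g where fg: "f \<in> special_letter_permutations n" "w = ?\<pi> f" "g \<in> transvections n" "s = ?\<pi> g" by blast
      have "f \<in> carrier (Aut_plus n)" "g \<in> carrier (Aut_plus n)"
        using fg transvections_subset by (auto simp: special_letter_permutations_def)
      then have "w \<otimes>\<^bsub>Out_plus n\<^esub> s \<otimes>\<^bsub>Out_plus n\<^esub> inv\<^bsub>Out_plus n\<^esub> w =
          ?\<pi> (f \<otimes>\<^bsub>Aut_plus n\<^esub> g \<otimes>\<^bsub>Aut_plus n\<^esub> inv\<^bsub>Aut_plus n\<^esub> f)" using fg by simp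
      then show "w \<otimes>\<^bsub>Out_plus n\<^esub> s \<otimes>\<^bsub>Out_plus n\<^esub> inv\<^bsub>Out_plus n\<^esub> w \<in> ?S"
        using letter_permutation_conjugates_transvection[OF fg(1,3)] by blast
    qed
  qed
  ultimately show ?thesis unfolding not_strongly_relatively_hyperbolic_def using group_Out_plus by blast
qed

end
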